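(* Let $M^4_r$ be a biharmonic nondegenerate hypersurface of a pseudo-Riemannian space form $N^5_s(c)$. Suppose that $M^4_r$ has exactly two distinct principal curvatures and that both are imaginary (non-real). Then $M^4_r$ is minimal, i.e. $H=0$ identically.
   Context: Manifolds are smooth. $N^5_s(c)$ denotes a $5$-dimensional pseudo-Riemannian space form of index $s$ and constant sectional curvature $c\in\mathbb{R}$. A nondegenerate hypersurface $M^4_r$ is a $4$-dimensional manifold isometrically immersed in $N^5_s(c)$ whose induced metric is nondegenerate, of index $r$. Let $\vec\xi$ be a unit normal vector field, $\varepsilon=\langle\vec\xi,\vec\xi\rangle=\pm1$. $\nabla$ and $\widetilde\nabla$ are the Levi-Civita connections of $M^4_r$ and $N^5_s(c)$; $A$ is the shape operator, $\widetilde\nabla_X\vec\xi=-AX$. The mean curvature is $H=\frac14\varepsilon\,\mathrm{tr}A$ and $\vec H=H\vec\xi$. The Laplacian is $\Delta\vec H=-\sum_{i=1}^4\varepsilon_i(\widetilde\nabla_{e_i}\widetilde\nabla_{e_i}\vec H-\widetilde\nabla_{\nabla_{e_i}e_i}\vec H)$ for a local orthonormal frame $\{e_i\}$ of $M^4_r$ with $\langle e_i,e_i\rangle=\varepsilon_i=\pm1$. The hypersurface is biharmonic if $\Delta\vec H=4c\,\vec H$. Principal curvatures are the eigenvalues of $A$ over $\mathbb{C}$; "imaginary" means non-real. *)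

theory Defs
  imports "HOL-Analysis.Analysis"
begin

section \<open>Smooth maps and smooth manifolds\<close>

text \<open>
  Only used on open \<open>S\<close>, where it says that all partial derivatives of order at most \<open>k\<close> exist
  and are continuous.
\<close>

primrec Ck_on :: "nat \<Rightarrow> (real^'n) set \<Rightarrow> (real^'n \<Rightarrow> 'b::real_normed_vector) \<Rightarrow> bool" where
  "Ck_on 0 S f \<longleftrightarrow> continuous_on S f"
| "Ck_on (Suc k) S f \<longleftrightarrow> (\<forall>x\<in>S. f differentiable (at x)) \<and>
     (\<forall>i. Ck_on k S (\<lambda>x. frechet_derivative f (at x) (axis i 1)))"

definition smooth_on :: "(real^'n) set \<Rightarrow> (real^'n \<Rightarrow> 'b::real_normed_vector) \<Rightarrow> bool" where
  "smooth_on S f \<longleftrightarrow> (\<forall>k. Ck_on k S f)"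

text \<open>
  A chart is a coordinate domain together with its coordinate map. A manifold is a whole type,
  Hausdorff and second countable by its type classes, with an atlas of smoothly compatible charts.
\<close>

type_synonym ('m, 'n) chart = "'m set \<times> ('m \<Rightarrow> real^'n)"

definition chart_inv :: "('m, 'n) chart \<Rightarrow> real^'n \<Rightarrow> 'm" where
  "chart_inv c = inv_into (fst c) (snd c)"

definition is_chart :: "('m::topological_space, 'n::finite) chart \<Rightarrow> bool" where
  "is_chart c \<longleftrightarrow> open (fst c) \<and> open (snd c ` fst c) \<and>
     homeomorphism (fst c) (snd c ` fst c) (snd c) (chart_inv c)"

definition transition :: "('m, 'n) chart \<Rightarrow> ('m, 'n) chart \<Rightarrow> real^'n \<Rightarrow> real^'n" where
  "transition c d = snd d \<circ> chart_inv c"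

definition smooth_atlas ::
  "('m::{t2_space, second_countable_topology}, 'n::finite) chart set \<Rightarrow> bool" where
  "smooth_atlas \<A> \<longleftrightarrow> (\<forall>c\<in>\<A>. is_chart c) \<and> (\<Union>c\<in>\<A>. fst c) = UNIV \<and>
     (\<forall>c\<in>\<A>. \<forall>d\<in>\<A>. smooth_on (snd c ` (fst c \<inter> fst d)) (transition c d))"

text \<open>The coordinate expression of a map \<open>f\<close> in charts \<open>c\<close>, \<open>d\<close>, and the set on which it lives.\<close>

definition local_rep :: "('m, 'n) chart \<Rightarrow> ('k, 'p) chart \<Rightarrow> ('m \<Rightarrow> 'k) \<Rightarrow> real^'n \<Rightarrow> real^'p" where
  "local_rep c d f = snd d \<circ> f \<circ> chart_inv c"

definition local_dom :: "('m, 'n) chart \<Rightarrow> ('k, 'p) chart \<Rightarrow> ('m \<Rightarrow> 'k) \<Rightarrow> (real^'n) set" where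
  "local_dom c d f = snd c ` (fst c \<inter> f -` fst d)"

definition smooth_map ::
  "('m::topological_space, 'n::finite) chart set \<Rightarrow> ('k::topological_space, 'p::finite) chart set
     \<Rightarrow> ('m \<Rightarrow> 'k) \<Rightarrow> bool" where
  "smooth_map \<A> \<B> f \<longleftrightarrow> continuous_on UNIV f \<and>
     (\<forall>c\<in>\<A>. \<forall>d\<in>\<B>. smooth_on (local_dom c d f) (local_rep c d f))"


section \<open>Pseudo-Riemannian metrics, connections and curvature\<close>

text \<open>
  In coordinates a metric is a matrix-valued function \<open>G\<close>. On a manifold it is given by one such
  function \<open>g c\<close> for every chart \<open>c\<close> of the atlas, subject to the tensor transformation law.
\<close>

type_synonym 'n metric_field = "real^'n \<Rightarrow> real^'n^'n"

definition ip :: "'n metric_field \<Rightarrow> real^'n \<Rightarrow> real^'n \<Rightarrow> real^'n \<Rightarrow> real" where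
  "ip G x v w = v \<bullet> (G x *v w)"

definition metric_index :: "real^'n^'n \<Rightarrow> nat" where
  "metric_index B = Max {dim S | S. subspace S \<and> (\<forall>v\<in>S. v \<noteq> 0 \<longrightarrow> v \<bullet> (B *v v) < 0)}"

definition pseudo_riemannian_metric ::
  "('m, 'n::finite) chart set \<Rightarrow> (('m, 'n) chart \<Rightarrow> 'n metric_field) \<Rightarrow> nat \<Rightarrow> bool" where
  "pseudo_riemannian_metric \<A> g s \<longleftrightarrow>
     (\<forall>c\<in>\<A>. smooth_on (snd c ` fst c) (g c) \<and>
        (\<forall>x \<in> snd c ` fst c.
           transpose (g c x) = g c x \<and> invertible (g c x) \<and> metric_index (g c x) = s)) \<and>
     (\<forall>c\<in>\<A>. \<forall>d\<in>\<A>. \<forall>x \<in> snd c ` (fst c \<inter> fst d).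
        g c x = transpose (jacobian (transition c d) (at x)) ** g d (transition c d x)
                  ** jacobian (transition c d) (at x))"

definition christoffel :: "'n metric_field \<Rightarrow> real^'n \<Rightarrow> 'n \<Rightarrow> 'n \<Rightarrow> 'n \<Rightarrow> real" where
  "christoffel G x k i j =
     (1/2) * (\<Sum>l\<in>UNIV. matrix_inv (G x) $ k $ l *
       (frechet_derivative G (at x) (axis i 1) $ j $ l
        + frechet_derivative G (at x) (axis j 1) $ i $ l
        - frechet_derivative G (at x) (axis l 1) $ i $ j))"

text \<open>
  For a map \<open>F\<close> into a coordinate domain with metric \<open>G\<close>, a vector field \<open>X\<close> on the source and a
  vector field \<open>V\<close> along \<open>F\<close>, this is the derivative of \<open>V\<close> along \<open>X\<close> with respect to the pullback
  of the Levi-Civita connection of \<open>G\<close>. Vector fields are given by their coordinate components.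
\<close>

definition cov_along ::
  "'p metric_field \<Rightarrow> (real^'n \<Rightarrow> real^'p) \<Rightarrow> (real^'n \<Rightarrow> real^'n) \<Rightarrow> (real^'n \<Rightarrow> real^'p)
     \<Rightarrow> real^'n \<Rightarrow> real^'p" where
  "cov_along G F X V x = frechet_derivative V (at x) (X x) +
     (\<chi> k. \<Sum>i\<in>UNIV. \<Sum>j\<in>UNIV.
        christoffel G (F x) k i j * frechet_derivative F (at x) (X x) $ i * V x $ j)"

definition levi_civita ::
  "'n metric_field \<Rightarrow> (real^'n \<Rightarrow> real^'n) \<Rightarrow> (real^'n \<Rightarrow> real^'n) \<Rightarrow> real^'n \<Rightarrow> real^'n" where
  "levi_civita G X Y = cov_along G (\<lambda>x. x) X Y"

text \<open>
  \<open>R(v,w)z\<close>, computed on the extensions of \<open>v\<close>, \<open>w\<close>, \<open>z\<close> with constant components; the term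
  with the Lie bracket of \<open>v\<close> and \<open>w\<close> vanishes for these.
\<close>

definition riemann :: "'n metric_field \<Rightarrow> real^'n \<Rightarrow> real^'n \<Rightarrow> real^'n \<Rightarrow> real^'n \<Rightarrow> real^'n" where
  "riemann G x v w z =
     levi_civita G (\<lambda>_. v) (levi_civita G (\<lambda>_. w) (\<lambda>_. z)) x
     - levi_civita G (\<lambda>_. w) (levi_civita G (\<lambda>_. v) (\<lambda>_. z)) x"

definition area_form :: "'n metric_field \<Rightarrow> real^'n \<Rightarrow> real^'n \<Rightarrow> real^'n \<Rightarrow> real" where
  "area_form G x v w = ip G x v v * ip G x w w - (ip G x v w)^2"

definition sectional_curvature :: "'n metric_field \<Rightarrow> real^'n \<Rightarrow> real^'n \<Rightarrow> real^'n \<Rightarrow> real" where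
  "sectional_curvature G x v w = ip G x (riemann G x v w w) v / area_form G x v w"

text \<open>
  Neither completeness nor (simple) connectedness is required. The planes spanned by \<open>v\<close>, \<open>w\<close>
  with \<open>area_form G x v w \<noteq> 0\<close> are exactly the nondegenerate ones.
\<close>

definition space_form ::
  "('k::{t2_space, second_countable_topology}, 'p::finite) chart set
     \<Rightarrow> (('k, 'p) chart \<Rightarrow> 'p metric_field) \<Rightarrow> nat \<Rightarrow> real \<Rightarrow> bool" where
  "space_form \<B> h s \<kappa> \<longleftrightarrow> smooth_atlas \<B> \<and> pseudo_riemannian_metric \<B> h s \<and>
     (\<forall>d\<in>\<B>. \<forall>y \<in> snd d ` fst d. \<forall>v w.
        area_form (h d) y v w \<noteq> 0 \<longrightarrow> sectional_curvature (h d) y v w = \<kappa>)"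


section \<open>Nondegenerate hypersurfaces\<close>

definition isometric_immersion ::
  "('m::topological_space, 'n::finite) chart set \<Rightarrow> (('m, 'n) chart \<Rightarrow> 'n metric_field)
     \<Rightarrow> ('k::topological_space, 'p::finite) chart set \<Rightarrow> (('k, 'p) chart \<Rightarrow> 'p metric_field)
     \<Rightarrow> ('m \<Rightarrow> 'k) \<Rightarrow> bool" where
  "isometric_immersion \<A> g \<B> h f \<longleftrightarrow> smooth_map \<A> \<B> f \<and>
     (\<forall>c\<in>\<A>. \<forall>d\<in>\<B>. \<forall>x \<in> local_dom c d f.
        inj (frechet_derivative (local_rep c d f) (at x)) \<and>
        (\<forall>v w. ip (g c) x v w =
           ip (h d) (local_rep c d f x) (frechet_derivative (local_rep c d f) (at x) v)
                                        (frechet_derivative (local_rep c d f) (at x) w)))"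

definition nondegenerate_hypersurface ::
  "('m::{t2_space, second_countable_topology}, 4) chart set
     \<Rightarrow> (('m, 4) chart \<Rightarrow> 4 metric_field) \<Rightarrow> nat
     \<Rightarrow> ('k::{t2_space, second_countable_topology}, 5) chart set
     \<Rightarrow> (('k, 5) chart \<Rightarrow> 5 metric_field) \<Rightarrow> ('m \<Rightarrow> 'k) \<Rightarrow> bool" where
  "nondegenerate_hypersurface \<A> g r \<B> h f \<longleftrightarrow>
     smooth_atlas \<A> \<and> pseudo_riemannian_metric \<A> g r \<and> isometric_immersion \<A> g \<B> h f"

text \<open>
  Below, \<open>G\<close> is the metric of the ambient space in a chart, \<open>F\<close> the coordinate expression of the
  immersion, and vector fields along the immersion are given by ambient coordinate components.
\<close>

definition unit_normal ::
  "5 metric_field \<Rightarrow> (real^4 \<Rightarrow> real^5) \<Rightarrow> (real^4) set \<Rightarrow> (real^4 \<Rightarrow> real^5) \<Rightarrow> bool" where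
  "unit_normal G F U \<xi> \<longleftrightarrow> smooth_on U \<xi> \<and>
     (\<forall>x\<in>U. ip G (F x) (\<xi> x) (\<xi> x) \<in> {1, -1} \<and>
        (\<forall>v. ip G (F x) (frechet_derivative F (at x) v) (\<xi> x) = 0))"

text \<open>
  A unit normal field need not exist globally, so the notions below are tested on all smooth unit
  normal fields over open sets lying in one chart pair. The choice only affects signs:
  the mean curvature vector does not depend on it.
\<close>

definition local_unit_normal ::
  "('m, 4) chart set \<Rightarrow> ('k, 5) chart set \<Rightarrow> (('k, 5) chart \<Rightarrow> 5 metric_field) \<Rightarrow> ('m \<Rightarrow> 'k)
     \<Rightarrow> ('m, 4) chart \<Rightarrow> ('k, 5) chart \<Rightarrow> (real^4) set \<Rightarrow> (real^4 \<Rightarrow> real^5) \<Rightarrow> bool" where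
  "local_unit_normal \<A> \<B> h f c d U \<xi> \<longleftrightarrow> c \<in> \<A> \<and> d \<in> \<B> \<and> open U \<and> U \<subseteq> local_dom c d f \<and>
     unit_normal (h d) (local_rep c d f) U \<xi>"

definition shape_operator ::
  "5 metric_field \<Rightarrow> (real^4 \<Rightarrow> real^5) \<Rightarrow> (real^4 \<Rightarrow> real^5) \<Rightarrow> real^4 \<Rightarrow> real^4^4" where
  "shape_operator G F \<xi> x =
     (THE A. \<forall>v. cov_along G F (\<lambda>_. v) \<xi> x = - frechet_derivative F (at x) (A *v v))"

definition principal_curvatures ::
  "5 metric_field \<Rightarrow> (real^4 \<Rightarrow> real^5) \<Rightarrow> (real^4 \<Rightarrow> real^5) \<Rightarrow> real^4 \<Rightarrow> complex set" where
  "principal_curvatures G F \<xi> x =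
     {\<mu>. \<exists>v. v \<noteq> 0 \<and> map_matrix complex_of_real (shape_operator G F \<xi> x) *v v = \<mu> *s v}"

definition mean_curvature ::
  "5 metric_field \<Rightarrow> (real^4 \<Rightarrow> real^5) \<Rightarrow> (real^4 \<Rightarrow> real^5) \<Rightarrow> real^4 \<Rightarrow> real" where
  "mean_curvature G F \<xi> x =
     1/4 * ip G (F x) (\<xi> x) (\<xi> x) * trace (shape_operator G F \<xi> x)"

definition mean_curvature_vector ::
  "5 metric_field \<Rightarrow> (real^4 \<Rightarrow> real^5) \<Rightarrow> (real^4 \<Rightarrow> real^5) \<Rightarrow> real^4 \<Rightarrow> real^5" where
  "mean_curvature_vector G F \<xi> x = mean_curvature G F \<xi> x *\<^sub>R \<xi> x"

definition orthonormal_frame ::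
  "4 metric_field \<Rightarrow> (real^4) set \<Rightarrow> (4 \<Rightarrow> real^4 \<Rightarrow> real^4) \<Rightarrow> bool" where
  "orthonormal_frame G U e \<longleftrightarrow> (\<forall>i. smooth_on U (e i)) \<and>
     (\<forall>x\<in>U. \<forall>i j. if i = j then ip G x (e i x) (e j x) \<in> {1, -1} else ip G x (e i x) (e j x) = 0)"

definition frame_laplacian ::
  "4 metric_field \<Rightarrow> 5 metric_field \<Rightarrow> (real^4 \<Rightarrow> real^5) \<Rightarrow> (4 \<Rightarrow> real^4 \<Rightarrow> real^4)
     \<Rightarrow> (real^4 \<Rightarrow> real^5) \<Rightarrow> real^4 \<Rightarrow> real^5" where
  "frame_laplacian g G F e V x =
     - (\<Sum>i\<in>UNIV. ip g x (e i x) (e i x) *\<^sub>R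
          (cov_along G F (e i) (cov_along G F (e i) V) x
           - cov_along G F (levi_civita g (e i) (e i)) V x))"

text \<open>
  The value of the Laplacian does not depend on the local orthonormal frame,
  and such a frame exists around every point.
\<close>

definition has_laplacian ::
  "4 metric_field \<Rightarrow> 5 metric_field \<Rightarrow> (real^4 \<Rightarrow> real^5) \<Rightarrow> (real^4 \<Rightarrow> real^5) \<Rightarrow> real^4
     \<Rightarrow> real^5 \<Rightarrow> bool" where
  "has_laplacian g G F V x L \<longleftrightarrow>
     (\<exists>U e. open U \<and> x \<in> U \<and> orthonormal_frame g U e \<and> frame_laplacian g G F e V x = L)"

definition biharmonic_hypersurface ::
  "('m, 4) chart set \<Rightarrow> (('m, 4) chart \<Rightarrow> 4 metric_field)
     \<Rightarrow> ('k, 5) chart set \<Rightarrow> (('k, 5) chart \<Rightarrow> 5 metric_field) \<Rightarrow> real \<Rightarrow> ('m \<Rightarrow> 'k) \<Rightarrow> bool" where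
  "biharmonic_hypersurface \<A> g \<B> h \<kappa> f \<longleftrightarrow>
     (\<forall>c d U \<xi>. local_unit_normal \<A> \<B> h f c d U \<xi> \<longrightarrow>
        (\<forall>x\<in>U. has_laplacian (g c) (h d) (local_rep c d f)
                  (mean_curvature_vector (h d) (local_rep c d f) \<xi>) x
                  ((4 * \<kappa>) *\<^sub>R mean_curvature_vector (h d) (local_rep c d f) \<xi> x)))"

definition minimal_hypersurface ::
  "('m, 4) chart set \<Rightarrow> ('k, 5) chart set \<Rightarrow> (('k, 5) chart \<Rightarrow> 5 metric_field)
     \<Rightarrow> ('m \<Rightarrow> 'k) \<Rightarrow> bool" where
  "minimal_hypersurface \<A> \<B> h f \<longleftrightarrow>
     (\<forall>c d U \<xi>. local_unit_normal \<A> \<B> h f c d U \<xi> \<longrightarrow>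
        (\<forall>x\<in>U. mean_curvature (h d) (local_rep c d f) \<xi> x = 0))"

end

theory Submission
  imports Defs "HOL-Computational_Algebra.Fundamental_Theorem_Algebra"
begin

text \<open>
  Let \<open>\<rho> = a + ib\<close> and its conjugate be the two principal curvatures. In dimension four each of them is
  a double eigenvalue of the shape operator \<open>A\<close>, so \<open>tr A = 4a\<close> and \<open>tr A\<^sup>2 = 4(a\<^sup>2 - b\<^sup>2)\<close>.

  The biharmonic equation splits into a tangential and a normal part. By the Codazzi equation the
  tangential part says that \<open>A (\<nabla>H) = - 2 \<epsilon> H \<nabla>H\<close> (\<open>gradient_zero\<close>). As \<open>A\<close> has no real eigenvalue,
  \<open>\<nabla>H = 0\<close>. The normal part then reduces to \<open>H (\<epsilon> tr A\<^sup>2 - 4\<kappa>) = 0\<close> (\<open>normal_part\<close>). Suppose \<open>H \<noteq> 0\<close> at some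
  point. Around it \<open>a\<close> and \<open>b\<close> are constant and \<open>\<epsilon> (a\<^sup>2 - b\<^sup>2) = \<kappa>\<close>. The contradiction comes from the
  identity of Cartan's type \<open>\<kappa> + \<epsilon> (a\<^sup>2 + b\<^sup>2) = 0\<close> for two constant principal curvatures
  (\<open>constant_double_eigenvalues\<close>): together they give \<open>a = 0\<close>, that is \<open>H = 0\<close>.

  The identity follows from the Gauss equation once it is known that, for eigenvectors \<open>u1\<close> of \<open>\<rho>\<close> and
  \<open>v1\<close> of its conjugate, a suitable component of the commutator of \<open>R(u1, v1)\<close> with \<open>A\<close> vanishes
  (\<open>product_of_eigenvalues\<close>). There are two cases.

  If \<open>A\<close> is diagonalizable over the complex numbers on an open set, then \<open>(A - a)\<^sup>2 = - b\<^sup>2\<close> there, and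
  \<open>\<nabla>A\<close> anticommutes with \<open>A - a\<close>. A totally symmetric tensor with this property is zero
  (\<open>anticommuting_codazzi_zero\<close>). So \<open>A\<close> is parallel and commutes with the whole curvature.

  If \<open>A\<close> is not diagonalizable at some point, it has there one Jordan block of size two for each
  eigenvalue, with bases \<open>u1, u2\<close> and \<open>v1, v2\<close> (\<open>selfadjoint_normal_form\<close>). Constancy of \<open>tr A, \<dots>, tr A\<^sup>4\<close>
  makes several components of \<open>\<nabla>A\<close> vanish (\<open>trace_free_coefficients\<close>). With the Codazzi symmetry,
  \<open>\<nabla>\<^bsub>u1\<^esub> A\<close> has a single component left and commutes with \<open>A\<close>. Therefore the quadratic terms drop out
  when the traces are differentiated once more, and the same components of \<open>\<nabla>\<^sup>2\<^bsub>u1,y\<^esub> A\<close> vanish. By the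
  Codazzi symmetry again, the relevant component of the antisymmetric part of \<open>\<nabla>\<^sup>2 A\<close> in the directions
  \<open>u1, v1\<close> is zero (\<open>QQ_commutator\<close>), and by the Ricci identity that part is the commutator.

  All of the geometry takes place in one pair of charts, where a connection is a family of matrices:
  the ambient Levi-Civita connection is pulled back along the immersion, and its splitting into
  tangential and normal parts yields the induced connection, the shape operator and the equations of
  Gauss, Weingarten and Codazzi.
\<close>

section \<open>Calculus of smooth functions\<close>

definition pd :: "'n \<Rightarrow> (real^'n \<Rightarrow> 'b::real_normed_vector) \<Rightarrow> real^'n \<Rightarrow> 'b" where
  "pd i f x = frechet_derivative f (at x) (axis i 1)"

lemma Ck_on_Suc_pd:
  "Ck_on (Suc k) S f \<longleftrightarrow> (\<forall>x\<in>S. f differentiable (at x)) \<and> (\<forall>i. Ck_on k S (pd i f))"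
  by (simp add: pd_def[abs_def])

lemma pd_eqI: "(f has_derivative f') (at x) \<Longrightarrow> pd i f x = f' (axis i 1)"
  unfolding pd_def by (metis frechet_derivative_at)

lemma pd_cong:
  assumes "open S" "x \<in> S" "\<And>y. y \<in> S \<Longrightarrow> f y = g y"
  shows "pd i f x = pd i g x"
proof -
  have "(f has_derivative f') (at x) \<longleftrightarrow> (g has_derivative f') (at x)" for f'
    using assms has_derivative_transform_within_open[of f f' x UNIV S g]
      has_derivative_transform_within_open[of g f' x UNIV S f] by auto
  then show ?thesis unfolding pd_def frechet_derivative_def by simp
qed

lemma differentiable_cong_open:
  assumes "open S" "x \<in> S" "\<And>y. y \<in> S \<Longrightarrow> f y = g y"
  shows "f differentiable (at x) \<longleftrightarrow> g differentiable (at x)"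
proof -
  have "(f has_derivative f') (at x) \<longleftrightarrow> (g has_derivative f') (at x)" for f'
    using assms has_derivative_transform_within_open[of f f' x UNIV S g]
      has_derivative_transform_within_open[of g f' x UNIV S f] by auto
  then show ?thesis unfolding differentiable_def by simp
qed

text \<open>
  \<open>Ck_on\<close> speaks about derivatives as functions on the whole space, whereas the rules of
  differentiation hold on \<open>S\<close> only. Openness of \<open>S\<close> bridges the two.
\<close>

lemma Ck_on_cong:
  assumes "open S" "\<And>y. y \<in> S \<Longrightarrow> f y = g y"
  shows "Ck_on k S f \<longleftrightarrow> Ck_on k S g"
  using assms(2)
proof (induction k arbitrary: f g)
  case 0
  then show ?case by (simp cong: continuous_on_cong_simp)
next
  case (Suc k)
  have "Ck_on k S (pd i f) = Ck_on k S (pd i g)" for i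
    by (rule Suc.IH) (use assms(1) Suc.prems in \<open>auto intro!: pd_cong\<close>)
  moreover have "f differentiable (at x) \<longleftrightarrow> g differentiable (at x)" if "x \<in> S" for x
    by (rule differentiable_cong_open) (use assms(1) that Suc.prems in auto)
  ultimately show ?case by (simp only: Ck_on_Suc_pd) auto
qed

lemma Ck_on_SucD: "Ck_on (Suc k) S f \<Longrightarrow> Ck_on k S f"
proof (induction k arbitrary: f)
  case 0
  then show ?case
    by (auto simp: continuous_on_eq_continuous_at differentiable_imp_continuous_within
        intro!: continuous_at_imp_continuous_on)
next
  case (Suc k)
  then show ?case unfolding Ck_on_Suc_pd by blast
qed

lemma Ck_on_subset: "Ck_on k S f \<Longrightarrow> T \<subseteq> S \<Longrightarrow> Ck_on k T f"
  by (induction k arbitrary: f) (auto intro: continuous_on_subset)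

lemma Ck_on_const: "Ck_on k S (\<lambda>_. c)"
  by (induction k arbitrary: c) auto

lemma pd_linear:
  assumes "bounded_linear h" "f differentiable (at x)"
  shows "pd i (\<lambda>x. h (f x)) x = h (pd i f x)"
proof -
  have "(f has_derivative frechet_derivative f (at x)) (at x)"
    using assms(2) frechet_derivative_works by blast
  from bounded_linear.has_derivative[OF assms(1) this] show ?thesis
    unfolding pd_def[of i f] by (rule pd_eqI)
qed

lemma Ck_on_linear:
  assumes "bounded_linear h" "open S" "Ck_on k S f"
  shows "Ck_on k S (\<lambda>x. h (f x))"
  using assms(3)
proof (induction k arbitrary: f)
  case 0
  then show ?case by (simp add: bounded_linear.continuous_on[OF assms(1)])
next
  case (Suc k)
  then have d: "f differentiable (at x)" if "x \<in> S" for x using that by simp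
  have "Ck_on k S (pd i (\<lambda>x. h (f x)))" for i
  proof -
    have "Ck_on k S (\<lambda>x. h (pd i f x))" using Suc unfolding Ck_on_Suc_pd by blast
    then show ?thesis using Ck_on_cong[OF assms(2), of "pd i (\<lambda>x. h (f x))" "\<lambda>x. h (pd i f x)"]
      by (simp add: pd_linear[OF assms(1) d])
  qed
  moreover have "(\<lambda>x. h (f x)) differentiable (at x)" if "x \<in> S" for x
    using d[OF that] bounded_linear.has_derivative[OF assms(1)] unfolding differentiable_def by blast
  ultimately show ?case by (simp only: Ck_on_Suc_pd) blast
qed

lemma pd_add:
  "f differentiable (at x) \<Longrightarrow> g differentiable (at x) \<Longrightarrow> pd i (\<lambda>x. f x + g x) x = pd i f x + pd i g x"
  unfolding pd_def[of i f] pd_def[of i g]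
  by (rule pd_eqI, rule derivative_intros) (simp_all add: frechet_derivative_works)

lemma Ck_on_add:
  assumes "open S" "Ck_on k S f" "Ck_on k S g"
  shows "Ck_on k S (\<lambda>x. f x + g x)"
  using assms(2,3)
proof (induction k arbitrary: f g)
  case 0
  then show ?case by (auto intro: continuous_intros)
next
  case (Suc k)
  then have d: "f differentiable (at x)" "g differentiable (at x)" if "x \<in> S" for x
    using that by simp_all
  have "Ck_on k S (pd i (\<lambda>x. f x + g x))" for i
  proof -
    have "Ck_on k S (\<lambda>x. pd i f x + pd i g x)" using Suc unfolding Ck_on_Suc_pd by blast
    then show ?thesis
      using Ck_on_cong[OF assms(1), of "pd i (\<lambda>x. f x + g x)" "\<lambda>x. pd i f x + pd i g x"]
      by (simp add: pd_add[OF d])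
  qed
  then show ?case using d by (simp only: Ck_on_Suc_pd) (blast intro: differentiable_add)
qed

lemma pd_bilinear:
  assumes "bounded_bilinear h" "f differentiable (at x)" "g differentiable (at x)"
  shows "pd i (\<lambda>x. h (f x) (g x)) x = h (pd i f x) (g x) + h (f x) (pd i g x)"
proof -
  have "(f has_derivative frechet_derivative f (at x)) (at x)"
    "(g has_derivative frechet_derivative g (at x)) (at x)"
    using assms frechet_derivative_works by blast+
  from bounded_bilinear.FDERIV[OF assms(1) this] show ?thesis
    unfolding pd_def[of i f] pd_def[of i g] by (subst pd_eqI) (auto simp: add.commute)
qed

lemma differentiable_bilinear:
  assumes "bounded_bilinear h" "f differentiable (at x)" "g differentiable (at x)"
  shows "(\<lambda>x. h (f x) (g x)) differentiable (at x)"
  using assms bounded_bilinear.FDERIV[OF assms(1)] unfolding differentiable_def by blast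

lemma Ck_on_bilinear:
  assumes h: "bounded_bilinear h" and S: "open S" and "Ck_on k S f" "Ck_on k S g"
  shows "Ck_on k S (\<lambda>x. h (f x) (g x))"
  using assms(3,4)
proof (induction k arbitrary: f g)
  case 0
  then show ?case by (simp add: bounded_bilinear.continuous_on[OF h])
next
  case (Suc k)
  then have d: "f differentiable (at x)" "g differentiable (at x)" if "x \<in> S" for x
    using that by simp_all
  have "Ck_on k S (pd i (\<lambda>x. h (f x) (g x)))" for i
  proof -
    have "Ck_on k S f" "Ck_on k S g" using Suc.prems by (blast intro: Ck_on_SucD)+
    moreover have "Ck_on k S (pd i f)" "Ck_on k S (pd i g)"
      using Suc.prems unfolding Ck_on_Suc_pd by blast+
    ultimately    have "Ck_on k S (\<lambda>x. h (pd i f x) (g x) + h (f x) (pd i g x))"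
      by (intro Ck_on_add S Suc.IH)
    then show ?thesis
      using Ck_on_cong[OF S, of "pd i (\<lambda>x. h (f x) (g x))"
          "\<lambda>x. h (pd i f x) (g x) + h (f x) (pd i g x)"]
      by (simp add: pd_bilinear[OF h d])
  qed
  then show ?case using d by (simp only: Ck_on_Suc_pd) (blast intro: differentiable_bilinear[OF h])
qed

lemma Ck_on_sum:
  assumes "open S" "\<And>i. i \<in> I \<Longrightarrow> Ck_on k S (f i)"
  shows "Ck_on k S (\<lambda>x. \<Sum>i\<in>I. f i x)"
  using assms(2) by (induction I rule: infinite_finite_induct) (auto intro: Ck_on_add Ck_on_const assms(1))

lemma Ck_on_prod:
  fixes f :: "'a \<Rightarrow> real^'n \<Rightarrow> real"
  assumes "open S" "\<And>i. i \<in> I \<Longrightarrow> Ck_on k S (f i)"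
  shows "Ck_on k S (\<lambda>x. \<Prod>i\<in>I. f i x)"
  using assms(2)
  by (induction I rule: infinite_finite_induct)
    (auto intro: Ck_on_bilinear[OF bounded_bilinear_mult] Ck_on_const assms(1))

lemma axis_expansion: "(v::real^'n) = (\<Sum>a\<in>UNIV. v $ a *\<^sub>R axis a 1)"
  by (simp add: vec_eq_iff axis_def if_distrib cong: if_cong)

lemma frechet_derivative_pd:
  assumes "f differentiable (at x)"
  shows "frechet_derivative f (at x) v = (\<Sum>a\<in>UNIV. v $ a *\<^sub>R pd a f x)"
proof -
  interpret linear "frechet_derivative f (at x)" using assms by (rule linear_frechet_derivative)
  show ?thesis by (subst axis_expansion[of v]) (simp add: sum scale pd_def)
qed

lemma pd_compose:
  assumes "g differentiable (at (f x))" "f differentiable (at x)"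
  shows "pd i (\<lambda>x. g (f x)) x = (\<Sum>a\<in>UNIV. pd i f x $ a *\<^sub>R pd a g (f x))"
  using frechet_derivative_compose[OF assms(2,1)]
    frechet_derivative_pd[OF assms(1), of "pd i f x"]
  by (simp add: pd_def[of i] o_def)

text \<open>
  By the chain rule a partial derivative of the composition is a sum of products of partial
  derivatives of \<open>f\<close> with compositions of the same kind, but of one order less.
\<close>

lemma Ck_on_compose:
  assumes S: "open S" and "Ck_on k S f" "Ck_on k T g" "f ` S \<subseteq> T"
  shows "Ck_on k S (\<lambda>x. g (f x))"
  using assms(2-4)
proof (induction k arbitrary: g)
  case 0
  then show ?case by (auto intro: continuous_on_compose2)
next
  case (Suc k)
  then have d: "f differentiable (at x)" "g differentiable (at (f x))" if "x \<in> S" for x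
    using that by auto
  have "Ck_on k S (pd i (\<lambda>x. g (f x)))" for i
  proof -
    have "Ck_on k S f" using Suc.prems(1) by (rule Ck_on_SucD)
    then have "Ck_on k S (\<lambda>x. pd a g (f x))" for a
      using Suc unfolding Ck_on_Suc_pd by blast
    moreover have "Ck_on k S (\<lambda>x. pd i f x $ a)" for a
      using Suc.prems unfolding Ck_on_Suc_pd
      by (intro Ck_on_linear[OF bounded_linear_vec_nth S]) blast
    ultimately have "Ck_on k S (\<lambda>x. \<Sum>a\<in>UNIV. pd i f x $ a *\<^sub>R pd a g (f x))"
      by (intro Ck_on_sum S Ck_on_bilinear[OF bounded_bilinear_scaleR])
    then show ?thesis
      using Ck_on_cong[OF S, of "pd i (\<lambda>x. g (f x))"
          "\<lambda>x. \<Sum>a\<in>UNIV. pd i f x $ a *\<^sub>R pd a g (f x)"]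
      by (simp add: pd_compose d)
  qed
  moreover have "(\<lambda>x. g (f x)) differentiable (at x)" if "x \<in> S" for x
    using differentiable_chain_at[OF d(1)[OF that] d(2)[OF that]] by (simp add: o_def)
  ultimately show ?case by (simp only: Ck_on_Suc_pd) blast
qed

lemma pd_inverse:
  fixes f :: "real^'n \<Rightarrow> real"
  assumes "f differentiable (at x)" "f x \<noteq> 0"
  shows "pd i (\<lambda>x. inverse (f x)) x = - (inverse (f x) * pd i f x * inverse (f x))"
  unfolding pd_def[of i f]
  by (rule pd_eqI[where f' = "\<lambda>h. - (inverse (f x) * frechet_derivative f (at x) h * inverse (f x))"],
      rule Deriv.has_derivative_inverse) (use assms in \<open>auto simp: frechet_derivative_works\<close>)

lemma Ck_on_inverse:
  fixes f :: "real^'n \<Rightarrow> real"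
  assumes S: "open S" and "Ck_on k S f" and nz: "\<And>x. x \<in> S \<Longrightarrow> f x \<noteq> 0"
  shows "Ck_on k S (\<lambda>x. inverse (f x))"
  using assms(2)
proof (induction k)
  case 0
  then show ?case using nz by (auto intro!: continuous_intros)
next
  case (Suc k)
  then have d: "f differentiable (at x)" if "x \<in> S" for x using that by auto
  have "Ck_on k S (pd i (\<lambda>x. inverse (f x)))" for i
  proof -
    have "Ck_on k S (\<lambda>x. inverse (f x))" "Ck_on k S (pd i f)"
      using Suc.IH Suc.prems Ck_on_SucD unfolding Ck_on_Suc_pd by blast+
    then have "Ck_on k S (\<lambda>x. - (inverse (f x) * pd i f x * inverse (f x)))"
      by (intro Ck_on_linear[OF bounded_linear_minus[OF bounded_linear_ident]] S
          Ck_on_bilinear[OF bounded_bilinear_mult])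
    then show ?thesis
      using Ck_on_cong[OF S, of "pd i (\<lambda>x. inverse (f x))"
          "\<lambda>x. - (inverse (f x) * pd i f x * inverse (f x))"]
      by (simp add: pd_inverse d nz)
  qed
  moreover have "(\<lambda>x. inverse (f x)) differentiable (at x)" if "x \<in> S" for x
    using d nz that by (intro differentiable_inverse) auto
  ultimately show ?case by (simp only: Ck_on_Suc_pd) blast
qed

lemma Ck_on_vec:
  fixes f :: "real^'n \<Rightarrow> 'b::euclidean_space^'m"
  assumes S: "open S" and "\<And>j. Ck_on k S (\<lambda>x. f x $ j)"
  shows "Ck_on k S f"
proof -
  have bl: "bounded_linear (axis j :: 'b \<Rightarrow> 'b^'m)" for j
    by (intro linear_conv_bounded_linear[THEN iffD1] linearI) (auto simp: vec_eq_iff axis_def)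
  have "f x = (\<Sum>j\<in>UNIV. axis j (f x $ j))" for x
    by (simp add: vec_eq_iff axis_def if_distrib cong: if_cong)
  moreover have "Ck_on k S (\<lambda>x. \<Sum>j\<in>UNIV. axis j (f x $ j))"
    by (intro Ck_on_sum S Ck_on_linear[OF bl S assms(2)])
  ultimately show ?thesis by presburger
qed

lemma smooth_on_pd: "smooth_on S f \<Longrightarrow> smooth_on S (pd i f)"
  unfolding smooth_on_def using Ck_on_Suc_pd by blast

lemma smooth_on_differentiable: "smooth_on S f \<Longrightarrow> x \<in> S \<Longrightarrow> f differentiable (at x)"
  unfolding smooth_on_def using Ck_on_Suc_pd[of 0 S f] by blast

lemma smooth_on_continuous: "smooth_on S f \<Longrightarrow> continuous_on S f"
  unfolding smooth_on_def using Ck_on.simps(1) by blast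

lemma smooth_on_subset: "smooth_on S f \<Longrightarrow> T \<subseteq> S \<Longrightarrow> smooth_on T f"
  unfolding smooth_on_def using Ck_on_subset by blast

lemma smooth_on_cong:
  "open S \<Longrightarrow> (\<And>y. y \<in> S \<Longrightarrow> f y = g y) \<Longrightarrow> smooth_on S f \<longleftrightarrow> smooth_on S g"
  unfolding smooth_on_def using Ck_on_cong by metis

lemma smooth_on_const: "smooth_on S (\<lambda>_. c)"
  by (simp add: smooth_on_def Ck_on_const)

lemma smooth_on_linear: "bounded_linear h \<Longrightarrow> open S \<Longrightarrow> smooth_on S f \<Longrightarrow> smooth_on S (\<lambda>x. h (f x))"
  by (simp add: smooth_on_def Ck_on_linear)

lemma smooth_on_bilinear:
  "bounded_bilinear h \<Longrightarrow> open S \<Longrightarrow> smooth_on S f \<Longrightarrow> smooth_on S g \<Longrightarrow> smooth_on S (\<lambda>x. h (f x) (g x))"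
  by (simp add: smooth_on_def Ck_on_bilinear)

lemma smooth_on_add:
  "open S \<Longrightarrow> smooth_on S f \<Longrightarrow> smooth_on S g \<Longrightarrow> smooth_on S (\<lambda>x. f x + g x)"
  by (simp add: smooth_on_def Ck_on_add)

lemma smooth_on_uminus: "open S \<Longrightarrow> smooth_on S f \<Longrightarrow> smooth_on S (\<lambda>x. - f x)"
  by (rule smooth_on_linear[OF bounded_linear_minus[OF bounded_linear_ident]])

lemma smooth_on_diff:
  "open S \<Longrightarrow> smooth_on S f \<Longrightarrow> smooth_on S g \<Longrightarrow> smooth_on S (\<lambda>x. f x - g x)"
  using smooth_on_add[of S f "\<lambda>x. - g x"] smooth_on_uminus[of S g] by simp

lemma smooth_on_sum:
  "open S \<Longrightarrow> (\<And>i. i \<in> I \<Longrightarrow> smooth_on S (f i)) \<Longrightarrow> smooth_on S (\<lambda>x. \<Sum>i\<in>I. f i x)"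
  by (simp add: smooth_on_def Ck_on_sum)

lemma smooth_on_prod:
  fixes f :: "'a \<Rightarrow> real^'n \<Rightarrow> real"
  shows "open S \<Longrightarrow> (\<And>i. i \<in> I \<Longrightarrow> smooth_on S (f i)) \<Longrightarrow> smooth_on S (\<lambda>x. \<Prod>i\<in>I. f i x)"
  by (simp add: smooth_on_def Ck_on_prod)

lemma smooth_on_inverse:
  fixes f :: "real^'n \<Rightarrow> real"
  shows "open S \<Longrightarrow> smooth_on S f \<Longrightarrow> (\<And>x. x \<in> S \<Longrightarrow> f x \<noteq> 0) \<Longrightarrow> smooth_on S (\<lambda>x. inverse (f x))"
  by (simp add: smooth_on_def Ck_on_inverse)

lemma smooth_on_compose:
  "open S \<Longrightarrow> smooth_on S f \<Longrightarrow> smooth_on T g \<Longrightarrow> f ` S \<subseteq> T \<Longrightarrow> smooth_on S (\<lambda>x. g (f x))"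
  unfolding smooth_on_def using Ck_on_compose by blast

lemma smooth_on_vec:
  fixes f :: "real^'n \<Rightarrow> 'b::euclidean_space^'m"
  shows "open S \<Longrightarrow> (\<And>j. smooth_on S (\<lambda>x. f x $ j)) \<Longrightarrow> smooth_on S f"
  by (simp add: smooth_on_def Ck_on_vec)

lemma bounded_bilinear_matrix_vector: "bounded_bilinear (\<lambda>(A::real^'n^'m) x. A *v x)"
  by (intro bilinear_conv_bounded_bilinear[THEN iffD1])
    (auto simp: bilinear_def matrix_vector_mult_add_rdistrib scaleR_matrix_vector_assoc
      intro!: linearI matrix_vector_mul_linear)

lemma bounded_bilinear_matrix_matrix: "bounded_bilinear (\<lambda>(A::real^'n^'m) (B::real^'k^'n). A ** B)"
  by (intro bilinear_conv_bounded_bilinear[THEN iffD1])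
    (auto simp: bilinear_def vec_eq_iff matrix_matrix_mult_def sum_distrib_left
      algebra_simps sum.distrib intro!: linearI)

lemma bounded_linear_transpose: "bounded_linear (transpose :: real^'n^'m \<Rightarrow> _)"
  by (intro linear_conv_bounded_linear[THEN iffD1] linearI) (auto simp: vec_eq_iff transpose_def)

lemma bounded_linear_trace: "bounded_linear (trace :: real^'n^'n \<Rightarrow> _)"
  by (intro linear_conv_bounded_linear[THEN iffD1] linearI)
    (auto simp: trace_def sum.distrib sum_distrib_left)

lemma smooth_on_nth:
  fixes f :: "real^'n \<Rightarrow> 'b::euclidean_space^'m"
  shows "open S \<Longrightarrow> smooth_on S f \<Longrightarrow> smooth_on S (\<lambda>x. f x $ j)"
  by (rule smooth_on_linear[OF bounded_linear_vec_nth])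

lemmas smooth_on_scaleR = smooth_on_bilinear[OF bounded_bilinear_scaleR]
  and smooth_on_mult = smooth_on_bilinear[OF bounded_bilinear_mult[where 'a = real]]
  and smooth_on_inner = smooth_on_bilinear[OF bounded_bilinear_inner]
  and smooth_on_matvec = smooth_on_bilinear[OF bounded_bilinear_matrix_vector]
  and smooth_on_matmul = smooth_on_bilinear[OF bounded_bilinear_matrix_matrix]
  and smooth_on_transpose = smooth_on_linear[OF bounded_linear_transpose]
  and smooth_on_trace = smooth_on_linear[OF bounded_linear_trace]

lemma smooth_on_det:
  fixes M :: "real^'n \<Rightarrow> real^'m^'m"
  assumes "open S" "smooth_on S M"
  shows "smooth_on S (\<lambda>x. det (M x))"
  unfolding det_def
  by (intro smooth_on_sum smooth_on_mult smooth_on_prod smooth_on_const assms smooth_on_nth)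

lemma matrix_inv_left: "invertible A \<Longrightarrow> matrix_inv A ** A = mat 1"
  and matrix_inv_right: "invertible A \<Longrightarrow> A ** matrix_inv A = mat 1"
  for A :: "real^'n^'n"
  using someI_ex[of "\<lambda>A'. A ** A' = mat 1 \<and> A' ** A = mat 1"]
  unfolding invertible_def matrix_inv_def by auto

text \<open>Cramer's rule exhibits the entries of the inverse as rational functions of the entries.\<close>

lemma matrix_inv_entry:
  fixes A :: "real^'n^'n"
  assumes "invertible A"
  shows "matrix_inv A $ i $ j = det (\<chi> r c. if c = i then axis j 1 $ r else A $ r $ c) * inverse (det A)"
proof -
  have "A *v (matrix_inv A *v axis j 1) = axis j 1"
    by (simp add: matrix_vector_mul_assoc matrix_inv_right[OF assms])
  then have "matrix_inv A *v axis j 1 =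
      (\<chi> k. det (\<chi> r c. if c = k then axis j 1 $ r else A $ r $ c) / det A)"
    using cramer[of A "matrix_inv A *v axis j 1" "axis j 1"] assms invertible_det_nz by auto
  moreover have "matrix_inv A $ i $ j = (matrix_inv A *v axis j 1) $ i"
    by (simp add: matrix_vector_mult_basis column_def)
  ultimately show ?thesis by (simp add: divide_inverse)
qed

lemma smooth_on_matrix_inv:
  fixes M :: "real^'n \<Rightarrow> real^'m^'m"
  assumes S: "open S" and M: "smooth_on S M" and inv: "\<And>x. x \<in> S \<Longrightarrow> invertible (M x)"
  shows "smooth_on S (\<lambda>x. matrix_inv (M x))"
proof (intro smooth_on_vec S)
  fix i j
  have ent: "smooth_on S (\<lambda>x. if c = i then axis j 1 $ r else M x $ r $ c)" for r c
    by (cases "c = i") (auto intro!: smooth_on_const smooth_on_nth S M)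
  have "smooth_on S (\<lambda>x. det (\<chi> r c. if c = i then axis j 1 $ r else M x $ r $ c) * inverse (det (M x)))"
    by (intro smooth_on_mult S smooth_on_inverse smooth_on_det M smooth_on_vec)
      (use ent inv invertible_det_nz in auto)
  then show "smooth_on S (\<lambda>x. matrix_inv (M x) $ i $ j)"
    using smooth_on_cong[OF S, of "\<lambda>x. matrix_inv (M x) $ i $ j"] inv
    by (simp add: matrix_inv_entry)
qed

lemmas smooth_intros = smooth_on_const smooth_on_add smooth_on_uminus smooth_on_diff smooth_on_sum
  smooth_on_scaleR smooth_on_mult smooth_on_inner smooth_on_matvec smooth_on_matmul
  smooth_on_transpose smooth_on_trace smooth_on_nth smooth_on_pd

subsection \<open>Symmetry of second derivatives\<close>

lemma has_real_derivative_along_axis: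
  fixes f :: "real^'n \<Rightarrow> real"
  assumes "f differentiable (at (y + s *\<^sub>R axis i 1))"
  shows "((\<lambda>s. f (y + s *\<^sub>R axis i 1)) has_real_derivative pd i f (y + s *\<^sub>R axis i 1)) (at s)"
proof -
  let ?z = "y + s *\<^sub>R axis i 1"
  have f: "(f has_derivative frechet_derivative f (at ?z)) (at ?z)"
    using assms frechet_derivative_works by blast
  have "((\<lambda>s. y + s *\<^sub>R axis i 1) has_derivative (\<lambda>h. h *\<^sub>R axis i 1)) (at s)"
    by (auto intro!: derivative_eq_intros)
  from has_derivative_compose[OF this f]
  have "((\<lambda>s. f (y + s *\<^sub>R axis i 1)) has_derivative
      (\<lambda>h. frechet_derivative f (at ?z) (h *\<^sub>R axis i 1))) (at s)" .
  moreover have "frechet_derivative f (at ?z) (h *\<^sub>R axis i 1) = pd i f ?z * h" for h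
    using linear_frechet_derivative[OF assms] by (simp add: linear_scale pd_def)
  ultimately show ?thesis by (simp add: has_field_derivative_def)
qed

text \<open>
  The mixed second difference of \<open>f\<close> does not change when the two directions are exchanged, and
  by two applications of the mean value theorem it is \<open>t\<^sup>2\<close> times a value of either mixed derivative.
\<close>

lemma second_difference_mean_value:
  fixes f :: "real^'n \<Rightarrow> real"
  assumes t: "0 < t"
    and S: "\<And>s u. 0 \<le> s \<Longrightarrow> s \<le> t \<Longrightarrow> 0 \<le> u \<Longrightarrow> u \<le> t \<Longrightarrow> x + s *\<^sub>R axis i 1 + u *\<^sub>R axis j 1 \<in> S"
    and f: "\<And>y. y \<in> S \<Longrightarrow> f differentiable (at y)" "\<And>y. y \<in> S \<Longrightarrow> pd i f differentiable (at y)"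
  obtains s u where "0 < s" "s < t" "0 < u" "u < t"
    "f (x + t *\<^sub>R axis i 1 + t *\<^sub>R axis j 1) - f (x + t *\<^sub>R axis i 1) - f (x + t *\<^sub>R axis j 1) + f x
      = t * t * pd j (pd i f) (x + s *\<^sub>R axis i 1 + u *\<^sub>R axis j 1)"
proof -
  let ?p = "\<lambda>s u. x + s *\<^sub>R axis i 1 + u *\<^sub>R axis j 1"
  have swap: "?p s u = x + u *\<^sub>R axis j 1 + s *\<^sub>R axis i 1" for s u by (simp add: algebra_simps)
  have S0: "?p s 0 \<in> S" if "0 \<le> s" "s \<le> t" for s using S[of s 0] that t by simp
  let ?\<phi> = "\<lambda>s. f (?p s t) - f (?p s 0)"
  have "(?\<phi> has_real_derivative pd i f (?p s t) - pd i f (?p s 0)) (at s)" if "0 \<le> s" "s \<le> t" for s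
  proof (rule DERIV_diff)
    show "((\<lambda>s. f (?p s t)) has_real_derivative pd i f (?p s t)) (at s)"
      using has_real_derivative_along_axis[of f "x + t *\<^sub>R axis j 1" s i] f(1)[OF S[of s t]] that t
      by (simp add: swap)
    show "((\<lambda>s. f (?p s 0)) has_real_derivative pd i f (?p s 0)) (at s)"
      using has_real_derivative_along_axis[of f x s i] f(1)[OF S0[of s]] that t by simp
  qed
  then obtain s where s: "0 < s" "s < t" "?\<phi> t - ?\<phi> 0 = (t - 0) * (pd i f (?p s t) - pd i f (?p s 0))"
    using MVT2[of 0 t ?\<phi> "\<lambda>s. pd i f (?p s t) - pd i f (?p s 0)"] t by blast
  have "((\<lambda>u. pd i f (?p s u)) has_real_derivative pd j (pd i f) (?p s u)) (at u)"
    if "0 \<le> u" "u \<le> t" for u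
    using has_real_derivative_along_axis[of "pd i f" "x + s *\<^sub>R axis i 1" u j] f(2)[OF S[of s u]] that s
    by simp
  then obtain u where u: "0 < u" "u < t"
    "pd i f (?p s t) - pd i f (?p s 0) = (t - 0) * pd j (pd i f) (?p s u)"
    using MVT2[of 0 t "\<lambda>u. pd i f (?p s u)" "\<lambda>u. pd j (pd i f) (?p s u)"] t by blast
  show ?thesis by (rule that[OF s(1,2) u(1,2)]) (use s(3) u(3) in \<open>simp add: algebra_simps\<close>)
qed

lemma pd_commute_real:
  fixes f :: "real^'n \<Rightarrow> real"
  assumes S: "open S" "x \<in> S" and f: "smooth_on S f"
  shows "pd i (pd j f) x = pd j (pd i f) x"
proof -
  obtain r where r: "0 < r" "ball x r \<subseteq> S" using S open_contains_ball by blast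
  have close: "\<exists>y z. dist y x < e \<and> dist z x < e \<and> pd j (pd i f) y = pd i (pd j f) z"
    if "0 < e" for e
  proof -
    define t where "t = min r e / 4"
    then have t: "0 < t" "2 * t < r" "2 * t < e" using r that by auto
    have near: "dist (x + s *\<^sub>R axis k 1 + u *\<^sub>R axis l 1) x \<le> 2 * t"
      if "0 \<le> s" "s \<le> t" "0 \<le> u" "u \<le> t" for s u and k l :: 'n
      using norm_triangle_ineq[of "s *\<^sub>R axis k (1::real)" "u *\<^sub>R axis l (1::real)"] that
      by (simp add: dist_norm add.assoc)
    have inS: "x + s *\<^sub>R axis k 1 + u *\<^sub>R axis l 1 \<in> S"
      if "0 \<le> s" "s \<le> t" "0 \<le> u" "u \<le> t" for s u and k l :: 'n
      using near[OF that, of k l] t r by (auto simp: dist_commute subset_iff)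
    have d: "f differentiable (at y)" "pd k f differentiable (at y)" if "y \<in> S" for y k
      using smooth_on_differentiable f smooth_on_pd that by blast+
    obtain s u where 1: "0 < s" "s < t" "0 < u" "u < t"
      "f (x + t *\<^sub>R axis i 1 + t *\<^sub>R axis j 1) - f (x + t *\<^sub>R axis i 1) - f (x + t *\<^sub>R axis j 1) + f x
        = t * t * pd j (pd i f) (x + s *\<^sub>R axis i 1 + u *\<^sub>R axis j 1)"
      using second_difference_mean_value[of t x i j S f] t(1) inS d by blast
    obtain s' u' where 2: "0 < s'" "s' < t" "0 < u'" "u' < t"
      "f (x + t *\<^sub>R axis j 1 + t *\<^sub>R axis i 1) - f (x + t *\<^sub>R axis j 1) - f (x + t *\<^sub>R axis i 1) + f x
        = t * t * pd i (pd j f) (x + s' *\<^sub>R axis j 1 + u' *\<^sub>R axis i 1)"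
      using second_difference_mean_value[of t x j i S f] t(1) inS d by blast
    have "t * t * pd j (pd i f) (x + s *\<^sub>R axis i 1 + u *\<^sub>R axis j 1)
        = t * t * pd i (pd j f) (x + s' *\<^sub>R axis j 1 + u' *\<^sub>R axis i 1)"
      using 1(5) 2(5) by (simp add: algebra_simps)
    then have "pd j (pd i f) (x + s *\<^sub>R axis i 1 + u *\<^sub>R axis j 1)
        = pd i (pd j f) (x + s' *\<^sub>R axis j 1 + u' *\<^sub>R axis i 1)"
      using t(1) by simp
    moreover have "dist (x + s *\<^sub>R axis i 1 + u *\<^sub>R axis j 1) x < e"
      using near[of s u i j] 1 t by linarith
    moreover have "dist (x + s' *\<^sub>R axis j 1 + u' *\<^sub>R axis i 1) x < e"
      using near[of s' u' j i] 2 t by linarith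
    ultimately show ?thesis by blast
  qed
  have cont: "isCont (pd k (pd l f)) x" for k l
    using smooth_on_continuous[OF smooth_on_pd[OF smooth_on_pd[OF f]]] S continuous_on_eq_continuous_at
    by blast
  show ?thesis
  proof (rule ccontr)
    define e where "e = \<bar>pd i (pd j f) x - pd j (pd i f) x\<bar> / 2"
    assume "pd i (pd j f) x \<noteq> pd j (pd i f) x"
    then have "0 < e" by (simp add: e_def)
    obtain d1 where d1: "0 < d1"
      "\<And>y. dist y x < d1 \<Longrightarrow> dist (pd j (pd i f) y) (pd j (pd i f) x) < e"
      using cont[of j i] \<open>0 < e\<close> unfolding continuous_at_eps_delta by blast
    obtain d2 where d2: "0 < d2"
      "\<And>y. dist y x < d2 \<Longrightarrow> dist (pd i (pd j f) y) (pd i (pd j f) x) < e"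
      using cont[of i j] \<open>0 < e\<close> unfolding continuous_at_eps_delta by blast
    note d = d1(1) d2(1) d1(2) d2(2)
    obtain y z where "dist y x < d1" "dist z x < d2" "pd j (pd i f) y = pd i (pd j f) z"
      using close[of "min d1 d2"] d by auto
    then have "\<bar>pd j (pd i f) y - pd j (pd i f) x\<bar> < e" "\<bar>pd j (pd i f) y - pd i (pd j f) x\<bar> < e"
      using d(3)[of y] d(4)[of z] by (simp_all add: dist_real_def)
    moreover have "\<bar>pd i (pd j f) x - pd j (pd i f) x\<bar> \<le>
        \<bar>pd j (pd i f) y - pd j (pd i f) x\<bar> + \<bar>pd j (pd i f) y - pd i (pd j f) x\<bar>"
      by (smt (verit))
    ultimately show False by (simp add: e_def)
  qed
qed

lemma pd_commute:
  fixes f :: "real^'n \<Rightarrow> 'b::euclidean_space"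
  assumes S: "open S" "x \<in> S" and f: "smooth_on S f"
  shows "pd i (pd j f) x = pd j (pd i f) x"
proof (rule euclidean_eqI)
  fix b :: 'b
  assume "b \<in> Basis"
  have d: "pd k (\<lambda>y. f y \<bullet> b) y = pd k f y \<bullet> b" if "y \<in> S" for y k
    using smooth_on_differentiable[OF f that] by (intro pd_linear bounded_linear_inner_left)
  have dd: "pd l (pd k f) x \<bullet> b = pd l (pd k (\<lambda>y. f y \<bullet> b)) x" for k l
  proof -
    have "pd l (pd k f) x \<bullet> b = pd l (\<lambda>y. pd k f y \<bullet> b) x"
      using smooth_on_differentiable[OF smooth_on_pd[OF f] S(2)]
      by (intro pd_linear[symmetric] bounded_linear_inner_left)
    also have "\<dots> = pd l (pd k (\<lambda>y. f y \<bullet> b)) x"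
      using d by (intro pd_cong[OF S]) simp
    finally show ?thesis .
  qed
  have "smooth_on S (\<lambda>y. f y \<bullet> b)" by (rule smooth_on_linear[OF bounded_linear_inner_left S(1) f])
  then show "pd i (pd j f) x \<bullet> b = pd j (pd i f) x \<bullet> b"
    using pd_commute_real[OF S] dd by simp
qed

subsection \<open>Product rules\<close>

lemmas pd_scaleR = pd_bilinear[OF bounded_bilinear_scaleR]
  and pd_mult = pd_bilinear[OF bounded_bilinear_mult[where 'a = real]]
  and pd_inner = pd_bilinear[OF bounded_bilinear_inner]
  and pd_matvec = pd_bilinear[OF bounded_bilinear_matrix_vector]
  and pd_matmul = pd_bilinear[OF bounded_bilinear_matrix_matrix]
  and pd_transpose = pd_linear[OF bounded_linear_transpose]
  and pd_trace = pd_linear[OF bounded_linear_trace]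

lemma pd_const [simp]: "pd i (\<lambda>_. c) x = 0"
  by (simp add: pd_def)

lemma pd_diff:
  "f differentiable (at x) \<Longrightarrow> g differentiable (at x) \<Longrightarrow> pd i (\<lambda>x. f x - g x) x = pd i f x - pd i g x"
  unfolding pd_def[of i f] pd_def[of i g]
  by (rule pd_eqI, rule derivative_intros) (simp_all add: frechet_derivative_works)

lemma pd_sum:
  "(\<And>k. k \<in> I \<Longrightarrow> f k differentiable (at x)) \<Longrightarrow> pd i (\<lambda>x. \<Sum>k\<in>I. f k x) x = (\<Sum>k\<in>I. pd i (f k) x)"
  unfolding pd_def[of i "f _"]
  by (rule pd_eqI, rule derivative_intros) (simp_all add: frechet_derivative_works)

lemma pd_nth:
  fixes f :: "real^'n \<Rightarrow> 'b::euclidean_space^'m"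
  shows "f differentiable (at x) \<Longrightarrow> pd i (\<lambda>x. f x $ k) x = pd i f x $ k"
  by (rule pd_linear[OF bounded_linear_vec_nth])

lemma pd_ident [simp]: "pd i (\<lambda>x. x) x = axis i 1"
  by (simp add: pd_def)

section \<open>Connections\<close>

subsection \<open>Differentiation by a matrix connection\<close>

lemma matrix_mult_distribs:
  fixes A A' :: "'a::comm_ring_1^'n^'m" and B B' :: "'a^'k^'n"
  shows "(A + A') ** B = A ** B + A' ** B" "A ** (B + B') = A ** B + A ** B'"
    "(A - A') ** B = A ** B - A' ** B" "A ** (B - B') = A ** B - A ** B'"
    "(- A) ** B = - (A ** B)" "A ** (- B) = - (A ** B)"
  by (simp_all add: vec_eq_iff matrix_matrix_mult_def sum.distrib algebra_simps sum_subtractf sum_negf)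

lemma matrix_vector_distribs:
  fixes A A' :: "'a::comm_ring_1^'n^'m"
  shows "(A + A') *v v = A *v v + A' *v v" "A *v (v + w) = A *v v + A *v w"
    "(A - A') *v v = A *v v - A' *v v" "A *v (v - w) = A *v v - A *v w"
    "(- A) *v v = - (A *v v)" "A *v (- v) = - (A *v v)"
  by (simp_all add: vec_eq_iff matrix_vector_mult_def sum.distrib algebra_simps sum_subtractf sum_negf)

lemma matrix_vector_scaleR:
  fixes A :: "real^'n^'m"
  shows "(c *\<^sub>R A) *v v = c *\<^sub>R (A *v v)" "A *v (c *\<^sub>R v) = c *\<^sub>R (A *v v)"
  by (simp_all add: vec_eq_iff matrix_vector_mult_def sum_distrib_left mult_ac)

lemma matrix_mult_scaleR:
  fixes A :: "real^'n^'m" and B :: "real^'k^'n"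
  shows "(c *\<^sub>R A) ** B = c *\<^sub>R (A ** B)" "A ** (c *\<^sub>R B) = c *\<^sub>R (A ** B)"
  by (simp_all add: vec_eq_iff matrix_matrix_mult_def sum_distrib_left mult_ac)

lemma matrix_vector_sum:
  fixes A :: "'a::comm_ring_1^'n^'m"
  shows "(\<Sum>i\<in>I. B i :: 'a^'n^'m) *v v = (\<Sum>i\<in>I. B i *v v)" "A *v (\<Sum>i\<in>I. w i) = (\<Sum>i\<in>I. A *v w i)"
  by (induction I rule: infinite_finite_induct) (simp_all add: matrix_vector_distribs)

lemma matrix_mult_sum:
  fixes A :: "'a::comm_ring_1^'n^'m" and W :: "_ \<Rightarrow> 'a^'k^'n"
  shows "(\<Sum>i\<in>I. B i) ** (C :: 'a^'k^'n) = (\<Sum>i\<in>I. (B i :: 'a^'n^'m) ** C)"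
    "A ** (\<Sum>i\<in>I. W i) = (\<Sum>i\<in>I. A ** W i)"
  by (induction I rule: infinite_finite_induct) (simp_all add: matrix_mult_distribs)

text \<open>
  A connection is given by one matrix function for every coordinate direction. It differentiates
  vector fields and, through commutators, fields of endomorphisms.
\<close>

definition vD :: "('n \<Rightarrow> real^'n \<Rightarrow> real^'p^'p) \<Rightarrow> 'n \<Rightarrow> (real^'n \<Rightarrow> real^'p) \<Rightarrow> real^'n \<Rightarrow> real^'p" where
  "vD C i V x = pd i V x + C i x *v V x"

definition mD :: "('n \<Rightarrow> real^'n \<Rightarrow> real^'p^'p) \<Rightarrow> 'n \<Rightarrow> (real^'n \<Rightarrow> real^'p^'p) \<Rightarrow> real^'n \<Rightarrow> real^'p^'p" where
  "mD C i B x = pd i B x + (C i x ** B x - B x ** C i x)"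

definition curv :: "('n \<Rightarrow> real^'n \<Rightarrow> real^'p^'p) \<Rightarrow> 'n \<Rightarrow> 'n \<Rightarrow> real^'n \<Rightarrow> real^'p^'p" where
  "curv C i j x = pd i (C j) x - pd j (C i) x + (C i x ** C j x - C j x ** C i x)"

lemma vD_smooth:
  "open S \<Longrightarrow> (\<And>i. smooth_on S (C i)) \<Longrightarrow> smooth_on S V \<Longrightarrow> smooth_on S (vD C i V)"
  unfolding vD_def[abs_def] by (intro smooth_intros)

lemma mD_smooth:
  "open S \<Longrightarrow> (\<And>i. smooth_on S (C i)) \<Longrightarrow> smooth_on S B \<Longrightarrow> smooth_on S (mD C i B)"
  unfolding mD_def[abs_def] by (intro smooth_intros)

lemma vD_cong:
  assumes "open S" "x \<in> S" "\<And>y. y \<in> S \<Longrightarrow> V y = W y"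
  shows "vD C i V x = vD C i W x"
  unfolding vD_def using pd_cong[OF assms] assms by simp

lemma vD_commute:
  assumes S: "open S" "x \<in> S" and C: "\<And>i. smooth_on S (C i)" and V: "smooth_on S V"
  shows "vD C i (vD C j V) x - vD C j (vD C i V) x = curv C i j x *v V x"
proof -
  note d = smooth_on_differentiable[OF _ S(2)]
  have "vD C i (vD C j V) x = pd i (pd j V) x + (pd i (C j) x *v V x + C j x *v pd i V x)
      + (C i x *v pd j V x + C i x *v (C j x *v V x))" for i j
  proof -
    have "pd i (vD C j V) x = pd i (pd j V) x + (pd i (C j) x *v V x + C j x *v pd i V x)"
      unfolding vD_def[abs_def]
      by (subst pd_add) (auto intro!: d smooth_intros C V S pd_matvec)
    then show ?thesis by (simp add: vD_def[of C i] vD_def[of C j] matrix_vector_distribs)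
  qed
  from this[of i j] this[of j i] show ?thesis
    using pd_commute[OF S V, of i j]
    by (simp add: curv_def matrix_vector_distribs matrix_vector_mul_assoc[symmetric] algebra_simps)
qed

lemma mD_commute:
  assumes S: "open S" "x \<in> S" and C: "\<And>i. smooth_on S (C i)" and B: "smooth_on S B"
  shows "mD C i (mD C j B) x - mD C j (mD C i B) x = curv C i j x ** B x - B x ** curv C i j x"
proof -
  note d = smooth_on_differentiable[OF _ S(2)]
  have "mD C i (mD C j B) x = pd i (pd j B) x
      + ((pd i (C j) x ** B x + C j x ** pd i B x) - (pd i B x ** C j x + B x ** pd i (C j) x))
      + (C i x ** (pd j B x + (C j x ** B x - B x ** C j x))
         - (pd j B x + (C j x ** B x - B x ** C j x)) ** C i x)" for i j
  proof -
    have "pd i (mD C j B) x = pd i (pd j B) x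
      + ((pd i (C j) x ** B x + C j x ** pd i B x) - (pd i B x ** C j x + B x ** pd i (C j) x))"
      unfolding mD_def[abs_def]
      apply (subst pd_add)
        apply (auto intro!: d smooth_intros C B S)[2]
      apply (subst pd_diff)
        apply (auto intro!: d smooth_intros C B S)[2]
      apply (subst pd_matmul)
        apply (auto intro!: d smooth_intros C B S)[2]
      apply (subst pd_matmul)
        apply (auto intro!: d smooth_intros C B S)
      done
    then show ?thesis by (simp add: mD_def[of C i] mD_def[of C j])
  qed
  note eq = this
  show ?thesis
    unfolding eq[of i j] eq[of j i] pd_commute[OF S B, of i j] curv_def
    by (simp add: matrix_mult_distribs matrix_mul_assoc algebra_simps)
qed

lemma vD_matvec:
  assumes "B differentiable (at x)" "V differentiable (at x)"
  shows "vD C i (\<lambda>x. B x *v V x) x = mD C i B x *v V x + B x *v vD C i V x"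
  using assms by (simp add: vD_def mD_def pd_matvec matrix_vector_distribs matrix_vector_mul_assoc)

lemma vD_const: "vD C i (\<lambda>_. v) x = C i x *v v"
  by (simp add: vD_def)

lemma vD_scaleR:
  assumes "f differentiable (at x)" "V differentiable (at x)"
  shows "vD C i (\<lambda>x. f x *\<^sub>R V x) x = pd i f x *\<^sub>R V x + f x *\<^sub>R vD C i V x"
  using assms by (simp add: vD_def pd_scaleR matrix_vector_scaleR algebra_simps)

lemma vD_add:
  assumes "W differentiable (at x)" "V differentiable (at x)"
  shows "vD C i (\<lambda>x. W x + V x) x = vD C i W x + vD C i V x"
  using assms by (simp add: vD_def pd_add matrix_vector_distribs)

lemma vD_diff:
  assumes "W differentiable (at x)" "V differentiable (at x)"
  shows "vD C i (\<lambda>x. W x - V x) x = vD C i W x - vD C i V x"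
  using assms by (simp add: vD_def pd_diff matrix_vector_distribs)

lemma vD_sum:
  assumes "\<And>k. k \<in> I \<Longrightarrow> V k differentiable (at x)"
  shows "vD C i (\<lambda>x. \<Sum>k\<in>I. V k x) x = (\<Sum>k\<in>I. vD C i (V k) x)"
  using assms by (simp add: vD_def pd_sum matrix_vector_sum sum.distrib)

lemma mD_matmul:
  assumes "B differentiable (at x)" "B' differentiable (at x)"
  shows "mD C i (\<lambda>x. B x ** B' x) x = mD C i B x ** B' x + B x ** mD C i B' x"
  using assms by (simp add: mD_def pd_matmul matrix_mult_distribs matrix_mul_assoc)

lemma pd_trace_mD:
  assumes "B differentiable (at x)"
  shows "pd i (\<lambda>x. trace (B x)) x = trace (mD C i B x)"
  using assms trace_mul_sym[of "C i x" "B x"] by (simp add: mD_def pd_trace trace_add trace_sub)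

lemma inner_transpose: "v \<bullet> (transpose M *v w) = (M *v v) \<bullet> w" for M :: "real^'n^'m"
  by (metis dot_lmul_matrix vector_transpose_matrix)

lemma inner_vector_matrix: "v \<bullet> (w v* M) = (M *v v) \<bullet> w" for M :: "real^'n^'m"
  using inner_transpose[of v M w] by simp

text \<open>\<open>H\<close> is parallel for \<open>C\<close>: the inner product \<open>ip H\<close> obeys the product rule.\<close>

definition metric_connection ::
  "(real^'n) set \<Rightarrow> (real^'n \<Rightarrow> real^'p^'p) \<Rightarrow> ('n \<Rightarrow> real^'n \<Rightarrow> real^'p^'p) \<Rightarrow> bool" where
  "metric_connection S H C \<longleftrightarrow>
     (\<forall>x\<in>S. \<forall>i. pd i H x = transpose (C i x) ** H x + H x ** C i x)"

lemma pd_ip: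
  assumes "metric_connection S H C" "x \<in> S"
    and "H differentiable (at x)" "V differentiable (at x)" "W differentiable (at x)"
  shows "pd i (\<lambda>x. V x \<bullet> (H x *v W x)) x
    = vD C i V x \<bullet> (H x *v W x) + V x \<bullet> (H x *v vD C i W x)"
proof -
  have H: "pd i H x = transpose (C i x) ** H x + H x ** C i x"
    using assms unfolding metric_connection_def by blast
  have "pd i (\<lambda>x. V x \<bullet> (H x *v W x)) x
      = pd i V x \<bullet> (H x *v W x) + V x \<bullet> (pd i H x *v W x + H x *v pd i W x)"
    using assms(3-5)
    by (subst pd_inner) (simp_all add: pd_matvec differentiable_bilinear[OF bounded_bilinear_matrix_vector])
  then show ?thesis
    by (simp add: H vD_def matrix_vector_distribs inner_simps matrix_vector_mul_assoc[symmetric]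
        inner_vector_matrix)
qed

subsection \<open>The Levi-Civita connection in coordinates\<close>

text \<open>
  A nondegenerate metric of any signature on a coordinate domain: both the ambient metric and the
  induced one are instances.
\<close>

locale smooth_metric =
  fixes T :: "(real^'n) set" and G :: "'n metric_field"
  assumes open_T: "open T" and G_smooth: "smooth_on T G"
    and G_sym: "y \<in> T \<Longrightarrow> transpose (G y) = G y" and G_inv: "y \<in> T \<Longrightarrow> invertible (G y)"

definition lc_conn :: "'n metric_field \<Rightarrow> 'n \<Rightarrow> real^'n \<Rightarrow> real^'n^'n" where
  "lc_conn G a y = (\<chi> k j. christoffel G y k a j)"

lemma sym_entry: "transpose (M :: 'a^'n^'n) = M \<Longrightarrow> M $ i $ j = M $ j $ i"
  by (metis transpose_def vec_lambda_beta)

context smooth_metric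
begin

lemma ip_commute: "y \<in> T \<Longrightarrow> ip G y v w = ip G y w v"
  unfolding ip_def using G_sym
  by (metis dot_lmul_matrix inner_commute vector_transpose_matrix)

lemma pd_G_sym: "y \<in> T \<Longrightarrow> transpose (pd a G y) = pd a G y"
  using pd_transpose[OF smooth_on_differentiable[OF G_smooth], of y a]
    pd_cong[OF open_T, of y "\<lambda>y. transpose (G y)" G a] G_sym by simp

lemma christoffel_pd:
  "christoffel G y k i j = (1/2) * (\<Sum>l\<in>UNIV. matrix_inv (G y) $ k $ l *
     (pd i G y $ j $ l + pd j G y $ i $ l - pd l G y $ i $ j))"
  by (simp add: christoffel_def pd_def)

lemma lc_conn_sym: "y \<in> T \<Longrightarrow> lc_conn G a y *v axis b 1 = lc_conn G b y *v axis a 1"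
  using sym_entry[OF pd_G_sym]
  by (simp add: matrix_vector_mult_basis column_def lc_conn_def christoffel_pd vec_eq_iff algebra_simps)

lemma lc_conn_smooth: "smooth_on T (lc_conn G a)"
proof (intro smooth_on_vec open_T)
  fix k j
  show "smooth_on T (\<lambda>y. lc_conn G a y $ k $ j)"
    unfolding lc_conn_def christoffel_pd vec_lambda_beta
    by (intro smooth_intros open_T smooth_on_matrix_inv G_smooth G_inv)
qed

text \<open>
  The Christoffel symbols of the first kind: lowering the index cancels the inverse metric.
\<close>

lemma lc_conn_lower:
  assumes "y \<in> T"
  shows "(G y ** lc_conn G a y) $ l $ j = (1/2) * (pd a G y $ j $ l + pd j G y $ a $ l - pd l G y $ a $ j)"
proof -
  let ?c = "\<chi> m. (1/2) * (pd a G y $ j $ m + pd j G y $ a $ m - pd m G y $ a $ j)"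
  have "(lc_conn G a y *v axis j 1) $ k = (matrix_inv (G y) *v ?c) $ k" for k
  proof -
    have "(lc_conn G a y *v axis j 1) $ k = christoffel G y k a j"
      by (simp add: matrix_vector_mult_basis column_def lc_conn_def)
    also have "\<dots> = (matrix_inv (G y) *v ?c) $ k"
      by (simp add: christoffel_pd matrix_vector_mult_def sum_distrib_left mult_ac)
    finally show ?thesis .
  qed
  then have "lc_conn G a y *v axis j 1 = matrix_inv (G y) *v ?c" by (simp add: vec_eq_iff)
  then have "G y *v (lc_conn G a y *v axis j 1) = ?c"
    by (simp add: matrix_vector_mul_assoc matrix_inv_right[OF G_inv[OF assms]])
  then have "(G y ** lc_conn G a y) *v axis j 1 = ?c" by (simp add: matrix_vector_mul_assoc)
  then show ?thesis by (simp add: matrix_vector_mult_basis column_def vec_eq_iff)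
qed

text \<open>
  In the sum of two Christoffel symbols of the first kind with exchanged last indices all but one
  derivative of the metric cancel.
\<close>

lemma lc_conn_metric: "metric_connection T G (lc_conn G)"
  unfolding metric_connection_def
proof (intro ballI allI)
  fix y a
  assume y: "y \<in> T"
  have t: "transpose (lc_conn G a y) ** G y = transpose (G y ** lc_conn G a y)"
    using G_sym[OF y] by (simp add: matrix_transpose_mul)
  show "pd a G y = transpose (lc_conn G a y) ** G y + G y ** lc_conn G a y"
    unfolding t using sym_entry[OF pd_G_sym[OF y]]
    by (simp add: vec_eq_iff transpose_def lc_conn_lower[OF y] algebra_simps)
qed

end

subsection \<open>Pulling the connection back along a map\<close>

text \<open>
  The pullback of the Levi-Civita connection along \<open>F\<close>, so that \<open>cov_along\<close> becomes
  differentiation by a matrix connection on the source. Along the identity it is the Levi-Civita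
  connection itself.
\<close>

definition pull_conn :: "'p metric_field \<Rightarrow> (real^'n \<Rightarrow> real^'p) \<Rightarrow> 'n \<Rightarrow> real^'n \<Rightarrow> real^'p^'p" where
  "pull_conn G F i x = (\<Sum>a\<in>UNIV. pd i F x $ a *\<^sub>R lc_conn G a (F x))"

lemma pull_conn_ident: "pull_conn G (\<lambda>x. x) = lc_conn G"
  by (simp add: fun_eq_iff pull_conn_def axis_def if_distrib[of "\<lambda>c. c *\<^sub>R _"] cong: if_cong)

lemma cov_along_vD:
  assumes "F differentiable (at x)" "V differentiable (at x)"
  shows "cov_along G F X V x = (\<Sum>i\<in>UNIV. X x $ i *\<^sub>R vD (pull_conn G F) i V x)"
proof -
  let ?w = "frechet_derivative F (at x) (X x)"
  have "(\<chi> k. \<Sum>a\<in>UNIV. \<Sum>j\<in>UNIV. christoffel G (F x) k a j * ?w $ a * V x $ j)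
      = (\<Sum>a\<in>UNIV. ?w $ a *\<^sub>R (lc_conn G a (F x) *v V x))"
    by (simp add: vec_eq_iff lc_conn_def matrix_vector_mult_def sum_distrib_left mult_ac)
  also have "\<dots> = (\<Sum>a\<in>UNIV. \<Sum>i\<in>UNIV. (X x $ i * pd i F x $ a) *\<^sub>R (lc_conn G a (F x) *v V x))"
    by (simp add: frechet_derivative_pd[OF assms(1)] sum_distrib_right scaleR_sum_left)
  also have "\<dots> = (\<Sum>i\<in>UNIV. X x $ i *\<^sub>R (pull_conn G F i x *v V x))"
    by (subst sum.swap)
      (simp add: pull_conn_def matrix_vector_sum matrix_vector_scaleR scaleR_sum_right)
  finally show ?thesis
    by (simp add: cov_along_def frechet_derivative_pd[OF assms(2)] vD_def scaleR_add_right sum.distrib)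
qed

locale pullback = smooth_metric T G
  for T :: "(real^'p) set" and G :: "'p metric_field" +
  fixes S :: "(real^'n) set" and F :: "real^'n \<Rightarrow> real^'p"
  assumes open_S: "open S" and F_smooth: "smooth_on S F" and F_into: "F ` S \<subseteq> T"
begin

abbreviation "C \<equiv> pull_conn G F"

lemma F_T: "x \<in> S \<Longrightarrow> F x \<in> T"
  using F_into by blast

lemma G_F_smooth: "smooth_on S (\<lambda>x. G (F x))"
  by (rule smooth_on_compose[OF open_S F_smooth G_smooth F_into])

lemma lc_F_smooth: "smooth_on S (\<lambda>x. lc_conn G a (F x))"
  by (rule smooth_on_compose[OF open_S F_smooth lc_conn_smooth F_into])

lemma C_smooth: "smooth_on S (C i)"
  unfolding pull_conn_def[abs_def] by (intro smooth_intros open_S F_smooth lc_F_smooth)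

lemma C_metric: "metric_connection S (\<lambda>x. G (F x)) C"
  unfolding metric_connection_def
proof (intro ballI allI)
  fix x i
  assume x: "x \<in> S"
  have "pd i (\<lambda>x. G (F x)) x = (\<Sum>a\<in>UNIV. pd i F x $ a *\<^sub>R pd a G (F x))"
    using smooth_on_differentiable[OF G_smooth F_T[OF x]] smooth_on_differentiable[OF F_smooth x]
    by (rule pd_compose)
  also have "\<dots> = (\<Sum>a\<in>UNIV. pd i F x $ a *\<^sub>R
      (transpose (lc_conn G a (F x)) ** G (F x) + G (F x) ** lc_conn G a (F x)))"
    using lc_conn_metric F_T[OF x] unfolding metric_connection_def by simp
  also have "\<dots> = transpose (C i x) ** G (F x) + G (F x) ** C i x"
    by (simp add: pull_conn_def matrix_mult_sum matrix_mult_scaleR scaleR_add_right sum.distrib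
        linear_sum[OF bounded_linear.linear[OF bounded_linear_transpose]]
        linear_scale[OF bounded_linear.linear[OF bounded_linear_transpose]])
  finally show "pd i (\<lambda>x. G (F x)) x = transpose (C i x) ** G (F x) + G (F x) ** C i x" .
qed

text \<open>
  Both the second derivatives of \<open>F\<close> and the Christoffel symbols are symmetric.
\<close>

lemma torsion_free:
  assumes "x \<in> S"
  shows "vD C i (pd j F) x = vD C j (pd i F) x"
proof -
  have exp: "C i x *v pd j F x
      = (\<Sum>a\<in>UNIV. \<Sum>b\<in>UNIV. (pd i F x $ a * pd j F x $ b) *\<^sub>R (lc_conn G a (F x) *v axis b 1))" for i j
    unfolding pull_conn_def
    by (subst axis_expansion[of "pd j F x"], subst sum.swap)
      (simp only: matrix_vector_sum matrix_vector_scaleR scaleR_sum_right scaleR_scaleR mult.commute)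
  have "C i x *v pd j F x = C j x *v pd i F x"
    unfolding exp by (subst sum.swap) (simp add: lc_conn_sym[OF F_T[OF assms]] mult.commute)
  then show ?thesis using pd_commute[OF open_S assms F_smooth, of i j] by (simp add: vD_def)
qed

text \<open>
  The derivative of the pulled back connection also contains second derivatives of \<open>F\<close>. They are
  symmetric in \<open>i, j\<close> and drop out of the curvature.
\<close>

lemma curv_pull:
  assumes x: "x \<in> S"
  shows "curv C i j x = (\<Sum>a\<in>UNIV. \<Sum>b\<in>UNIV. (pd i F x $ a * pd j F x $ b) *\<^sub>R curv (lc_conn G) a b (F x))"
proof -
  note dF = smooth_on_differentiable[OF smooth_on_pd[OF F_smooth] x]
  let ?L = "\<lambda>a. lc_conn G a (F x)"
  have pdL: "pd i (\<lambda>x. lc_conn G b (F x)) x = (\<Sum>a\<in>UNIV. pd i F x $ a *\<^sub>R pd a (lc_conn G b) (F x))" for i b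
    using smooth_on_differentiable[OF lc_conn_smooth F_T[OF x]] smooth_on_differentiable[OF F_smooth x]
    by (rule pd_compose)
  have 1: "pd i (C j) x = (\<Sum>b\<in>UNIV. pd i (pd j F) x $ b *\<^sub>R ?L b)
      + (\<Sum>a\<in>UNIV. \<Sum>b\<in>UNIV. (pd i F x $ a * pd j F x $ b) *\<^sub>R pd a (lc_conn G b) (F x))" for i j
  proof -
    have "pd i (C j) x = (\<Sum>b\<in>UNIV. pd i (\<lambda>x. pd j F x $ b *\<^sub>R lc_conn G b (F x)) x)"
      unfolding pull_conn_def[abs_def]
      by (rule pd_sum, rule smooth_on_differentiable[OF _ x])
        (intro smooth_intros open_S F_smooth lc_F_smooth)
    also have "\<dots> = (\<Sum>b\<in>UNIV. pd i (pd j F) x $ b *\<^sub>R ?L b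
        + pd j F x $ b *\<^sub>R pd i (\<lambda>x. lc_conn G b (F x)) x)"
      using smooth_on_differentiable[OF smooth_on_nth[OF open_S smooth_on_pd[OF F_smooth]] x]
        smooth_on_differentiable[OF lc_F_smooth x]
      by (simp add: pd_scaleR pd_nth[OF dF])
    finally show ?thesis
      by (subst sum.swap) (simp add: pdL sum.distrib scaleR_sum_right mult.commute)
  qed
  have 2: "C i x ** C j x = (\<Sum>a\<in>UNIV. \<Sum>b\<in>UNIV. (pd i F x $ a * pd j F x $ b) *\<^sub>R (?L a ** ?L b))" for i j
    unfolding pull_conn_def
    by (subst sum.swap) (simp add: matrix_mult_sum matrix_mult_scaleR scaleR_sum_right mult.commute)
  have swap: "(\<Sum>a\<in>UNIV. \<Sum>b\<in>UNIV. (pd j F x $ a * pd i F x $ b) *\<^sub>R M a b)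
      = (\<Sum>a\<in>UNIV. \<Sum>b\<in>UNIV. (pd i F x $ a * pd j F x $ b) *\<^sub>R M b a)" for M :: "'p \<Rightarrow> 'p \<Rightarrow> real^'p^'p"
    by (subst sum.swap) (simp add: mult.commute)
  have "curv C i j x
      = (\<Sum>a\<in>UNIV. \<Sum>b\<in>UNIV. (pd i F x $ a * pd j F x $ b) *\<^sub>R pd a (lc_conn G b) (F x))
      - (\<Sum>a\<in>UNIV. \<Sum>b\<in>UNIV. (pd i F x $ a * pd j F x $ b) *\<^sub>R pd b (lc_conn G a) (F x))
      + ((\<Sum>a\<in>UNIV. \<Sum>b\<in>UNIV. (pd i F x $ a * pd j F x $ b) *\<^sub>R (?L a ** ?L b))
        - (\<Sum>a\<in>UNIV. \<Sum>b\<in>UNIV. (pd i F x $ a * pd j F x $ b) *\<^sub>R (?L b ** ?L a)))"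
    unfolding curv_def 1 2 swap pd_commute[OF open_S x F_smooth, of i j] by simp
  then show ?thesis
    unfolding curv_def
    by (simp only: scaleR_add_right scaleR_diff_right sum.distrib sum_subtractf)
qed

end

section \<open>Constant curvature\<close>

subsection \<open>Symmetries of the curvature\<close>

text \<open>
  Mixed partial derivatives of the function \<open>\<langle>v, w\<rangle>\<close>, for constant \<open>v\<close> and \<open>w\<close>, commute.
\<close>

lemma curv_skew:
  assumes S: "open S" "x \<in> S" and C: "\<And>i. smooth_on S (C i)" and H: "smooth_on S H"
    and m: "metric_connection S H C"
  shows "(curv C i j x *v v) \<bullet> (H x *v w) + v \<bullet> (H x *v (curv C i j x *v w)) = 0"
proof -
  note d = smooth_on_differentiable
  let ?ip = "\<lambda>V W x. V x \<bullet> (H x *v W x)"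
  have 1: "pd j (?ip V W) y = ?ip (vD C j V) W y + ?ip V (vD C j W) y"
    if "y \<in> S" "smooth_on S V" "smooth_on S W" for j V W y
    using that by (intro pd_ip[OF m]) (auto intro: d H)
  have V: "smooth_on S (\<lambda>_. v)" "smooth_on S (\<lambda>_. w)" by (rule smooth_on_const)+
  note D = vD_smooth[OF S(1) C]
  have ips: "smooth_on S (?ip V W)" if "smooth_on S V" "smooth_on S W" for V W
    using that by (intro smooth_intros S H)
  have 2: "pd i (pd j (?ip (\<lambda>_. v) (\<lambda>_. w))) x
      = ?ip (vD C i (vD C j (\<lambda>_. v))) (\<lambda>_. w) x + ?ip (vD C j (\<lambda>_. v)) (vD C i (\<lambda>_. w)) x
      + (?ip (vD C i (\<lambda>_. v)) (vD C j (\<lambda>_. w)) x + ?ip (\<lambda>_. v) (vD C i (vD C j (\<lambda>_. w))) x)" for i j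
  proof -
    have "pd i (pd j (?ip (\<lambda>_. v) (\<lambda>_. w))) x
        = pd i (\<lambda>y. ?ip (vD C j (\<lambda>_. v)) (\<lambda>_. w) y + ?ip (\<lambda>_. v) (vD C j (\<lambda>_. w)) y) x"
      by (rule pd_cong[OF S]) (rule 1[OF _ V])
    also have "\<dots> = pd i (?ip (vD C j (\<lambda>_. v)) (\<lambda>_. w)) x + pd i (?ip (\<lambda>_. v) (vD C j (\<lambda>_. w))) x"
      by (intro pd_add d[OF _ S(2)] ips V D)
    finally show ?thesis by (simp only: 1[OF S(2) D[OF V(1)] V(2)] 1[OF S(2) V(1) D[OF V(2)]])
  qed
  have "pd i (pd j (?ip (\<lambda>_. v) (\<lambda>_. w))) x = pd j (pd i (?ip (\<lambda>_. v) (\<lambda>_. w))) x"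
    by (rule pd_commute[OF S ips[OF V]])
  then have "(vD C i (vD C j (\<lambda>_. v)) x - vD C j (vD C i (\<lambda>_. v)) x) \<bullet> (H x *v w)
      + v \<bullet> (H x *v (vD C i (vD C j (\<lambda>_. w)) x - vD C j (vD C i (\<lambda>_. w)) x)) = 0"
    unfolding 2 by (simp add: inner_simps matrix_vector_distribs)
  then show ?thesis
    by (simp only: vD_commute[OF S C V(1)] vD_commute[OF S C V(2)])
qed

lemma curv_antisym: "curv C i j x = - curv C j i x"
  by (simp add: curv_def)

context smooth_metric
begin

lemma riemann_curv:
  assumes y: "y \<in> T"
  shows "riemann G y v w z = (\<Sum>a\<in>UNIV. \<Sum>b\<in>UNIV. (v $ a * w $ b) *\<^sub>R (curv (lc_conn G) a b y *v z))"
proof -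
  let ?L = "lc_conn G"
  have 1: "levi_civita G (\<lambda>_. w) (\<lambda>_. z) = (\<lambda>y. \<Sum>b\<in>UNIV. w $ b *\<^sub>R (?L b y *v z))" for w z
    by (simp add: fun_eq_iff levi_civita_def cov_along_vD pull_conn_ident vD_const)
  have sm: "smooth_on T (\<lambda>y. \<Sum>b\<in>UNIV. w $ b *\<^sub>R (?L b y *v z))" for w z
    by (intro smooth_intros open_T lc_conn_smooth)
  have sm1: "smooth_on T (\<lambda>y. ?L b y *v z)" for b z
    by (intro smooth_intros open_T lc_conn_smooth)
  have D: "vD ?L a (\<lambda>y. \<Sum>b\<in>UNIV. w $ b *\<^sub>R (?L b y *v z)) y
      = (\<Sum>b\<in>UNIV. w $ b *\<^sub>R vD ?L a (vD ?L b (\<lambda>_. z)) y)" for a w z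
  proof -
    have "vD ?L a (\<lambda>y. \<Sum>b\<in>UNIV. w $ b *\<^sub>R (?L b y *v z)) y
        = (\<Sum>b\<in>UNIV. vD ?L a (\<lambda>y. w $ b *\<^sub>R (?L b y *v z)) y)"
      by (rule vD_sum, rule smooth_on_differentiable[OF _ y])
        (intro smooth_intros open_T lc_conn_smooth)
    also have "\<dots> = (\<Sum>b\<in>UNIV. w $ b *\<^sub>R vD ?L a (\<lambda>y. ?L b y *v z) y)"
      by (simp add: vD_scaleR smooth_on_differentiable[OF sm1 y])
    moreover have "(\<lambda>y. ?L b y *v z) = vD ?L b (\<lambda>_. z)" for b
      by (simp add: fun_eq_iff vD_const)
    ultimately show ?thesis by simp
  qed
  have 2: "levi_civita G (\<lambda>_. v) (levi_civita G (\<lambda>_. w) (\<lambda>_. z)) y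
      = (\<Sum>a\<in>UNIV. \<Sum>b\<in>UNIV. (v $ a * w $ b) *\<^sub>R vD ?L a (vD ?L b (\<lambda>_. z)) y)" for v w
    unfolding 1 unfolding levi_civita_def
    by (subst cov_along_vD) (simp_all add: smooth_on_differentiable[OF sm y] pull_conn_ident D scaleR_sum_right)
  have "levi_civita G (\<lambda>_. w) (levi_civita G (\<lambda>_. v) (\<lambda>_. z)) y
      = (\<Sum>a\<in>UNIV. \<Sum>b\<in>UNIV. (v $ a * w $ b) *\<^sub>R vD ?L b (vD ?L a (\<lambda>_. z)) y)"
    unfolding 2 by (subst sum.swap) (simp add: mult.commute)
  then show ?thesis
    unfolding riemann_def 2
    using vD_commute[OF open_T y lc_conn_smooth smooth_on_const[of T z]]
    by (simp add: sum_subtractf[symmetric] scaleR_diff_right[symmetric])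
qed

lemma ip_riemann:
  assumes "y \<in> T"
  shows "ip G y (riemann G y v w z) u
    = (\<Sum>a\<in>UNIV. \<Sum>b\<in>UNIV. (v $ a * w $ b) * ip G y (curv (lc_conn G) a b y *v z) u)"
  by (simp add: riemann_curv[OF assms] ip_def inner_sum_left)

lemma riemann_antisym: "y \<in> T \<Longrightarrow> riemann G y v w z = - riemann G y w v z"
  unfolding riemann_curv
  by (subst (2) sum.swap, subst (2) curv_antisym) (simp add: sum_negf matrix_vector_distribs mult.commute)

lemma riemann_skew:
  assumes y: "y \<in> T"
  shows "ip G y (riemann G y v w z) u = - ip G y (riemann G y v w u) z"
proof -
  have "ip G y (curv (lc_conn G) a b y *v z) u = - ip G y (curv (lc_conn G) a b y *v u) z" for a b
    using curv_skew[OF open_T y lc_conn_smooth G_smooth lc_conn_metric, of a b z u]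
      ip_commute[OF y, of z "curv (lc_conn G) a b y *v u"] by (simp add: ip_def)
  then show ?thesis unfolding ip_riemann[OF y] by (simp add: sum_negf)
qed

text \<open>
  By symmetry of the Christoffel symbols \<open>\<nabla>\<^sub>b e\<^sub>c = \<nabla>\<^sub>c e\<^sub>b\<close>, so the six second derivatives in the cyclic
  sum cancel in pairs.
\<close>

lemma curv_bianchi:
  assumes y: "y \<in> T"
  shows "curv (lc_conn G) a b y *v axis c 1 + curv (lc_conn G) b c y *v axis a 1
    + curv (lc_conn G) c a y *v axis b 1 = 0"
proof -
  let ?L = "lc_conn G"
  have K: "curv ?L a b y *v axis c 1
      = vD ?L a (vD ?L b (\<lambda>_. axis c 1)) y - vD ?L b (vD ?L a (\<lambda>_. axis c 1)) y" for a b c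
    by (rule vD_commute[OF open_T y lc_conn_smooth smooth_on_const, symmetric])
  have sym: "vD ?L a (vD ?L b (\<lambda>_. axis c 1)) y = vD ?L a (vD ?L c (\<lambda>_. axis b 1)) y" for a b c
    by (rule vD_cong[OF open_T y]) (simp add: vD_const lc_conn_sym)
  show ?thesis unfolding K using sym[of a b c] sym[of b c a] sym[of c a b] by simp
qed

lemma riemann_bianchi:
  assumes y: "y \<in> T"
  shows "riemann G y v w z + riemann G y w z v + riemann G y z v w = 0"
proof -
  let ?K = "\<lambda>a b c. curv (lc_conn G) a b y *v axis c 1"
  have exp: "riemann G y v w z
      = (\<Sum>a\<in>UNIV. \<Sum>b\<in>UNIV. \<Sum>c\<in>UNIV. (v $ a * w $ b * z $ c) *\<^sub>R ?K a b c)" for v w z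
    unfolding riemann_curv[OF y]
    by (subst axis_expansion[of z])
      (simp only: matrix_vector_sum matrix_vector_scaleR scaleR_sum_right scaleR_scaleR)
  have 1: "riemann G y w z v
      = (\<Sum>a\<in>UNIV. \<Sum>b\<in>UNIV. \<Sum>c\<in>UNIV. (v $ a * w $ b * z $ c) *\<^sub>R ?K b c a)"
  proof -
    have "riemann G y w z v
        = (\<Sum>b\<in>UNIV. \<Sum>a\<in>UNIV. \<Sum>c\<in>UNIV. (w $ b * z $ c * v $ a) *\<^sub>R ?K b c a)"
      unfolding exp by (rule sum.cong[OF refl], rule sum.swap)
    then show ?thesis by (subst sum.swap) (simp add: mult_ac)
  qed
  have 2: "riemann G y z v w
      = (\<Sum>a\<in>UNIV. \<Sum>b\<in>UNIV. \<Sum>c\<in>UNIV. (v $ a * w $ b * z $ c) *\<^sub>R ?K c a b)"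
  proof -
    have "riemann G y z v w
        = (\<Sum>a\<in>UNIV. \<Sum>c\<in>UNIV. \<Sum>b\<in>UNIV. (z $ c * v $ a * w $ b) *\<^sub>R ?K c a b)"
      unfolding exp by (rule sum.swap)
    also have "\<dots> = (\<Sum>a\<in>UNIV. \<Sum>b\<in>UNIV. \<Sum>c\<in>UNIV. (z $ c * v $ a * w $ b) *\<^sub>R ?K c a b)"
      by (rule sum.cong[OF refl], rule sum.swap)
    finally show ?thesis by (simp add: mult_ac)
  qed
  show ?thesis
    unfolding 1 2 exp[of v w z] sum.distrib[symmetric] scaleR_add_right[symmetric] curv_bianchi[OF y]
    by simp
qed

end

subsection \<open>Sectional curvature determines the curvature tensor\<close>

text \<open>
  Polarising \<open>R v w w v = 0\<close> first in \<open>w\<close> and then in \<open>v\<close> shows that \<open>R\<close> is invariant under cyclic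
  permutations of its first three arguments, and the Bianchi identity turns this into \<open>3 R = 0\<close>.
\<close>

lemma algebraic_curvature_tensor_zero:
  fixes R :: "'v::real_vector \<Rightarrow> 'v \<Rightarrow> 'v \<Rightarrow> 'v \<Rightarrow> real"
  assumes add1: "\<And>v v' w z u. R (v + v') w z u = R v w z u + R v' w z u"
    and add3: "\<And>v w z z' u. R v w (z + z') u = R v w z u + R v w z' u"
    and skew12: "\<And>v w z u. R v w z u = - R w v z u"
    and skew34: "\<And>v w z u. R v w z u = - R v w u z"
    and bianchi: "\<And>v w z u. R v w z u + R w z v u + R z v w u = 0"
    and sec: "\<And>v w. R v w w v = 0"
  shows "R v w z u = 0"
proof -
  have add2: "R v (w + w') z u = R v w z u + R v w' z u" for v w w' z u
    using add1[of w w' v z u] skew12 by (metis minus_add_distrib)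
  have add4: "R v w z (u + u') = R v w z u + R v w z u'" for v w z u u'
    using add3[of v w u u' z] skew34 by (metis minus_add_distrib)
  \<comment> \<open>The sum of the four Bianchi identities that fix one argument each, up to the skew symmetries.\<close>
  have pair: "R v w z u = R z u v w" for v w z u
    using bianchi[of v w z u] bianchi[of w z u v] bianchi[of z u v w] bianchi[of u v w z]
      skew12[of v w z u] skew12[of z u v w] skew34[of z u v w]  skew34[of v w z u]
      skew12[of w z v u] skew34[of w z v u] skew12[of w z u v] skew34[of z w u v]
      skew12[of z v w u] skew34[of z v w u] skew12[of v z w u] skew34[of v z w u] skew34[of v z u w]
      skew12[of w u z v] skew34[of w u z v] skew12[of u w z v] skew34[of u w v z] skew12[of w u v z]
      skew12[of u v z w] skew34[of u v z w] skew12[of v u z w] skew34[of u v w z] skew12[of u v w z]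
      skew12[of z u w v] skew34[of z u w v] skew12[of u z v w]
    by linarith
  have sec3: "R v w z v = 0" for v w z
    using sec[of v "w + z"] sec[of v w] sec[of v z] pair[of v z w v] skew12[of w v v z] skew34[of v w v z]
    by (simp add: add2 add3)
  have swap: "R v w z u = - R u w z v" for v w z u
    using sec3[of "v + u" w z] sec3[of v w z] sec3[of u w z] by (simp add: add1 add4)
  have "R v w z u = R z v w u" for v w z u
    using swap[of v w z u] pair[of u w z v] skew12[of u w z v] skew34[of z v u w] by linarith
  from this[of v w z u] this[of z v w u] show ?thesis using bianchi[of v w z u] by linarith
qed

context smooth_metric
begin

lemma ip_add: "ip G y (v + v') w = ip G y v w + ip G y v' w" "ip G y v (w + w') = ip G y v w + ip G y v w'"
  and ip_diff: "ip G y (v - v') w = ip G y v w - ip G y v' w" "ip G y v (w - w') = ip G y v w - ip G y v w'"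
  and ip_scale: "ip G y (c *\<^sub>R v) w = c * ip G y v w" "ip G y v (c *\<^sub>R w) = c * ip G y v w"
  by (simp_all add: ip_def inner_simps matrix_vector_distribs matrix_vector_scaleR)

lemma ip_nondegenerate:
  assumes "y \<in> T" "\<And>u. ip G y v u = ip G y w u"
  shows "v = w"
proof -
  have "G y *v v = G y *v w"
    using assms(2) ip_commute[OF assms(1)] unfolding ip_def by (metis inner_commute vector_eq_rdot)
  then have "matrix_inv (G y) *v (G y *v v) = matrix_inv (G y) *v (G y *v w)" by simp
  then show ?thesis using matrix_inv_left[OF G_inv[OF assms(1)]] by (simp add: matrix_vector_mul_assoc)
qed

text \<open>
  If \<open>area_form\<close> vanished identically, the form would be zero on the orthogonal complement of a
  nonnull vector \<open>v\<close>, and a nonzero vector there would be orthogonal to everything.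
\<close>

lemma nondegenerate_plane_exists:
  assumes y: "y \<in> T" and card: "2 \<le> CARD('n)"
  obtains v w where "area_form G y v w \<noteq> 0"
proof -
  have nonzero: "\<exists>w::real^'n. w \<noteq> 0 \<and> orthogonal x w" for x
    using orthogonal_to_vector_exists[of x] card by auto
  have null: "ip G y p q = 0"
    if "\<And>v w. P v \<Longrightarrow> P w \<Longrightarrow> P (v + w)" "\<And>v. P v \<Longrightarrow> ip G y v v = 0" "P p" "P q" for P p q
    using that(2)[OF that(1)[OF that(3,4)]] that(2)[OF that(3)] that(2)[OF that(4)]
      ip_commute[OF y, of p q] by (simp add: ip_add)
  obtain v where v: "ip G y v v \<noteq> 0"
  proof (rule ccontr)
    assume "\<not> thesis"
    then have "ip G y v w = 0" for v w using null[of "\<lambda>_. True" v w] that by blast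
    then have "v = (0 :: real^'n)" for v by (intro ip_nondegenerate[OF y]) simp
    then show False using nonzero by blast
  qed
  show ?thesis
  proof (rule ccontr)
    assume "\<not> thesis"
    then have "area_form G y v w = 0" for w using that by blast
    then have sq: "ip G y v v * ip G y w w = (ip G y v w)\<^sup>2" for w by (simp add: area_form_def)
    have self: "ip G y w w = 0" if "ip G y v w = 0" for w
      using sq[of w] that v by simp
    have perp: "ip G y p q = 0" if "ip G y v p = 0" "ip G y v q = 0" for p q
      by (rule null[of "\<lambda>w. ip G y v w = 0"]) (use that self in \<open>auto simp: ip_add\<close>)
    obtain w where w: "w \<noteq> 0" "ip G y v w = 0"
      using nonzero[of "G y *v v"] ip_commute[OF y, of v] by (auto simp: orthogonal_def ip_def inner_commute)
    have "ip G y w z = 0" for z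
    proof -
      define z' where "z' = z - (ip G y v z / ip G y v v) *\<^sub>R v"
      have "ip G y v z' = 0" using v by (simp add: z'_def ip_diff ip_scale)
      then have "ip G y w z' = 0" using perp w by blast
      then show ?thesis using w(2) ip_commute[OF y, of v w] by (simp add: z'_def ip_diff ip_scale)
    qed
    then have "w = 0" by (intro ip_nondegenerate[OF y]) (simp add: ip_def)
    with w show False by simp
  qed
qed

text \<open>
  Degenerate planes are limits of nondegenerate ones: along the line from \<open>(v, w)\<close> in the direction
  of a nondegenerate pair, \<open>area_form\<close> is a polynomial with nonzero leading coefficient.
\<close>

lemma area_form_nonzero_near:
  assumes y: "y \<in> T" and a: "area_form G y p q \<noteq> 0"
  shows "\<forall>\<^sub>F t in at 0. area_form G y (v + t *\<^sub>R p) (w + t *\<^sub>R q) \<noteq> 0"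
proof -
  define P where "P = [:ip G y v v, 2 * ip G y v p, ip G y p p:]"
  define Q where "Q = [:ip G y w w, 2 * ip G y w q, ip G y q q:]"
  define M where "M = [:ip G y v w, ip G y v q + ip G y p w, ip G y p q:]"
  have "area_form G y (v + t *\<^sub>R p) (w + t *\<^sub>R q) = poly (P * Q - M * M) t" for t
    using ip_commute[OF y, of p v] ip_commute[OF y, of q w]
    by (simp add: area_form_def P_def Q_def M_def ip_add ip_scale power2_eq_square algebra_simps)
  moreover have "coeff (P * Q - M * M) 4 = area_form G y p q"
    by (simp add: area_form_def P_def Q_def M_def numeral_eq_Suc power2_eq_square)
  then have "P * Q - M * M \<noteq> 0" using a by auto
  then have "\<forall>\<^sub>F t in at 0. t \<notin> {t. poly (P * Q - M * M) t = 0}"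
    using islimpt_finite[OF poly_roots_finite] islimpt_iff_eventually by blast
  ultimately show ?thesis by simp
qed

text \<open>
  The identity for nondegenerate planes extends to all planes by density and continuity. Then
  \<open>algebraic_curvature_tensor_zero\<close> applies to the difference from the model tensor.
\<close>

lemma constant_curvature_tensor:
  assumes y: "y \<in> T" and card: "2 \<le> CARD('n)"
    and sec: "\<And>v w. area_form G y v w \<noteq> 0 \<Longrightarrow> sectional_curvature G y v w = \<kappa>"
  shows "riemann G y v w z = \<kappa> *\<^sub>R (ip G y w z *\<^sub>R v - ip G y v z *\<^sub>R w)"
proof -
  let ?R = "\<lambda>v w z u. ip G y (riemann G y v w z) u"
  let ?K = "\<lambda>v w z u. ip G y w z * ip G y v u - ip G y v z * ip G y w u"
  have add: "?R (v + v') w z u = ?R v w z u + ?R v' w z u" "?R v w (z + z') u = ?R v w z u + ?R v w z' u"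
    for v v' w z z' u
    by (simp_all add: ip_riemann[OF y] algebra_simps sum.distrib ip_add matrix_vector_distribs)
  have all: "?R v w w v = \<kappa> * area_form G y v w" for v w
  proof -
    obtain p q where a: "area_form G y p q \<noteq> 0" using nondegenerate_plane_exists[OF y card] .
    let ?d = "\<lambda>t. ?R (v + t *\<^sub>R p) (w + t *\<^sub>R q) (w + t *\<^sub>R q) (v + t *\<^sub>R p)
      - \<kappa> * area_form G y (v + t *\<^sub>R p) (w + t *\<^sub>R q)"
    have "\<forall>\<^sub>F t in at 0. ?d t = 0"
      using area_form_nonzero_near[OF y a, of v w]
    proof eventually_elim
      case (elim t)
      then show ?case
        using sec[OF elim] unfolding sectional_curvature_def nonzero_divide_eq_eq[OF elim] by simp
    qed
    then have "(?d \<longlongrightarrow> 0) (at 0)" by (rule tendsto_eventually)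
    moreover have "isCont ?d 0"
      unfolding ip_riemann[OF y] unfolding area_form_def ip_def
      by (intro continuous_intros bounded_linear.isCont[OF matrix_vector_mul_bounded_linear])
    then have "(?d \<longlongrightarrow> ?d 0) (at 0)" by (simp add: isCont_def)
    ultimately have "0 = ?d 0" by (rule tendsto_unique[OF trivial_limit_at])
    then show ?thesis by simp
  qed
  have "?R v w z u - \<kappa> * ?K v w z u = 0" for v w z u
  proof (rule algebraic_curvature_tensor_zero[where R = "\<lambda>v w z u. ?R v w z u - \<kappa> * ?K v w z u"])
    fix v w z u v' z' :: "real^'n"
    show "?R (v + v') w z u - \<kappa> * ?K (v + v') w z u
        = (?R v w z u - \<kappa> * ?K v w z u) + (?R v' w z u - \<kappa> * ?K v' w z u)"
      unfolding add by (simp add: ip_add algebra_simps)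
    show "?R v w (z + z') u - \<kappa> * ?K v w (z + z') u
        = (?R v w z u - \<kappa> * ?K v w z u) + (?R v w z' u - \<kappa> * ?K v w z' u)"
      unfolding add by (simp add: ip_add algebra_simps)
    show "?R v w z u - \<kappa> * ?K v w z u = - (?R w v z u - \<kappa> * ?K w v z u)"
      using riemann_antisym[OF y, of v w z] by (simp add: ip_def inner_simps algebra_simps)
    show "?R v w z u - \<kappa> * ?K v w z u = - (?R v w u z - \<kappa> * ?K v w u z)"
      using riemann_skew[OF y, of v w z u] by (simp add: algebra_simps)
    show "(?R v w z u - \<kappa> * ?K v w z u) + (?R w z v u - \<kappa> * ?K w z v u) + (?R z v w u - \<kappa> * ?K z v w u) = 0"
    proof -
      have "?R v w z u + ?R w z v u + ?R z v w u = 0"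
        using arg_cong[OF riemann_bianchi[OF y, of v w z], of "\<lambda>r. ip G y r u"] by (simp add: ip_def inner_simps)
      then show ?thesis
        using ip_commute[OF y, of v w] ip_commute[OF y, of v z] ip_commute[OF y, of w z]
        by (simp add: algebra_simps)
    qed
    show "?R v w w v - \<kappa> * ?K v w w v = 0"
      using ip_commute[OF y, of v w] by (simp add: all area_form_def power2_eq_square algebra_simps)
  qed
  then show ?thesis
    by (intro ip_nondegenerate[OF y]) (simp add: ip_def inner_simps algebra_simps)
qed

end

section \<open>Hypersurfaces in coordinates\<close>

lemma pd_eq_frechet: "pd j F x = frechet_derivative F (at x) (axis j 1)"
  by (simp add: pd_def)

text \<open>
  The metric is parallel, so differentiating \<open>\<langle>B v, w\<rangle> = \<langle>v, B w\<rangle>\<close> gives the same identity for the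
  derivative of \<open>B\<close>.
\<close>

lemma (in smooth_metric) mD_selfadjoint:
  assumes y: "y \<in> T" and B: "smooth_on T B"
    and sa: "\<And>y v w. y \<in> T \<Longrightarrow> ip G y (B y *v v) w = ip G y v (B y *v w)"
  shows "ip G y (mD (lc_conn G) i B y *v v) w = ip G y v (mD (lc_conn G) i B y *v w)"
proof -
  let ?D = "vD (lc_conn G) i"
  note d = smooth_on_differentiable[OF _ y]
  have Bv: "smooth_on T (\<lambda>y. B y *v v)" for v by (intro smooth_intros open_T B)
  have D: "?D (\<lambda>y. B y *v v) y = mD (lc_conn G) i B y *v v + B y *v (lc_conn G i y *v v)" for v
    by (simp add: vD_matvec d[OF B] vD_const)
  have "pd i (\<lambda>y. (B y *v v) \<bullet> (G y *v w)) y = pd i (\<lambda>y. v \<bullet> (G y *v (B y *v w))) y"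
    by (rule pd_cong[OF open_T y]) (use sa in \<open>simp add: ip_def\<close>)
  moreover have "pd i (\<lambda>y. (B y *v v) \<bullet> (G y *v w)) y
      = ip G y (?D (\<lambda>y. B y *v v) y) w + ip G y (B y *v v) (lc_conn G i y *v w)"
    by (subst pd_ip[OF lc_conn_metric y]) (simp_all add: d G_smooth Bv ip_def vD_const)
  moreover have "pd i (\<lambda>y. v \<bullet> (G y *v (B y *v w))) y
      = ip G y (lc_conn G i y *v v) (B y *v w) + ip G y v (?D (\<lambda>y. B y *v w) y)"
    by (subst pd_ip[OF lc_conn_metric y]) (simp_all add: d G_smooth Bv ip_def vD_const)
  ultimately show ?thesis
    using sa[OF y, of "lc_conn G i y *v v" w] sa[OF y, of v "lc_conn G i y *v w"] by (simp add: D ip_add)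
qed

text \<open>
  An immersed hypersurface with its induced metric \<open>g\<close> and unit normal \<open>\<xi>\<close>, in one pair of charts. The
  ambient space has constant curvature \<open>\<kappa>\<close>, expressed through its full curvature tensor.
\<close>

locale hypersurface_patch = pullback T G U F
  for T :: "(real^'p) set" and G :: "'p metric_field"
    and U :: "(real^'n) set" and F :: "real^'n \<Rightarrow> real^'p" +
  fixes g :: "'n metric_field" and \<xi> :: "real^'n \<Rightarrow> real^'p" and \<kappa> :: real
  assumes codim: "CARD('p) = CARD('n) + 1"
    and g_smooth: "smooth_on U g"
    and g_sym: "x \<in> U \<Longrightarrow> transpose (g x) = g x" and g_inv: "x \<in> U \<Longrightarrow> invertible (g x)"
    and induced: "x \<in> U \<Longrightarrow> ip g x v w
      = ip G (F x) (frechet_derivative F (at x) v) (frechet_derivative F (at x) w)"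
    and \<xi>_smooth: "smooth_on U \<xi>"
    and \<xi>_unit: "x \<in> U \<Longrightarrow> ip G (F x) (\<xi> x) (\<xi> x) \<in> {1, -1}"
    and \<xi>_normal: "x \<in> U \<Longrightarrow> ip G (F x) (frechet_derivative F (at x) v) (\<xi> x) = 0"
    and space_form_curvature: "y \<in> T \<Longrightarrow>
      riemann G y v' w' z' = \<kappa> *\<^sub>R (ip G y w' z' *\<^sub>R v' - ip G y v' z' *\<^sub>R w')"
begin

sublocale M: smooth_metric U g
  by unfold_locales (use open_S g_smooth g_sym g_inv in auto)

abbreviation "\<Gamma> \<equiv> lc_conn g"
abbreviation "tang x \<equiv> frechet_derivative F (at x)"
abbreviation "\<epsilon> x \<equiv> ip G (F x) (\<xi> x) (\<xi> x)"

lemma tang_linear: "x \<in> U \<Longrightarrow> linear (tang x)"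
  by (intro linear_frechet_derivative smooth_on_differentiable[OF F_smooth])

lemma tang_expand: "x \<in> U \<Longrightarrow> tang x v = (\<Sum>j\<in>UNIV. v $ j *\<^sub>R pd j F x)"
  by (intro frechet_derivative_pd smooth_on_differentiable[OF F_smooth])

lemma tang_smooth: "smooth_on U Y \<Longrightarrow> smooth_on U (\<lambda>x. tang x (Y x))"
  using smooth_on_cong[OF open_S, of "\<lambda>x. tang x (Y x)" "\<lambda>x. \<Sum>j\<in>UNIV. Y x $ j *\<^sub>R pd j F x"] tang_expand
  by (simp add: smooth_on_sum smooth_on_scaleR smooth_on_nth smooth_on_pd F_smooth open_S)

lemma \<epsilon>_square: "x \<in> U \<Longrightarrow> \<epsilon> x * \<epsilon> x = 1"
  using \<xi>_unit by fastforce

lemma normal_tang: "x \<in> U \<Longrightarrow> ip G (F x) (\<xi> x) (tang x v) = 0"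
  using \<xi>_normal ip_commute[OF F_T] by metis

lemma tang_normal_unique:
  assumes x: "x \<in> U" and eq: "tang x v + s *\<^sub>R \<xi> x = tang x v' + s' *\<^sub>R \<xi> x"
  shows "v = v'" "s = s'"
proof -
  have "s * \<epsilon> x = s' * \<epsilon> x"
    using arg_cong[OF eq, of "\<lambda>w. ip G (F x) w (\<xi> x)"] \<xi>_normal[OF x] by (simp add: ip_add ip_scale)
  then show s: "s = s'" using \<xi>_unit[OF x] by auto
  then have "tang x v = tang x v'" using eq by simp
  then show "v = v'" by (intro M.ip_nondegenerate[OF x]) (simp add: induced[OF x])
qed

text \<open>
  The map sending \<open>(v, s)\<close> to \<open>dF v + s \<xi>\<close> is injective, and its source and target have the same
  dimension.
\<close>

lemma tang_normal_exists:
  assumes x: "x \<in> U"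
  obtains v s where "w = tang x v + s *\<^sub>R \<xi> x"
proof -
  let ?L = "\<lambda>(v, s). tang x v + s *\<^sub>R \<xi> x"
  have L: "linear ?L"
    using tang_linear[OF x] by (intro linearI) (auto simp: linear_add linear_scale algebra_simps)
  have "inj ?L" using tang_normal_unique[OF x] by (auto simp: inj_def)
  then have "dim (range ?L) = dim (UNIV :: ((real^'n) \<times> real) set)"
    by (intro dim_image_eq L) simp
  then have "dim (range ?L) = DIM(real^'p)" using codim by (simp add: dim_UNIV)
  then have "range ?L = UNIV"
    using dim_eq_full[of "range ?L"] linear_subspace_image[OF L subspace_UNIV] span_eq_iff by metis
  then show ?thesis using that by (metis (mono_tags, lifting) case_prod_conv old.prod.exhaust rangeE UNIV_I)
qed

lemma normal_component:
  assumes x: "x \<in> U" and w: "\<And>k. ip G (F x) w (pd k F x) = 0"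
  shows "w = (\<epsilon> x * ip G (F x) w (\<xi> x)) *\<^sub>R \<xi> x"
proof -
  obtain v s where vs: "w = tang x v + s *\<^sub>R \<xi> x" using tang_normal_exists[OF x] .
  have "ip G (F x) w (tang x u) = 0" for u
    unfolding tang_expand[OF x] ip_def using w
    by (simp add: ip_def matrix_vector_sum matrix_vector_scaleR inner_sum_right)
  then have "ip g x v u = 0" for u
    using normal_tang[OF x] by (simp add: vs ip_add ip_scale induced[OF x])
  then have "v = 0" by (intro M.ip_nondegenerate[OF x]) (simp add: ip_def)
  then have w': "w = s *\<^sub>R \<xi> x" using vs tang_linear[OF x] by (simp add: linear_0)
  then have "ip G (F x) w (\<xi> x) = s * \<epsilon> x" by (simp add: ip_scale)
  then show ?thesis using \<epsilon>_square[OF x] w' by (simp add: mult_ac)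
qed

subsection \<open>The formulas of Gauss and Weingarten\<close>

lemma g_entry: "x \<in> U \<Longrightarrow> ip g x (axis j 1) (axis k 1) = ip G (F x) (pd j F x) (pd k F x)"
  by (simp add: induced pd_eq_frechet)

lemma pd_ip_F:
  assumes "x \<in> U" "smooth_on U V" "smooth_on U W"
  shows "pd i (\<lambda>x. ip G (F x) (V x) (W x)) x
    = ip G (F x) (vD C i V x) (W x) + ip G (F x) (V x) (vD C i W x)"
  unfolding ip_def
  by (intro pd_ip[OF C_metric] smooth_on_differentiable[OF _ assms(1)] G_F_smooth assms)

text \<open>
  Both sides are the Christoffel symbols of the first kind of the induced metric: they are
  symmetric in \<open>i, j\<close> and have the derivatives of the metric as their symmetrisation in \<open>j, k\<close>.
\<close>

lemma tangential_part_second_derivative: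
  assumes x: "x \<in> U"
  shows "ip G (F x) (vD C i (pd j F) x) (pd k F x) = ip g x (\<Gamma> i x *v axis j 1) (axis k 1)"
proof -
  define P where "P = (\<lambda>i j k. ip G (F x) (vD C i (pd j F) x) (pd k F x) - ip g x (\<Gamma> i x *v axis j 1) (axis k 1))"
  have sym: "P i j k = P j i k" for i j k
    using torsion_free[OF x, of i j] M.lc_conn_sym[OF x, of i j] by (simp add: P_def)
  have skew: "P i j k = - P i k j" for i j k
  proof -
    have "pd i (\<lambda>x. ip g x (axis j 1) (axis k 1)) x = pd i (\<lambda>x. ip G (F x) (pd j F x) (pd k F x)) x"
      by (rule pd_cong[OF open_S x g_entry])
    moreover have "pd i (\<lambda>x. ip g x (axis j 1) (axis k 1)) x
        = ip g x (\<Gamma> i x *v axis j 1) (axis k 1) + ip g x (axis j 1) (\<Gamma> i x *v axis k 1)"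
      unfolding ip_def
      by (subst pd_ip[OF M.lc_conn_metric x]) (simp_all add: smooth_on_differentiable[OF g_smooth x] vD_const)
    moreover have "pd i (\<lambda>x. ip G (F x) (pd j F x) (pd k F x)) x
        = ip G (F x) (vD C i (pd j F) x) (pd k F x) + ip G (F x) (pd j F x) (vD C i (pd k F) x)"
      by (intro pd_ip_F x smooth_on_pd F_smooth)
    ultimately show ?thesis
      using ip_commute[OF F_T[OF x], of "pd j F x"] M.ip_commute[OF x, of "axis j 1"] by (simp add: P_def)
  qed
  \<comment> \<open>Symmetric in the first two and skew in the last two arguments: exchanging them in turn gives \<open>P = - P\<close>.\<close>
  have "P i j k = 0"
    using sym[of i j k] skew[of j i k] sym[of j k i] skew[of k j i] sym[of k i j] skew[of i k j] by linarith
  then show ?thesis by (simp add: P_def)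
qed

text \<open>
  The function \<open>\<epsilon>\<close> is smooth with \<open>\<epsilon>\<^sup>2 = 1\<close>, so its derivative vanishes, and this derivative is
  \<open>2 \<langle>\<nabla>\<^sub>i \<xi>, \<xi>\<rangle>\<close>.
\<close>

lemma vD_normal_orthogonal:
  assumes x: "x \<in> U"
  shows "pd i \<epsilon> x = 0" "ip G (F x) (vD C i \<xi> x) (\<xi> x) = 0"
proof -
  have sm: "smooth_on U \<epsilon>" unfolding ip_def by (intro smooth_intros open_S \<xi>_smooth G_F_smooth)
  have "pd i (\<lambda>x. \<epsilon> x * \<epsilon> x) x = pd i (\<lambda>_. 1) x"
    by (rule pd_cong[OF open_S x \<epsilon>_square])
  then have "2 * (\<epsilon> x * pd i \<epsilon> x) = 0"
    using smooth_on_differentiable[OF sm x] by (simp add: pd_mult)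
  then show 0: "pd i \<epsilon> x = 0" using \<epsilon>_square[OF x] by auto
  show "ip G (F x) (vD C i \<xi> x) (\<xi> x) = 0"
    using pd_ip_F[OF x \<xi>_smooth \<xi>_smooth, of i] 0 ip_commute[OF F_T[OF x], of "\<xi> x" "vD C i \<xi> x"] by simp
qed

lemma vD_normal_tangential:
  assumes x: "x \<in> U"
  shows "ip G (F x) (vD C i \<xi> x) (pd j F x) = - ip G (F x) (\<xi> x) (vD C i (pd j F) x)"
proof -
  have "pd i (\<lambda>x. ip G (F x) (\<xi> x) (pd j F x)) x = pd i (\<lambda>_. 0) x"
    by (rule pd_cong[OF open_S x]) (simp add: pd_eq_frechet normal_tang)
  then show ?thesis using pd_ip_F[OF x \<xi>_smooth smooth_on_pd[OF F_smooth], of i j] by simp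
qed

text \<open>
  The shape operator, written with the inverse metric, from which it is seen to be smooth.
\<close>

definition A :: "real^'n \<Rightarrow> real^'n^'n" where
  "A x = - (matrix_inv (g x) ** (\<chi> k i. ip G (F x) (vD C i \<xi> x) (pd k F x)))"

lemma A_smooth: "smooth_on U A"
proof -
  have "smooth_on U (\<lambda>x. ip G (F x) (vD C i \<xi> x) (pd k F x))" for i k
    unfolding ip_def
    by (intro smooth_on_inner smooth_on_matvec open_S G_F_smooth smooth_on_pd F_smooth
        vD_smooth C_smooth \<xi>_smooth)
  then have "smooth_on U (\<lambda>x. \<chi> k i. ip G (F x) (vD C i \<xi> x) (pd k F x))"
    by (intro smooth_on_vec open_S) simp
  then show ?thesis
    unfolding A_def[abs_def]
    by (intro smooth_on_uminus smooth_on_matmul open_S smooth_on_matrix_inv g_smooth g_inv)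
qed

lemma A_lower:
  assumes x: "x \<in> U"
  shows "ip g x (A x *v axis i 1) (axis k 1) = - ip G (F x) (vD C i \<xi> x) (pd k F x)"
proof -
  let ?M = "\<chi> k i. ip G (F x) (vD C i \<xi> x) (pd k F x)"
  have "g x *v (A x *v axis i 1) = - (?M *v axis i 1)"
    using matrix_inv_right[OF g_inv[OF x]]
    by (simp add: A_def matrix_vector_distribs matrix_vector_mul_assoc matrix_mul_assoc)
  then have "ip g x (axis k 1) (A x *v axis i 1) = - ?M $ k $ i"
    by (simp add: ip_def inner_axis' matrix_vector_mult_basis column_def)
  then show ?thesis by (simp add: M.ip_commute[OF x])
qed

lemma weingarten:
  assumes x: "x \<in> U"
  shows "vD C i \<xi> x = - tang x (A x *v axis i 1)"
proof -
  let ?w = "vD C i \<xi> x + tang x (A x *v axis i 1)"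
  have "ip G (F x) ?w (pd k F x) = 0" for k
    using A_lower[OF x, of i k] by (simp add: ip_add pd_eq_frechet[of k] induced[OF x])
  from normal_component[OF x this] have "?w = 0"
    using vD_normal_orthogonal(2)[OF x] \<xi>_normal[OF x] by (simp add: ip_add)
  then show ?thesis by (simp add: eq_neg_iff_add_eq_0)
qed

text \<open>
  The second fundamental form \<open>\<langle>\<nabla>\<^sub>i \<partial>\<^sub>jF, \<xi>\<rangle>\<close> is symmetric because the connection is torsion free.
\<close>

lemma A_selfadjoint:
  assumes x: "x \<in> U"
  shows "ip g x (A x *v v) w = ip g x v (A x *v w)"
proof -
  have "ip g x (A x *v axis i 1) (axis k 1) = ip g x (axis i 1) (A x *v axis k 1)" for i k
    using A_lower[OF x, of i k] A_lower[OF x, of k i] M.ip_commute[OF x, of "axis i 1" "A x *v axis k 1"]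
      vD_normal_tangential[OF x, of i k] vD_normal_tangential[OF x, of k i]
    unfolding torsion_free[OF x, of i k] by linarith
  then have "(\<Sum>i\<in>UNIV. \<Sum>k\<in>UNIV. (v $ i * w $ k) * ip g x (A x *v axis i 1) (axis k 1))
      = (\<Sum>i\<in>UNIV. \<Sum>k\<in>UNIV. (v $ i * w $ k) * ip g x (axis i 1) (A x *v axis k 1))" by simp
  moreover have "ip g x (A x *v v) w = (\<Sum>i\<in>UNIV. \<Sum>k\<in>UNIV. (v $ i * w $ k) * ip g x (A x *v axis i 1) (axis k 1))"
    by (subst axis_expansion[of v], subst axis_expansion[of w], subst sum.swap)
      (simp only: ip_def matrix_vector_sum matrix_vector_scaleR inner_sum_left inner_sum_right
        inner_scaleR_left inner_scaleR_right sum_distrib_left mult_ac)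
  moreover have "ip g x v (A x *v w) = (\<Sum>i\<in>UNIV. \<Sum>k\<in>UNIV. (v $ i * w $ k) * ip g x (axis i 1) (A x *v axis k 1))"
    by (subst axis_expansion[of v], subst axis_expansion[of w], subst sum.swap)
      (simp only: ip_def matrix_vector_sum matrix_vector_scaleR inner_sum_left inner_sum_right
        inner_scaleR_left inner_scaleR_right sum_distrib_left mult_ac)
  ultimately show ?thesis by simp
qed

lemma second_derivative_F:
  assumes x: "x \<in> U"
  shows "vD C i (pd j F) x = tang x (\<Gamma> i x *v axis j 1) + (\<epsilon> x * ip g x (A x *v axis i 1) (axis j 1)) *\<^sub>R \<xi> x"
proof -
  let ?w = "vD C i (pd j F) x - tang x (\<Gamma> i x *v axis j 1)"
  have "ip G (F x) ?w (pd k F x) = 0" for k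
    using tangential_part_second_derivative[OF x, of i j k]
    by (simp add: ip_diff pd_eq_frechet[of k] induced[OF x])
  from normal_component[OF x this] show ?thesis
    using A_lower[OF x, of i j] vD_normal_tangential[OF x, of i j] \<xi>_normal[OF x]
      ip_commute[OF F_T[OF x], of "\<xi> x" "vD C i (pd j F) x"]
    by (simp add: ip_diff algebra_simps)
qed

text \<open>
  Expand the field in the coordinate fields \<open>\<partial>\<^sub>jF\<close> and use the decomposition of their derivatives.
\<close>

lemma gauss_formula:
  assumes x: "x \<in> U" and Y: "smooth_on U Y"
  shows "vD C i (\<lambda>x. tang x (Y x)) x
    = tang x (vD \<Gamma> i Y x) + (\<epsilon> x * ip g x (A x *v axis i 1) (Y x)) *\<^sub>R \<xi> x"
proof -
  note d = smooth_on_differentiable[OF _ x]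
  note F' = smooth_on_pd[OF F_smooth]
  have "vD C i (\<lambda>x. tang x (Y x)) x = vD C i (\<lambda>x. \<Sum>j\<in>UNIV. Y x $ j *\<^sub>R pd j F x) x"
    by (rule vD_cong[OF open_S x tang_expand])
  also have "\<dots> = (\<Sum>j\<in>UNIV. vD C i (\<lambda>x. Y x $ j *\<^sub>R pd j F x) x)"
    by (rule vD_sum, rule d) (intro smooth_intros open_S Y F_smooth)
  also have "\<dots> = (\<Sum>j\<in>UNIV. pd i Y x $ j *\<^sub>R pd j F x + Y x $ j *\<^sub>R vD C i (pd j F) x)"
    by (simp add: vD_scaleR d smooth_on_nth open_S Y F' pd_nth)
  also have "\<dots> = tang x (pd i Y x)
      + (\<Sum>j\<in>UNIV. Y x $ j *\<^sub>R tang x (\<Gamma> i x *v axis j 1)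
          + (\<epsilon> x * (Y x $ j * ip g x (A x *v axis i 1) (axis j 1))) *\<^sub>R \<xi> x)"
    by (simp add: second_derivative_F[OF x] sum.distrib tang_expand[OF x, symmetric] scaleR_add_right mult_ac)
  also have "(\<Sum>j\<in>UNIV. Y x $ j *\<^sub>R tang x (\<Gamma> i x *v axis j 1)
          + (\<epsilon> x * (Y x $ j * ip g x (A x *v axis i 1) (axis j 1))) *\<^sub>R \<xi> x)
      = tang x (\<Gamma> i x *v Y x) + (\<epsilon> x * ip g x (A x *v axis i 1) (Y x)) *\<^sub>R \<xi> x"
  proof -
    have "(\<Sum>j\<in>UNIV. Y x $ j *\<^sub>R tang x (\<Gamma> i x *v axis j 1)) = tang x (\<Gamma> i x *v Y x)"
      by (subst (2) axis_expansion[of "Y x"])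
        (simp only: matrix_vector_sum matrix_vector_scaleR linear_sum[OF tang_linear[OF x]]
          linear_scale[OF tang_linear[OF x]])
    moreover have "(\<Sum>j\<in>UNIV. Y x $ j * ip g x (A x *v axis i 1) (axis j 1)) = ip g x (A x *v axis i 1) (Y x)"
      by (subst (2) axis_expansion[of "Y x"])
        (simp only: ip_def matrix_vector_sum matrix_vector_scaleR inner_sum_right inner_scaleR_right)
    ultimately show ?thesis
      by (simp only: sum.distrib scaleR_sum_left[symmetric] sum_distrib_left[symmetric])
  qed
  finally show ?thesis by (simp add: vD_def[of \<Gamma>] linear_add[OF tang_linear[OF x]] add.assoc)
qed

subsection \<open>The equations of Gauss and Codazzi\<close>

lemma curv_C:
  assumes x: "x \<in> U"
  shows "curv C i j x *v w = \<kappa> *\<^sub>R (ip G (F x) (pd j F x) w *\<^sub>R pd i F x - ip G (F x) (pd i F x) w *\<^sub>R pd j F x)"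
proof -
  have "curv C i j x *v w = riemann G (F x) (pd i F x) (pd j F x) w"
    by (simp add: curv_pull[OF x] riemann_curv[OF F_T[OF x]] matrix_vector_sum matrix_vector_scaleR)
  then show ?thesis by (simp add: space_form_curvature[OF F_T[OF x]])
qed

text \<open>
  The tangential part of \<open>R(e\<^sub>i, e\<^sub>j) \<xi>\<close>. In a space form this vector is zero, since \<open>\<xi>\<close> is orthogonal to
  both directions.
\<close>

lemma codazzi:
  assumes x: "x \<in> U"
  shows "mD \<Gamma> i A x *v axis j 1 = mD \<Gamma> j A x *v axis i 1"
proof -
  have Ae: "smooth_on U (\<lambda>x. A x *v axis j 1)" for j by (intro smooth_intros open_S A_smooth)
  have 1: "vD C i (vD C j \<xi>) x = - tang x (vD \<Gamma> i (\<lambda>x. A x *v axis j 1) x)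
      - (\<epsilon> x * ip g x (A x *v axis i 1) (A x *v axis j 1)) *\<^sub>R \<xi> x" for i j
  proof -
    have "vD C i (vD C j \<xi>) x = vD C i (\<lambda>x. 0 - tang x (A x *v axis j 1)) x"
      by (rule vD_cong[OF open_S x]) (simp add: weingarten)
    also have "\<dots> = 0 - vD C i (\<lambda>x. tang x (A x *v axis j 1)) x"
      using smooth_on_differentiable[OF tang_smooth[OF Ae] x] by (subst vD_diff) (simp_all add: vD_const)
    finally show ?thesis by (simp add: gauss_formula[OF x Ae])
  qed
  have "curv C i j x *v \<xi> x = 0"
    by (simp add: curv_C[OF x] pd_eq_frechet \<xi>_normal[OF x])
  then have "vD C i (vD C j \<xi>) x = vD C j (vD C i \<xi>) x"
    using vD_commute[where C = C and i = i and j = j, OF open_S x C_smooth \<xi>_smooth] by simp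
  then have "tang x (vD \<Gamma> i (\<lambda>x. A x *v axis j 1) x) = tang x (vD \<Gamma> j (\<lambda>x. A x *v axis i 1) x)"
    unfolding 1 by (simp add: M.ip_commute[OF x, of "A x *v axis i 1" "A x *v axis j 1"])
  then have "vD \<Gamma> i (\<lambda>x. A x *v axis j 1) x = vD \<Gamma> j (\<lambda>x. A x *v axis i 1) x"
    using tang_normal_unique(1)[OF x, of _ 0 _ 0] by simp
  then show ?thesis
    using smooth_on_differentiable[OF A_smooth x] M.lc_conn_sym[OF x, of i j]
    by (simp add: vD_matvec vD_const)
qed

text \<open>
  The tangential part of \<open>R(e\<^sub>i, e\<^sub>j) dF z\<close>, computed from the Gauss and Weingarten formulas.
\<close>

lemma gauss_equation:
  assumes x: "x \<in> U"
  shows "curv \<Gamma> i j x *v z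
    = \<kappa> *\<^sub>R (ip g x (axis j 1) z *\<^sub>R axis i 1 - ip g x (axis i 1) z *\<^sub>R axis j 1)
    + \<epsilon> x *\<^sub>R (ip g x (A x *v axis j 1) z *\<^sub>R (A x *v axis i 1) - ip g x (A x *v axis i 1) z *\<^sub>R (A x *v axis j 1))"
    (is "_ = ?rhs")
proof -
  note lin = linear_add[OF tang_linear[OF x]] linear_diff[OF tang_linear[OF x]] linear_scale[OF tang_linear[OF x]]
  define q where "q = (\<lambda>j x. \<epsilon> x * ip g x (A x *v axis j 1) z)"
  have z: "smooth_on U (\<lambda>_. z)" by (rule smooth_on_const)
  have q_smooth: "smooth_on U (q j)" for j
    unfolding q_def ip_def by (intro smooth_intros open_S \<xi>_smooth G_F_smooth A_smooth g_smooth)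
  have Dz: "smooth_on U (vD \<Gamma> j (\<lambda>_. z))" for j by (intro vD_smooth open_S M.lc_conn_smooth z)
  have 1: "\<exists>s. vD C i (vD C j (\<lambda>x. tang x z)) x
      = tang x (vD \<Gamma> i (vD \<Gamma> j (\<lambda>_. z)) x - q j x *\<^sub>R (A x *v axis i 1)) + s *\<^sub>R \<xi> x" for i j
  proof -
    have "vD C i (vD C j (\<lambda>x. tang x z)) x
        = vD C i (\<lambda>x. tang x (vD \<Gamma> j (\<lambda>_. z) x) + q j x *\<^sub>R \<xi> x) x"
      by (rule vD_cong[OF open_S x]) (simp add: gauss_formula[OF _ z] q_def)
    also have "\<dots> = vD C i (\<lambda>x. tang x (vD \<Gamma> j (\<lambda>_. z) x)) x + vD C i (\<lambda>x. q j x *\<^sub>R \<xi> x) x"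
      by (intro vD_add smooth_on_differentiable[OF _ x] tang_smooth Dz smooth_on_scaleR open_S q_smooth \<xi>_smooth)
    also have "vD C i (\<lambda>x. q j x *\<^sub>R \<xi> x) x = pd i (q j) x *\<^sub>R \<xi> x - q j x *\<^sub>R tang x (A x *v axis i 1)"
      using smooth_on_differentiable[OF q_smooth x] smooth_on_differentiable[OF \<xi>_smooth x]
      by (simp add: vD_scaleR weingarten[OF x])
    finally have "vD C i (vD C j (\<lambda>x. tang x z)) x
        = tang x (vD \<Gamma> i (vD \<Gamma> j (\<lambda>_. z)) x - q j x *\<^sub>R (A x *v axis i 1))
        + (\<epsilon> x * ip g x (A x *v axis i 1) (vD \<Gamma> j (\<lambda>_. z) x) + pd i (q j) x) *\<^sub>R \<xi> x"
      by (simp add: gauss_formula[OF x Dz] lin algebra_simps)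
    then show ?thesis by blast
  qed
  obtain s where s: "vD C i (vD C j (\<lambda>x. tang x z)) x
      = tang x (vD \<Gamma> i (vD \<Gamma> j (\<lambda>_. z)) x - q j x *\<^sub>R (A x *v axis i 1)) + s *\<^sub>R \<xi> x" using 1 by blast
  obtain t where t: "vD C j (vD C i (\<lambda>x. tang x z)) x
      = tang x (vD \<Gamma> j (vD \<Gamma> i (\<lambda>_. z)) x - q i x *\<^sub>R (A x *v axis j 1)) + t *\<^sub>R \<xi> x" using 1 by blast
  have "vD C i (vD C j (\<lambda>x. tang x z)) x - vD C j (vD C i (\<lambda>x. tang x z)) x
      = tang x (\<kappa> *\<^sub>R (ip g x (axis j 1) z *\<^sub>R axis i 1 - ip g x (axis i 1) z *\<^sub>R axis j 1))"
    using vD_commute[where C = C and i = i and j = j, OF open_S x C_smooth tang_smooth[OF z]]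
    by (simp add: curv_C[OF x] lin induced[OF x] pd_eq_frechet)
  then have "tang x ((vD \<Gamma> i (vD \<Gamma> j (\<lambda>_. z)) x - q j x *\<^sub>R (A x *v axis i 1))
        - (vD \<Gamma> j (vD \<Gamma> i (\<lambda>_. z)) x - q i x *\<^sub>R (A x *v axis j 1))) + (s - t) *\<^sub>R \<xi> x
      = tang x (\<kappa> *\<^sub>R (ip g x (axis j 1) z *\<^sub>R axis i 1 - ip g x (axis i 1) z *\<^sub>R axis j 1)) + 0 *\<^sub>R \<xi> x"
    unfolding s t by (simp add: lin algebra_simps)
  from tang_normal_unique(1)[OF x this] show ?thesis
    using vD_commute[where C = \<Gamma> and i = i and j = j, OF open_S x M.lc_conn_smooth z] by (simp add: q_def algebra_simps)
qed

end

section \<open>The Laplacian of the mean curvature vector\<close>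

definition dirD :: "real^'n \<Rightarrow> (real^'n \<Rightarrow> real) \<Rightarrow> real^'n \<Rightarrow> real" where
  "dirD v f x = (\<Sum>k\<in>UNIV. v $ k * pd k f x)"

definition along :: "('n \<Rightarrow> real^'n \<Rightarrow> real^'p^'p) \<Rightarrow> real^'n \<Rightarrow> (real^'n \<Rightarrow> real^'p) \<Rightarrow> real^'n \<Rightarrow> real^'p" where
  "along C v V x = (\<Sum>k\<in>UNIV. v $ k *\<^sub>R vD C k V x)"

definition mDalong :: "('n \<Rightarrow> real^'n \<Rightarrow> real^'p^'p) \<Rightarrow> real^'n \<Rightarrow> (real^'n \<Rightarrow> real^'p^'p) \<Rightarrow> real^'n \<Rightarrow> real^'p^'p" where
  "mDalong C v B x = (\<Sum>k\<in>UNIV. v $ k *\<^sub>R mD C k B x)"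

text \<open>
  Resolution of the identity for an orthonormal frame: if \<open>P\<close> has the frame as its columns and
  \<open>S\<close> is the diagonal matrix of signs, then \<open>S P\<^sup>T g\<close> is a left inverse of \<open>P\<close>, hence also a right inverse.
\<close>

lemma orthonormal_expansion:
  fixes e :: "'n::finite \<Rightarrow> real^'n"
  assumes unit: "\<And>i. e i \<bullet> (M *v e i) \<in> {1, -1}"
    and orth: "\<And>i j. i \<noteq> j \<Longrightarrow> e i \<bullet> (M *v e j) = 0"
  shows "(\<Sum>i\<in>UNIV. ((e i \<bullet> (M *v e i)) * (e i \<bullet> (M *v v))) *\<^sub>R e i) = v"
    and "(\<Sum>i\<in>UNIV. (e i \<bullet> (M *v e i)) * (e i \<bullet> (M *v (B *v e i)))) = trace B"
proof -
  define P :: "real^'n^'n" where "P = (\<chi> k i. e i $ k)"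
  define S :: "real^'n^'n" where "S = (\<chi> i j. if i = j then e i \<bullet> (M *v e i) else 0)"
  define Q where "Q = S ** transpose P ** M"
  have Pe: "P *v axis i 1 = e i" for i
    by (simp add: P_def matrix_vector_mult_basis column_def vec_eq_iff)
  have tP: "(transpose P *v w) $ i = e i \<bullet> w" for w i
    unfolding matrix_vector_mult_def by (simp add: transpose_def P_def inner_vec_def)
  have Sw: "(S *v w) $ i = (e i \<bullet> (M *v e i)) * w $ i" for w i
    by (simp add: S_def matrix_vector_mult_def if_distrib[of "\<lambda>c. c * _"] cong: if_cong)
  have Qw: "(Q *v w) $ i = (e i \<bullet> (M *v e i)) * (e i \<bullet> (M *v w))" for w i
  proof -
    have "Q *v w = S *v (transpose P *v (M *v w))"
      by (simp only: Q_def matrix_vector_mul_assoc matrix_mul_assoc)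
    then show ?thesis by (simp only: Sw tP)
  qed
  have "(Q *v (P *v axis j 1)) $ i = axis j 1 $ i" for i j
    unfolding Pe Qw using unit[of i] orth[of i j] by (auto simp: axis_def)
  then have "(Q ** P) *v axis j 1 = mat 1 *v axis j 1" for j
    by (simp add: vec_eq_iff matrix_vector_mul_assoc)
  then have "Q ** P = mat 1"
    by (simp add: vec_eq_iff matrix_vector_mult_basis column_def)
  then have PQ: "P ** Q = mat 1" using matrix_left_right_inverse by blast
  have "P *v (Q *v v) = (\<Sum>i\<in>UNIV. (Q *v v) $ i *\<^sub>R e i)"
    by (subst axis_expansion[of "Q *v v"]) (simp only: matrix_vector_sum matrix_vector_scaleR Pe)
  then show "(\<Sum>i\<in>UNIV. ((e i \<bullet> (M *v e i)) * (e i \<bullet> (M *v v))) *\<^sub>R e i) = v"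
    by (simp add: Qw matrix_vector_mul_assoc PQ)
  have "trace B = trace ((B ** P) ** Q)" by (simp add: matrix_mul_assoc[symmetric] PQ)
  also have "\<dots> = trace (Q ** (B ** P))" by (rule trace_mul_sym)
  also have "\<dots> = (\<Sum>i\<in>UNIV. (Q *v (B *v (P *v axis i 1))) $ i)"
  proof -
    have diag: "L $ i $ i = (L *v axis i 1) $ i" for L :: "real^'n^'n" and i
      by (simp add: matrix_vector_mult_basis column_def)
    show ?thesis unfolding trace_def by (subst diag) (simp only: matrix_vector_mul_assoc matrix_mul_assoc)
  qed
  finally show "(\<Sum>i\<in>UNIV. (e i \<bullet> (M *v e i)) * (e i \<bullet> (M *v (B *v e i)))) = trace B"
    by (simp add: Pe Qw)
qed

context hypersurface_patch
begin

text \<open>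
  Orthonormal frames, and balls on which the principal curvatures are constant, exist only locally; on them
  the results of the locale are used again.
\<close>

lemma restrict_patch:
  assumes "open W" "W \<subseteq> U"
  shows "hypersurface_patch T G W F g \<xi> \<kappa>"
  by unfold_locales
    (use assms F_into codim g_sym g_inv induced \<xi>_unit \<xi>_normal space_form_curvature
      smooth_on_subset[OF F_smooth] smooth_on_subset[OF g_smooth] smooth_on_subset[OF \<xi>_smooth]
      in \<open>auto simp: subset_iff\<close>)

lemma along_normal_field:
  assumes x: "x \<in> U" and \<phi>: "smooth_on U \<phi>"
  shows "along C v (\<lambda>x. \<phi> x *\<^sub>R \<xi> x) x = dirD v \<phi> x *\<^sub>R \<xi> x - \<phi> x *\<^sub>R tang x (A x *v v)"
proof -
  have "along C v (\<lambda>x. \<phi> x *\<^sub>R \<xi> x) x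
      = (\<Sum>k\<in>UNIV. (v $ k * pd k \<phi> x) *\<^sub>R \<xi> x - \<phi> x *\<^sub>R (v $ k *\<^sub>R tang x (A x *v axis k 1)))"
    by (simp add: along_def vD_scaleR smooth_on_differentiable[OF \<phi> x] smooth_on_differentiable[OF \<xi>_smooth x]
        weingarten[OF x] scaleR_diff_right mult_ac)
  moreover have "tang x (A x *v v) = (\<Sum>k\<in>UNIV. v $ k *\<^sub>R tang x (A x *v axis k 1))"
    by (subst axis_expansion[of v])
      (simp only: matrix_vector_sum matrix_vector_scaleR linear_sum[OF tang_linear[OF x]]
        linear_scale[OF tang_linear[OF x]])
  ultimately show ?thesis
    by (simp only: sum_subtractf scaleR_sum_left[symmetric] scaleR_sum_right[symmetric] dirD_def)
qed

lemma along_tangential_field: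
  assumes x: "x \<in> U" and Y: "smooth_on U Y"
  shows "along C v (\<lambda>x. tang x (Y x)) x
    = tang x (along \<Gamma> v Y x) + (\<epsilon> x * ip g x (A x *v v) (Y x)) *\<^sub>R \<xi> x"
proof -
  have "along C v (\<lambda>x. tang x (Y x)) x = (\<Sum>k\<in>UNIV. v $ k *\<^sub>R tang x (vD \<Gamma> k Y x)
      + (\<epsilon> x * (v $ k * ip g x (A x *v axis k 1) (Y x))) *\<^sub>R \<xi> x)"
    by (simp add: along_def gauss_formula[OF x Y] scaleR_add_right mult_ac)
  moreover have "tang x (along \<Gamma> v Y x) = (\<Sum>k\<in>UNIV. v $ k *\<^sub>R tang x (vD \<Gamma> k Y x))"
    by (simp add: along_def linear_sum[OF tang_linear[OF x]] linear_scale[OF tang_linear[OF x]])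
  moreover have "ip g x (A x *v v) (Y x) = (\<Sum>k\<in>UNIV. v $ k * ip g x (A x *v axis k 1) (Y x))"
    by (subst axis_expansion[of v])
      (simp only: ip_def matrix_vector_sum matrix_vector_scaleR inner_sum_left inner_scaleR_left)
  ultimately show ?thesis
    by (simp only: sum.distrib scaleR_sum_left[symmetric] sum_distrib_left[symmetric])
qed

lemma along_A:
  assumes x: "x \<in> U" and Y: "smooth_on U Y"
  shows "along \<Gamma> v (\<lambda>x. A x *v Y x) x = mDalong \<Gamma> v A x *v Y x + A x *v along \<Gamma> v Y x"
  by (simp add: along_def mDalong_def vD_matvec smooth_on_differentiable[OF A_smooth x]
      smooth_on_differentiable[OF Y x] matrix_vector_sum matrix_vector_scaleR scaleR_add_right sum.distrib)

lemma dirD_smooth: "smooth_on U \<phi> \<Longrightarrow> smooth_on U X \<Longrightarrow> smooth_on U (\<lambda>x. dirD (X x) \<phi> x)"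
  unfolding dirD_def by (intro smooth_intros open_S)

lemma along_cong:
  assumes "x \<in> U" "\<And>y. y \<in> U \<Longrightarrow> V y = W y"
  shows "along C v V x = along C v W x"
  unfolding along_def using vD_cong[OF open_S assms] by simp

lemma along_diff:
  assumes "V differentiable (at x)" "W differentiable (at x)"
  shows "along C v (\<lambda>x. V x - W x) x = along C v V x - along C v W x"
  using assms by (simp add: along_def vD_diff scaleR_diff_right sum_subtractf)

lemma along_scaleR:
  assumes "\<phi> differentiable (at x)" "V differentiable (at x)"
  shows "along C v (\<lambda>x. \<phi> x *\<^sub>R V x) x = dirD v \<phi> x *\<^sub>R V x + \<phi> x *\<^sub>R along C v V x"
  using assms
  by (simp add: along_def dirD_def vD_scaleR scaleR_add_right sum.distrib scaleR_sum_left scaleR_sum_right mult_ac)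

text \<open>
  The summand of the Laplacian of \<open>\<phi> \<xi>\<close> belonging to a field \<open>X\<close>. The terms with \<open>\<nabla>\<^sub>X X\<close> inside \<open>A\<close>
  cancel, so that the tangential part is tensorial in \<open>X\<close>.
\<close>

lemma second_derivative_normal_field:
  assumes x: "x \<in> U" and \<phi>: "smooth_on U \<phi>" and X: "smooth_on U X"
  defines "N \<equiv> along \<Gamma> (X x) X x"
  shows "along C (X x) (\<lambda>y. along C (X y) (\<lambda>x. \<phi> x *\<^sub>R \<xi> x) y) x - along C N (\<lambda>x. \<phi> x *\<^sub>R \<xi> x) x
    = (dirD (X x) (\<lambda>y. dirD (X y) \<phi> y) x - dirD N \<phi> x - \<phi> x * \<epsilon> x * ip g x (A x *v X x) (A x *v X x)) *\<^sub>R \<xi> x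
      - tang x ((2 * dirD (X x) \<phi> x) *\<^sub>R (A x *v X x) + \<phi> x *\<^sub>R (mDalong \<Gamma> (X x) A x *v X x))"
proof -
  note lin = linear_add[OF tang_linear[OF x]] linear_scale[OF tang_linear[OF x]]
  note d = smooth_on_differentiable[OF _ x]
  have two: "(2 * r) *\<^sub>R w = r *\<^sub>R w + r *\<^sub>R w" for r and w :: "real^'n"
    by (simp add: scaleR_add_left[symmetric])
  have AX: "smooth_on U (\<lambda>x. A x *v X x)" by (intro smooth_intros open_S A_smooth X)
  note dX = dirD_smooth[OF \<phi> X]
  have "along C (X x) (\<lambda>y. along C (X y) (\<lambda>x. \<phi> x *\<^sub>R \<xi> x) y) x
      = along C (X x) (\<lambda>y. dirD (X y) \<phi> y *\<^sub>R \<xi> y - \<phi> y *\<^sub>R tang y (A y *v X y)) x"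
    by (rule along_cong[OF x]) (rule along_normal_field[OF _ \<phi>])
  also have "\<dots> = along C (X x) (\<lambda>y. dirD (X y) \<phi> y *\<^sub>R \<xi> y) x
      - along C (X x) (\<lambda>y. \<phi> y *\<^sub>R tang y (A y *v X y)) x"
    by (intro along_diff d smooth_on_scaleR open_S dX \<xi>_smooth \<phi> tang_smooth AX)
  also have "along C (X x) (\<lambda>y. \<phi> y *\<^sub>R tang y (A y *v X y)) x
      = dirD (X x) \<phi> x *\<^sub>R tang x (A x *v X x) + \<phi> x *\<^sub>R along C (X x) (\<lambda>y. tang y (A y *v X y)) x"
    by (intro along_scaleR d \<phi> tang_smooth AX)
  finally show ?thesis
    unfolding along_normal_field[OF x dX] along_normal_field[OF x \<phi>] along_tangential_field[OF x AX]
      along_A[OF x X] N_def[symmetric]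
    by (simp only: lin two) (simp add: algebra_simps)
qed

text \<open>
  The field \<open>\<phi> \<xi>\<close>, with \<open>\<phi>\<close> a multiple of \<open>\<epsilon> tr A\<close>, stands for the mean curvature vector; the
  equation says that its Laplacian in the frame \<open>e\<close> is normal.
\<close>

context
  fixes e :: "'n \<Rightarrow> real^'n \<Rightarrow> real^'n" and \<phi> :: "real^'n \<Rightarrow> real" and c :: real and x :: "real^'n" and t :: real
  assumes e: "\<And>i. smooth_on U (e i)"
    and orth: "\<And>y i j. y \<in> U \<Longrightarrow>
      if i = j then ip g y (e i y) (e j y) \<in> {1, -1} else ip g y (e i y) (e j y) = 0"
    and c: "c \<noteq> 0" and \<phi>: "\<And>y. y \<in> U \<Longrightarrow> \<phi> y = c * \<epsilon> y * trace (A y)"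
    and x: "x \<in> U"
    and lap: "- (\<Sum>i\<in>UNIV. ip g x (e i x) (e i x) *\<^sub>R
        (along C (e i x) (\<lambda>y. along C (e i y) (\<lambda>x. \<phi> x *\<^sub>R \<xi> x) y) x
          - along C (along \<Gamma> (e i x) (e i) x) (\<lambda>x. \<phi> x *\<^sub>R \<xi> x) x)) = t *\<^sub>R \<xi> x"
begin

lemma \<phi>_smooth: "smooth_on U \<phi>"
proof -
  have "smooth_on U (\<lambda>y. c * \<epsilon> y * trace (A y))"
    unfolding ip_def by (intro smooth_intros open_S \<xi>_smooth G_F_smooth A_smooth)
  then show ?thesis using smooth_on_cong[OF open_S, of \<phi> "\<lambda>y. c * \<epsilon> y * trace (A y)"] \<phi> by simp
qed

lemma pd_\<phi>: "pd k \<phi> x = c * \<epsilon> x * trace (mD \<Gamma> k A x)"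
proof -
  note d = smooth_on_differentiable[OF _ x]
  have \<epsilon>: "smooth_on U \<epsilon>" unfolding ip_def by (intro smooth_intros open_S \<xi>_smooth G_F_smooth)
  have "pd k \<phi> x = pd k (\<lambda>y. c * \<epsilon> y * trace (A y)) x" by (rule pd_cong[OF open_S x \<phi>])
  also have "\<dots> = c * \<epsilon> x * pd k (\<lambda>y. trace (A y)) x"
    using d[OF \<epsilon>] d[OF smooth_on_trace[OF open_S A_smooth]] vD_normal_orthogonal(1)[OF x, of k]
    by (simp add: pd_mult differentiable_bilinear[OF bounded_bilinear_mult])
  also have "pd k (\<lambda>y. trace (A y)) x = trace (mD \<Gamma> k A x)"
    by (rule pd_trace_mD[OF d[OF A_smooth]])
  finally show ?thesis .
qed

lemma laplacian_components:
  "(\<Sum>i\<in>UNIV. ip g x (e i x) (e i x) *\<^sub>R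
      ((2 * dirD (e i x) \<phi> x) *\<^sub>R (A x *v e i x) + \<phi> x *\<^sub>R (mDalong \<Gamma> (e i x) A x *v e i x))) = 0"
  "(\<Sum>i\<in>UNIV. ip g x (e i x) (e i x) *
      (dirD (e i x) (\<lambda>y. dirD (e i y) \<phi> y) x - dirD (along \<Gamma> (e i x) (e i) x) \<phi> x
        - \<phi> x * \<epsilon> x * ip g x (A x *v e i x) (A x *v e i x))) = - t"
proof -
  let ?s = "\<lambda>i. ip g x (e i x) (e i x)"
  let ?v = "\<lambda>i. (2 * dirD (e i x) \<phi> x) *\<^sub>R (A x *v e i x) + \<phi> x *\<^sub>R (mDalong \<Gamma> (e i x) A x *v e i x)"
  let ?n = "\<lambda>i. dirD (e i x) (\<lambda>y. dirD (e i y) \<phi> y) x - dirD (along \<Gamma> (e i x) (e i) x) \<phi> x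
        - \<phi> x * \<epsilon> x * ip g x (A x *v e i x) (A x *v e i x)"
  have rearrange: "q + - p = 0 + r" if "- (p - q) = r" for p q r :: "real^'p" using that by simp
  have "- (\<Sum>i\<in>UNIV. ?s i *\<^sub>R (?n i *\<^sub>R \<xi> x - tang x (?v i))) = t *\<^sub>R \<xi> x"
    using lap by (simp only: second_derivative_normal_field[OF x \<phi>_smooth e])
  then have "- ((\<Sum>i\<in>UNIV. ?s i * ?n i) *\<^sub>R \<xi> x - tang x (\<Sum>i\<in>UNIV. ?s i *\<^sub>R ?v i)) = t *\<^sub>R \<xi> x"
    by (simp only: scaleR_diff_right scaleR_scaleR sum_subtractf linear_sum[OF tang_linear[OF x]]
        linear_scale[OF tang_linear[OF x]] scaleR_sum_left)
  then have "tang x (\<Sum>i\<in>UNIV. ?s i *\<^sub>R ?v i) + (- (\<Sum>i\<in>UNIV. ?s i * ?n i)) *\<^sub>R \<xi> x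
      = tang x 0 + t *\<^sub>R \<xi> x"
    unfolding scaleR_minus_left linear_0[OF tang_linear[OF x]] by (rule rearrange)
  from tang_normal_unique[OF x this]
  show "(\<Sum>i\<in>UNIV. ?s i *\<^sub>R ?v i) = 0" "(\<Sum>i\<in>UNIV. ?s i * ?n i) = - t" by simp_all
qed

lemma frame_expansion:
  "(\<Sum>i\<in>UNIV. (ip g x (e i x) (e i x) * ip g x (e i x) v) *\<^sub>R e i x) = v"
  "(\<Sum>i\<in>UNIV. ip g x (e i x) (e i x) * ip g x (e i x) (B *v e i x)) = trace B"
proof -
  have unit: "e i x \<bullet> (g x *v e i x) \<in> {1, -1}" for i
    using orth[OF x, of i i] by (simp add: ip_def)
  have zero: "e i x \<bullet> (g x *v e j x) = 0" if "i \<noteq> j" for i j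
    using orth[OF x, of i j] that by (simp add: ip_def)
  show "(\<Sum>i\<in>UNIV. (ip g x (e i x) (e i x) * ip g x (e i x) v) *\<^sub>R e i x) = v"
    unfolding ip_def by (rule orthonormal_expansion(1)) (fact unit zero)+
  show "(\<Sum>i\<in>UNIV. ip g x (e i x) (e i x) * ip g x (e i x) (B *v e i x)) = trace B"
    unfolding ip_def by (rule orthonormal_expansion(2)) (fact unit zero)+
qed

text \<open>
  By the Codazzi equation \<open>\<Sum> s\<^sub>i (\<nabla>\<^bsub>e\<^sub>i\<^esub> A) e\<^sub>i\<close> is the gradient of \<open>tr A\<close>. So the tangential part of the
  equation makes the gradient of \<open>\<phi>\<close> an eigenvector of \<open>A\<close> with a real eigenvalue, or zero.
\<close>

lemma gradient_zero:
  assumes no_real: "\<And>v \<mu>. A x *v v = \<mu> *\<^sub>R v \<Longrightarrow> v = 0"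
  shows "pd k \<phi> x = 0"
proof -
  let ?s = "\<lambda>i. ip g x (e i x) (e i x)"
  define u where "u = (\<Sum>i\<in>UNIV. (?s i * dirD (e i x) \<phi> x) *\<^sub>R e i x)"
  have u: "ip g x u (axis k 1) = pd k \<phi> x" for k
  proof -
    have "ip g x u (axis k 1) = (\<Sum>i\<in>UNIV. (?s i * ip g x (e i x) (axis k 1)) * dirD (e i x) \<phi> x)"
      by (simp add: u_def ip_def inner_sum_left mult_ac)
    also have "\<dots> = dirD (\<Sum>i\<in>UNIV. (?s i * ip g x (e i x) (axis k 1)) *\<^sub>R e i x) \<phi> x"
      unfolding dirD_def sum_distrib_left
      by (subst sum.swap) (simp add: sum_distrib_left sum_distrib_right mult_ac)
    finally show ?thesis
      by (simp add: frame_expansion dirD_def axis_def if_distrib[of "\<lambda>c. c * _"] cong: if_cong)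
  qed
  define w where "w = (\<Sum>i\<in>UNIV. ?s i *\<^sub>R (mDalong \<Gamma> (e i x) A x *v e i x))"
  have w: "ip g x w (axis k 1) = trace (mD \<Gamma> k A x)" for k
  proof -
    have sa: "ip g x (mD \<Gamma> j A x *v v) z = ip g x v (mD \<Gamma> j A x *v z)" for j v z
      by (rule M.mD_selfadjoint[OF x A_smooth]) (rule A_selfadjoint)
    have cod: "mDalong \<Gamma> v A x *v axis k 1 = mD \<Gamma> k A x *v v" for v
      unfolding mDalong_def
      by (subst (2) axis_expansion[of v])
        (simp add: matrix_vector_sum matrix_vector_scaleR codazzi[OF x, of _ k])
    have sa': "ip g x (mDalong \<Gamma> v A x *v y) z = ip g x y (mDalong \<Gamma> v A x *v z)" for v y z
      using sa by (simp add: mDalong_def ip_def matrix_vector_sum matrix_vector_scaleR inner_sum_left inner_sum_right)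
    have "ip g x w (axis k 1) = (\<Sum>i\<in>UNIV. ?s i * ip g x (mDalong \<Gamma> (e i x) A x *v e i x) (axis k 1))"
      by (simp add: w_def ip_def inner_sum_left)
    also have "\<dots> = (\<Sum>i\<in>UNIV. ?s i * ip g x (e i x) (mD \<Gamma> k A x *v e i x))"
      by (simp add: sa' cod)
    finally show ?thesis by (simp add: frame_expansion)
  qed
  have "2 *\<^sub>R (A x *v u) + \<phi> x *\<^sub>R w = 0"
    using laplacian_components(1)
    by (simp add: u_def w_def matrix_vector_sum matrix_vector_scaleR scaleR_add_right sum.distrib
        scaleR_sum_right mult_ac)
  moreover have "w = (\<epsilon> x / c) *\<^sub>R u"
  proof -
    have "ip g x w (axis k 1) = ip g x ((\<epsilon> x / c) *\<^sub>R u) (axis k 1)" for k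
    proof -
      have "\<epsilon> x / c * pd k \<phi> x = (\<epsilon> x * \<epsilon> x) * trace (mD \<Gamma> k A x)"
        using c by (simp add: pd_\<phi>)
      then show ?thesis by (simp add: M.ip_scale u w \<epsilon>_square[OF x])
    qed
    then have "ip g x w v = ip g x ((\<epsilon> x / c) *\<^sub>R u) v" for v
      by (subst (1 2) axis_expansion[of v])
        (simp only: ip_def matrix_vector_sum matrix_vector_scaleR inner_sum_right inner_scaleR_right)
    then show ?thesis by (rule M.ip_nondegenerate[OF x])
  qed
  ultimately have Au: "2 *\<^sub>R (A x *v u) = (- \<phi> x * \<epsilon> x / c) *\<^sub>R u" by (simp add: eq_neg_iff_add_eq_0)
  have "A x *v u = (1/2) *\<^sub>R (2 *\<^sub>R (A x *v u))" by simp
  also have "\<dots> = ((1/2) * (- \<phi> x * \<epsilon> x / c)) *\<^sub>R u" unfolding Au by (rule scaleR_scaleR)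
  finally have "A x *v u = ((1/2) * (- \<phi> x * \<epsilon> x / c)) *\<^sub>R u" .
  then have "u = 0" by (rule no_real)
  then show ?thesis using u[of k] by (simp add: ip_def)
qed

text \<open>
  For constant \<open>\<phi>\<close> only the term with \<open>\<langle>A e\<^sub>i, A e\<^sub>i\<rangle>\<close> survives, and it sums to \<open>tr A\<^sup>2\<close>.
\<close>

lemma normal_part:
  assumes const: "\<And>y k. y \<in> U \<Longrightarrow> pd k \<phi> y = 0"
  shows "\<phi> x * \<epsilon> x * trace (A x ** A x) = t"
proof -
  have 0: "dirD v \<phi> y = 0" if "y \<in> U" for v y using const that by (simp add: dirD_def)
  have "dirD (e i x) (\<lambda>y. dirD (e i y) \<phi> y) x = 0" for i
    using pd_cong[OF open_S x 0] by (simp add: dirD_def[of _ "\<lambda>y. dirD (e i y) \<phi> y"])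
  then have "(\<Sum>i\<in>UNIV. ip g x (e i x) (e i x) * (- (\<phi> x * \<epsilon> x) * ip g x (e i x) ((A x ** A x) *v e i x))) = - t"
    using laplacian_components(2) by (simp add: 0[OF x] A_selfadjoint[OF x] matrix_vector_mul_assoc)
  moreover have "(\<Sum>i\<in>UNIV. ip g x (e i x) (e i x) * (- (\<phi> x * \<epsilon> x) * ip g x (e i x) ((A x ** A x) *v e i x)))
      = - (\<phi> x * \<epsilon> x) * trace (A x ** A x)"
    unfolding frame_expansion(2)[symmetric] sum_distrib_left by (rule sum.cong) simp_all
  ultimately show ?thesis by simp
qed

end

end

section \<open>Complex normal form of the shape operator\<close>

subsection \<open>Eigenvectors in invariant subspaces\<close>

text \<open>Horner's scheme for \<open>p(A) w\<close>.\<close>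

definition poly_apply :: "'a::field^'n^'n \<Rightarrow> 'a poly \<Rightarrow> 'a^'n \<Rightarrow> 'a^'n" where
  "poly_apply A p w = fold_coeffs (\<lambda>a v. a *s w + A *v v) p 0"

lemma poly_apply_0 [simp]: "poly_apply A 0 w = 0"
  by (simp add: poly_apply_def)

lemma poly_apply_pCons [simp]: "poly_apply A (pCons a p) w = a *s w + A *v poly_apply A p w"
  by (cases "p = 0 \<and> a = 0") (auto simp: poly_apply_def)

lemma poly_apply_add: "poly_apply A (p + q) w = poly_apply A p w + poly_apply A q w"
  by (induction p q rule: poly_induct2) (simp_all add: vec.scale_left_distrib vec.add)

lemma poly_apply_diff: "poly_apply A (p - q) w = poly_apply A p w - poly_apply A q w"
  by (induction p q rule: poly_induct2) (simp_all add: vec.scale_left_diff_distrib vec.diff)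

lemma poly_apply_smult: "poly_apply A (smult c p) w = c *s poly_apply A p w"
  by (induction p) (simp_all add: vec.scale_right_distrib vec.scale)

lemma poly_apply_in:
  assumes "vec.subspace S" "w \<in> S" "\<And>v. v \<in> S \<Longrightarrow> A *v v \<in> S"
  shows "poly_apply A p w \<in> S"
  by (induction p) (use assms in \<open>auto intro: vec.subspace_add vec.subspace_scale vec.subspace_0\<close>)

text \<open>
  In finite dimension some power \<open>A\<^sup>m w\<close> is a linear combination of the earlier ones.
\<close>

lemma annihilating_poly_exists:
  fixes A :: "'a::field^'n^'n"
  shows "\<exists>p. p \<noteq> 0 \<and> poly_apply A p w = 0"
proof -
  define f where "f k = poly_apply A (monom 1 k) w" for k
  have "\<exists>m. f m \<in> vec.span (f ` {..<m})"
  proof (rule ccontr)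
    assume "\<not> ?thesis"
    then have new: "f m \<notin> vec.span (f ` {..<m})" for m by blast
    have "vec.independent (f ` {..<m}) \<and> card (f ` {..<m}) = m" for m
    proof (induction m)
      case 0
      then show ?case by (simp add: vec.independent_empty)
    next
      case (Suc m)
      have "f m \<notin> f ` {..<m}" using vec.span_base[of "f m" "f ` {..<m}"] new[of m] by argo
      then show ?case
        using Suc vec.independent_insertI[OF new] by (simp add: lessThan_Suc)
    qed
    from this[of "Suc CARD('n)"] have "Suc CARD('n) \<le> vec.dim (UNIV :: ('a^'n) set)"
      using vec.independent_card_le_dim[of "f ` {..<Suc CARD('n)}" UNIV] by simp
    then show False by (simp add: vec.dim_UNIV card_cart_basis)
  qed
  then obtain m where m: "f m \<in> vec.span (f ` {..<m})" by blast
  have "vec.subspace {poly_apply A q w | q. q = 0 \<or> degree q < m}"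
    unfolding vec.subspace_def
  proof (intro conjI ballI allI)
    show "0 \<in> {poly_apply A q w |q. q = 0 \<or> degree q < m}" by force
  next
    fix x y
    assume "x \<in> {poly_apply A q w | q. q = 0 \<or> degree q < m}" "y \<in> {poly_apply A q w | q. q = 0 \<or> degree q < m}"
    then obtain p q where "x = poly_apply A p w" "y = poly_apply A q w"
      "p = 0 \<or> degree p < m" "q = 0 \<or> degree q < m" by blast
    then show "x + y \<in> {poly_apply A q w | q. q = 0 \<or> degree q < m}"
      by (auto intro!: exI[of _ "p + q"] simp: poly_apply_add degree_add_less)
  next
    fix x c
    assume "x \<in> {poly_apply A q w | q. q = 0 \<or> degree q < m}"
    then obtain p where "x = poly_apply A p w" "p = 0 \<or> degree p < m" by blast
    then show "c *s x \<in> {poly_apply A q w | q. q = 0 \<or> degree q < m}"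
      by (cases "c = 0") (auto intro!: exI[of _ "smult c p"] simp: poly_apply_smult)
  qed
  moreover have "f ` {..<m} \<subseteq> {poly_apply A q w | q. q = 0 \<or> degree q < m}"
    unfolding f_def by (force simp: degree_monom_eq)
  ultimately have "f m \<in> {poly_apply A q w | q. q = 0 \<or> degree q < m}"
    using m vec.span_minimal by blast
  then obtain q where q: "f m = poly_apply A q w" "q = 0 \<or> degree q < m" by blast
  have "poly_apply A (monom 1 m - q) w = 0"
    using q(1) by (simp add: poly_apply_diff f_def)
  moreover have "coeff (monom 1 m - q) m = 1"
    using q(2) by (auto simp: coeff_eq_0)
  ultimately show ?thesis by (metis coeff_0 zero_neq_one)
qed

text \<open>
  Split off a root \<open>z\<close> of a polynomial with \<open>p(A) w = 0\<close>. The remaining factor annihilates \<open>w\<close> as well,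
  or it maps \<open>w\<close> to an eigenvector for \<open>z\<close>.
\<close>

lemma invariant_subspace_eigenvector:
  fixes A :: "complex^'n^'n"
  assumes S: "vec.subspace S" and inv: "\<And>v. v \<in> S \<Longrightarrow> A *v v \<in> S" and w: "w \<in> S" "w \<noteq> 0"
  obtains \<mu> v where "v \<in> S" "v \<noteq> 0" "A *v v = \<mu> *s v"
proof -
  have "\<exists>\<mu> v. v \<in> S \<and> v \<noteq> 0 \<and> A *v v = \<mu> *s v" if "p \<noteq> 0" "poly_apply A p w = 0" for p
    using that
  proof (induction "degree p" arbitrary: p rule: less_induct)
    case less
    show ?case
    proof (cases "degree p = 0")
      case True
      then obtain c where "p = [:c:]" by (meson degree_eq_zeroE)
      with less.prems w(2) show ?thesis by (simp add: vec.scale_eq_0_iff)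
    next
      case False
      then have "\<not> constant (poly p)" by (simp add: constant_degree)
      from fundamental_theorem_of_algebra[OF this] obtain z where "poly p z = 0" ..
      then have "[:- z, 1:] dvd p" by (simp add: poly_eq_0_iff_dvd)
      then obtain q where q: "p = [:- z, 1:] * q" by (rule dvdE)
      have pq: "poly_apply A p w = A *v poly_apply A q w - z *s poly_apply A q w"
        by (simp add: q poly_apply_diff poly_apply_smult)
      show ?thesis
      proof (cases "poly_apply A q w = 0")
        case True
        have "q \<noteq> 0" using less.prems(1) q by auto
        moreover have "degree q < degree p" using \<open>q \<noteq> 0\<close> unfolding q by (subst degree_mult_eq) auto
        ultimately show ?thesis using less.hyps True by metis
      next
        case False
        moreover have "poly_apply A q w \<in> S" by (rule poly_apply_in[OF S w(1) inv])
        moreover have "A *v poly_apply A q w = z *s poly_apply A q w" using pq less.prems(2) by simp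
        ultimately show ?thesis by metis
      qed
    qed
  qed
  moreover obtain p where "p \<noteq> 0" "poly_apply A p w = 0" using annihilating_poly_exists by blast
  ultimately show ?thesis using that by metis
qed

subsection \<open>Complexification\<close>

abbreviation cmat :: "real^'n^'m \<Rightarrow> complex^'n^'m" where
  "cmat \<equiv> map_matrix complex_of_real"

definition cvec :: "real^'n \<Rightarrow> complex^'n" where
  "cvec v = (\<chi> i. complex_of_real (v $ i))"

definition cnjv :: "complex^'n \<Rightarrow> complex^'n" where
  "cnjv v = (\<chi> i. cnj (v $ i))"

text \<open>
  Bilinear, not sesquilinear: this keeps self-adjoint operators self-adjoint over the complex
  numbers, and makes eigenspaces for different eigenvalues orthogonal.
\<close>

definition bil :: "complex^'n^'n \<Rightarrow> complex^'n \<Rightarrow> complex^'n \<Rightarrow> complex" where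
  "bil M x y = (\<Sum>i\<in>UNIV. x $ i * (M *v y) $ i)"

lemma cmat_algebra:
  "cmat (A ** B) = cmat A ** cmat B" "cmat (A + A') = cmat A + cmat A'" "cmat (A - A') = cmat A - cmat A'"
  "cmat (mat 1) = mat 1" "cmat 0 = 0"
  by (simp_all add: vec_eq_iff matrix_matrix_mult_def mat_def)

lemma cmat_inj: "cmat A = cmat B \<longleftrightarrow> A = B"
  by (simp add: vec_eq_iff)

lemma trace_cmat: "trace (cmat A) = of_real (trace A)"
  by (simp add: trace_def)

lemma cmat_cvec: "cmat A *v cvec v = cvec (A *v v)"
  by (simp add: vec_eq_iff matrix_vector_mult_def cvec_def)

lemma cvec_axis: "cvec (axis i 1) = axis i 1"
  by (simp add: vec_eq_iff cvec_def axis_def)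

lemma cvec_algebra: "cvec (v + w) = cvec v + cvec w" "cvec (v - w) = cvec v - cvec w"
  "cvec (c *\<^sub>R v) = of_real c *s cvec v" "cvec 0 = 0" "cvec v = cvec w \<longleftrightarrow> v = w"
  by (simp_all add: vec_eq_iff cvec_def)

lemma bil_cvec: "bil (cmat M) (cvec v) (cvec w) = of_real (v \<bullet> (M *v w))"
  unfolding bil_def cmat_cvec by (simp add: cvec_def inner_vec_def)

lemma cnjv_algebra: "cnjv (v + w) = cnjv v + cnjv w" "cnjv (c *s v) = cnj c *s cnjv v"
  "cnjv (cnjv v) = v" "cnjv v = 0 \<longleftrightarrow> v = 0"
  by (auto simp: vec_eq_iff cnjv_def)

lemma cmat_cnjv: "cmat A *v cnjv v = cnjv (cmat A *v v)"
  by (simp add: vec_eq_iff matrix_vector_mult_def cnjv_def)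

lemma bil_cnjv: "bil (cmat M) (cnjv v) (cnjv w) = cnj (bil (cmat M) v w)"
  unfolding bil_def cmat_cnjv by (simp add: cnjv_def)

lemma bil_add: "bil M (x + x') y = bil M x y + bil M x' y" "bil M x (y + y') = bil M x y + bil M x y'"
  and bil_diff: "bil M (x - x') y = bil M x y - bil M x' y" "bil M x (y - y') = bil M x y - bil M x y'"
  and bil_scale: "bil M (c *s x) y = c * bil M x y" "bil M x (c *s y) = c * bil M x y"
  and bil_zero: "bil M 0 y = 0" "bil M x 0 = 0"
  by (simp_all add: bil_def sum.distrib algebra_simps sum_subtractf sum_distrib_left vec.add vec.diff
      vec.scale)

lemma bil_sum: "bil M (\<Sum>i\<in>I. f i) y = (\<Sum>i\<in>I. bil M (f i) y)" "bil M x (\<Sum>i\<in>I. f i) = (\<Sum>i\<in>I. bil M x (f i))"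
  by (induction I rule: infinite_finite_induct) (simp_all add: bil_zero bil_add)

lemma caxis_expansion: "(v::complex^'n) = (\<Sum>a\<in>UNIV. v $ a *s axis a 1)"
  by (simp add: vec_eq_iff axis_def if_distrib cong: if_cong)

lemma matrix_vector_axis: "(M *v axis i 1) $ k = M $ k $ i" for M :: "complex^'n^'m"
  by (simp add: matrix_vector_mult_def axis_def if_distrib[of "\<lambda>c. _ * c"] cong: if_cong)

lemma complex_mat_eqI: "(\<And>i. A *v axis i 1 = B *v axis i 1) \<Longrightarrow> A = (B :: complex^'n^'m)"
  by (simp add: vec_eq_iff matrix_vector_axis)

lemma bil_sym:
  assumes "transpose M = M"
  shows "bil M x y = bil M y x"
proof -
  have "bil M x y = (\<Sum>i\<in>UNIV. \<Sum>j\<in>UNIV. x $ i * M $ i $ j * y $ j)" for x y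
    by (simp add: bil_def matrix_vector_mult_def sum_distrib_left mult.assoc)
  from this[of x y] this[of y x] show ?thesis
    using sym_entry[OF assms] by (subst (asm) (2) sum.swap) (simp add: mult_ac)
qed

lemma bil_nondegenerate:
  assumes "transpose M = M" "invertible M" "\<And>y. bil M x y = 0"
  shows "x = 0"
proof -
  have "(M *v x) $ i = 0" for i
    using assms(3)[of "axis i 1"] bil_sym[OF assms(1), of x "axis i 1"]
    by (simp add: bil_def axis_def if_distrib[of "\<lambda>c. c * _"] cong: if_cong)
  then have "M *v x = 0" by (simp add: vec_eq_iff)
  then show ?thesis using assms(2) matrix_left_invertible_ker unfolding invertible_def by blast
qed

lemma invertible_cmat: "invertible M \<Longrightarrow> invertible (cmat M)"
  unfolding invertible_def by (metis cmat_algebra(1,4))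

lemma transpose_cmat: "transpose M = M \<Longrightarrow> transpose (cmat M) = cmat M"
  by (simp add: vec_eq_iff transpose_def)

text \<open>
  Both sides are complex bilinear, and on coordinate vectors the identity is the real one.
\<close>

lemma bil_selfadjoint_cmat:
  assumes "\<And>v w. (B *v v) \<bullet> (M *v w) = v \<bullet> (M *v (B *v w))"
  shows "bil (cmat M) (cmat B *v x) y = bil (cmat M) x (cmat B *v y)"
proof -
  have "bil (cmat M) (cmat B *v axis i 1) (axis j 1) = bil (cmat M) (axis i 1) (cmat B *v axis j 1)" for i j
    using assms[of "axis i 1" "axis j 1"] by (simp add: cvec_axis[symmetric] cmat_cvec bil_cvec)
  then show ?thesis
    by (subst (1 2) caxis_expansion[of x], subst (1 2) caxis_expansion[of y])
      (simp only: vec.sum vec.scale bil_sum bil_scale)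
qed

subsection \<open>Two non-real eigenvalues in dimension four\<close>

text \<open>
  The operator \<open>(A - \<mu>)\<^sup>2\<close> annihilates \<open>v1\<close> and \<open>v2\<close> and is injective on the span of \<open>u1\<close> and \<open>u2\<close>.
\<close>

lemma double_eigenspaces_independent:
  fixes A :: "complex^'n^'n"
  assumes "\<rho> \<noteq> \<mu>" "\<And>a b. a *s u1 + b *s u2 = 0 \<Longrightarrow> a = 0 \<and> b = 0"
    and A: "A *v u1 = \<rho> *s u1" "A *v u2 = \<rho> *s u2 + \<eta> *s u1"
      "A *v v1 = \<mu> *s v1" "A *v v2 = \<mu> *s v2 + \<theta> *s v1"
    and eq: "a *s u1 + b *s u2 + (c *s v1 + d *s v2) = 0"
  shows "a = 0 \<and> b = 0"
proof -
  define L where "L w = A *v w - \<mu> *s w" for w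
  have L: "L (x + y) = L x + L y" "L (k *s x) = k *s L x" "L 0 = 0" for x y k
    by (simp_all add: L_def vec.add vec.scale vec.scale_right_distrib vec.scale_left_commute
        vec.scale_right_diff_distrib)
  have Lv: "L (L v1) = 0" "L (L v2) = 0"
    by (simp_all add: L_def A vec.add vec.scale vec.diff vec.scale_right_distrib)
  have Lu: "L (L u1) = (\<rho> - \<mu>)^2 *s u1" "L (L u2) = (\<rho> - \<mu>)^2 *s u2 + (2 * (\<rho> - \<mu>) * \<eta>) *s u1"
    by (simp_all add: L_def A vec.add vec.scale vec.diff vec_eq_iff algebra_simps power2_eq_square)
  have "L (L (a *s u1 + b *s u2 + (c *s v1 + d *s v2))) = 0" by (simp add: eq L)
  then have "(a * (\<rho> - \<mu>)^2 + b * (2 * (\<rho> - \<mu>) * \<eta>)) *s u1 + (b * (\<rho> - \<mu>)^2) *s u2 = 0"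
    by (simp add: L Lv Lu vec.scale_right_distrib vec.scale_left_distrib add_ac)
  from assms(2)[OF this] show ?thesis using assms(1) by auto
qed

lemma mult_inv_of_columns:
  fixes p :: "4 \<Rightarrow> complex^4"
  assumes "\<And>c. (\<Sum>i\<in>UNIV. c i *s p i) = 0 \<Longrightarrow> \<forall>i. c i = 0"
  obtains P :: "complex^4^4" where "\<And>i. P *v p i = axis i 1" "\<And>w. w = (\<Sum>i\<in>UNIV. (P *v w) $ i *s p i)"
proof -
  define K :: "complex^4^4" where "K = (\<chi> k i. p i $ k)"
  have Kp: "K *v axis i 1 = p i" for i
    by (simp add: K_def matrix_vector_axis vec_eq_iff)
  have Kw: "K *v w = (\<Sum>i\<in>UNIV. w $ i *s p i)" for w
    by (subst caxis_expansion[of w]) (simp only: vec.sum vec.scale Kp)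
  have "\<forall>x. K *v x = 0 \<longrightarrow> x = 0"
    using assms by (auto simp: Kw vec_eq_iff)
  then obtain P where PK: "P ** K = mat 1" using matrix_left_invertible_ker by blast
  then have KP: "K ** P = mat 1" using matrix_left_right_inverse by blast
  have "P *v p i = axis i 1" for i
    unfolding Kp[symmetric] by (simp add: matrix_vector_mul_assoc PK)
  moreover have "w = (\<Sum>i\<in>UNIV. (P *v w) $ i *s p i)" for w
    unfolding Kw[symmetric] by (simp add: matrix_vector_mul_assoc KP)
  ultimately show ?thesis using that by blast
qed

primrec mpow :: "'a::semiring_1^'n^'n \<Rightarrow> nat \<Rightarrow> 'a^'n^'n" where
  "mpow A 0 = mat 1"
| "mpow A (Suc k) = A ** mpow A k"

lemma mpow_eigen:
  fixes A :: "complex^'n^'n"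
  assumes "A *v u1 = \<rho> *s u1"
  shows "mpow A k *v u1 = \<rho>^k *s u1"
  by (induction k) (simp_all add: matrix_vector_mul_assoc[symmetric] vec.scale assms mult.commute)

lemma mpow_jordan:
  fixes A :: "complex^'n^'n"
  assumes "A *v u1 = \<rho> *s u1" "A *v u2 = \<rho> *s u2 + \<eta> *s u1"
  shows "mpow A k *v u2 = \<rho>^k *s u2 + (of_nat k * \<rho>^(k-1) * \<eta>) *s u1"
proof (induction k)
  case (Suc k)
  have "mpow A (Suc k) *v u2 = A *v (\<rho>^k *s u2 + (of_nat k * \<rho>^(k-1) * \<eta>) *s u1)"
    by (simp add: matrix_vector_mul_assoc[symmetric] Suc)
  also have "\<dots> = \<rho>^Suc k *s u2 + (\<rho>^k * \<eta> + of_nat k * \<rho>^(k-1) * \<rho> * \<eta>) *s u1"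
    by (simp add: assms vec.add vec.scale vec_eq_iff algebra_simps)
  also have "of_nat k * \<rho>^(k-1) * \<rho> = of_nat k * \<rho>^k" by (cases k) simp_all
  finally show ?case by (simp add: algebra_simps)
qed simp

text \<open>
  Here \<open>P\<close> takes coordinates with respect to the basis \<open>p\<close>; the trace is invariant under conjugation.
\<close>

lemma trace_via_basis:
  fixes P :: "complex^'n^'n"
  assumes "\<And>i. P *v p i = axis i 1" "\<And>w. w = (\<Sum>i\<in>UNIV. (P *v w) $ i *s p i)"
  shows "trace X = (\<Sum>i\<in>UNIV. (P *v (X *v p i)) $ i)"
proof -
  define K :: "complex^'n^'n" where "K = (\<chi> k i. p i $ k)"
  have Kp: "K *v axis i 1 = p i" for i
    by (simp add: K_def matrix_vector_axis vec_eq_iff)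
  have "P ** K = mat 1"
    by (rule complex_mat_eqI) (simp add: matrix_vector_mul_assoc[symmetric] Kp assms(1))
  then have "K ** P = mat 1" using matrix_left_right_inverse by blast
  then have "trace X = trace (X ** K ** P)" by (simp add: matrix_mul_assoc[symmetric])
  also have "\<dots> = trace (P ** (X ** K))" by (rule trace_mul_sym)
  also have "\<dots> = (\<Sum>i\<in>UNIV. (P *v (X *v (K *v axis i 1))) $ i)"
  proof -
    have diag: "L $ i $ i = (L *v axis i 1) $ i" for L :: "complex^'n^'n" and i
      by (simp add: matrix_vector_axis)
    show ?thesis unfolding trace_def by (subst diag) (simp only: matrix_vector_mul_assoc matrix_mul_assoc)
  qed
  finally show ?thesis by (simp add: Kp)
qed

text \<open>
  Two double eigenvalues in dimension four, diagonalizable or not according to \<open>\<eta>\<close> and \<open>\<theta>\<close>. The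
  vectors \<open>v1\<close>, \<open>v2\<close> will be the conjugates of \<open>u1\<close>, \<open>u2\<close>; treating them as independent data lets
  the two eigenvalues exchange their roles.
\<close>

locale two_double_eigenvalues =
  fixes M A :: "complex^4^4" and \<rho> \<sigma> \<eta> \<theta> :: complex and u1 u2 v1 v2 :: "complex^4"
  assumes M_sym: "transpose M = M" and M_inv: "invertible M"
    and A_sa: "bil M (A *v x) y = bil M x (A *v y)"
    and distinct: "\<rho> \<noteq> \<sigma>"
    and Au: "A *v u1 = \<rho> *s u1" "A *v u2 = \<rho> *s u2 + \<eta> *s u1"
    and Av: "A *v v1 = \<sigma> *s v1" "A *v v2 = \<sigma> *s v2 + \<theta> *s v1"
    and u_indep: "a *s u1 + b *s u2 = 0 \<Longrightarrow> a = 0 \<and> b = 0"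
    and v_indep: "a *s v1 + b *s v2 = 0 \<Longrightarrow> a = 0 \<and> b = 0"
begin

definition bas :: "4 \<Rightarrow> complex^4" where
  "bas i = (if i = 1 then u1 else if i = 2 then u2 else if i = 3 then v1 else v2)"

lemma sum_bas: "(\<Sum>i\<in>UNIV. c i *s bas i) = c 1 *s u1 + c 2 *s u2 + (c 3 *s v1 + c 4 *s v2)"
  by (simp add: sum_4 bas_def)

lemma dual_basis_exists:
  "\<exists>P :: complex^4^4. (\<forall>i. P *v bas i = axis i 1) \<and> (\<forall>w. w = (\<Sum>i\<in>UNIV. (P *v w) $ i *s bas i))"
proof (rule mult_inv_of_columns)
  fix c :: "4 \<Rightarrow> complex"
  assume "(\<Sum>i\<in>UNIV. c i *s bas i) = 0"
  then have "c 1 *s u1 + c 2 *s u2 + (c 3 *s v1 + c 4 *s v2) = 0"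
    "c 3 *s v1 + c 4 *s v2 + (c 1 *s u1 + c 2 *s u2) = 0"
    by (simp_all add: sum_bas add_ac)
  from double_eigenspaces_independent[OF distinct u_indep Au Av this(1)]
    double_eigenspaces_independent[OF distinct[symmetric] v_indep Av Au this(2)]
  show "\<forall>i. c i = 0" unfolding forall_4 by blast
qed blast

lemma bil_commute: "bil M x y = bil M y x"
  by (rule bil_sym[OF M_sym])

lemma eigenspaces_orthogonal:
  "bil M u1 v1 = 0" "bil M u1 v2 = 0" "bil M u2 v1 = 0" "bil M u2 v2 = 0"
proof -
  have cancel: "b = 0" if "\<rho> * b = \<sigma> * b" for b using that distinct by simp
  show 1: "bil M u1 v1 = 0" using A_sa[of u1 v1] by (intro cancel) (simp add: Au Av bil_scale)
  show 2: "bil M u1 v2 = 0" using A_sa[of u1 v2] 1 by (intro cancel) (simp add: Au Av bil_scale bil_add)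
  show 3: "bil M u2 v1 = 0" using A_sa[of u2 v1] 1 by (intro cancel) (simp add: Au Av bil_scale bil_add)
  show "bil M u2 v2 = 0" using A_sa[of u2 v2] 2 3 by (intro cancel) (simp add: Au Av bil_scale bil_add)
qed

lemma basis_expansion:
  obtains a b c d where "w = a *s u1 + b *s u2 + (c *s v1 + d *s v2)"
proof -
  from dual_basis_exists obtain P :: "complex^4^4" where
    P': "(\<forall>i. P *v bas i = axis i 1) \<and> (\<forall>w. w = (\<Sum>i\<in>UNIV. (P *v w) $ i *s bas i))" ..
  note P = P'[THEN conjunct1, rule_format] P'[THEN conjunct2, rule_format]
  show ?thesis by (rule that[OF P(2)[of w, unfolded sum_bas]])
qed

lemma orthogonal_to_basis:
  assumes "bil M w u1 = 0" "bil M w u2 = 0" "bil M w v1 = 0" "bil M w v2 = 0"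
  shows "w = 0"
proof (rule bil_nondegenerate[OF M_sym M_inv])
  fix y
  obtain a b c d where "y = a *s u1 + b *s u2 + (c *s v1 + d *s v2)" by (rule basis_expansion)
  then show "bil M w y = 0" using assms by (simp add: bil_add bil_scale)
qed

text \<open>
  The eigenspaces are orthogonal, so a null vector in one of them must be paired with the rest of
  the same eigenspace.
\<close>

lemma nondegenerate_on_eigenspace:
  assumes "bil M u1 u1 = 0"
  shows "bil M u1 u2 \<noteq> 0"
proof
  assume "bil M u1 u2 = 0"
  then have "u1 = 0" using assms eigenspaces_orthogonal by (intro orthogonal_to_basis) auto
  then show False using u_indep[of 1 0] by simp
qed

lemma trace_mpow: "trace (mpow A k) = 2 * \<rho>^k + 2 * \<sigma>^k"
proof -
  from dual_basis_exists obtain P :: "complex^4^4" where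
    P': "(\<forall>i. P *v bas i = axis i 1) \<and> (\<forall>w. w = (\<Sum>i\<in>UNIV. (P *v w) $ i *s bas i))" ..
  note P = P'[THEN conjunct1, rule_format] P'[THEN conjunct2, rule_format]
  have Pb: "P *v u1 = axis 1 1" "P *v u2 = axis 2 1" "P *v v1 = axis 3 1" "P *v v2 = axis 4 1"
    using P(1)[of 1] P(1)[of 2] P(1)[of 3] P(1)[of 4] by (simp_all add: bas_def)
  have "bas 1 = u1" "bas 2 = u2" "bas 3 = v1" "bas 4 = v2" by (simp_all add: bas_def)
  then show ?thesis
    unfolding trace_via_basis[OF P] sum_4
    by (simp add: mpow_eigen[OF Au(1)] mpow_jordan[OF Au] mpow_eigen[OF Av(1)] mpow_jordan[OF Av]
        vec.add vec.scale Pb) (simp add: axis_def)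
qed

end

text \<open>
  Interpolating both values and first derivatives at \<open>\<rho>\<close> and \<open>\<sigma>\<close> by a cubic polynomial:
  the confluent Vandermonde matrix is invertible.
\<close>

lemma confluent_vandermonde:
  fixes x x' y y' \<rho> \<sigma> :: complex
  assumes "\<rho> \<noteq> \<sigma>"
    and eq: "\<And>k. k < 4 \<Longrightarrow> (\<rho>^k * x + of_nat k * \<rho>^(k-1) * y) + (\<sigma>^k * x' + of_nat k * \<sigma>^(k-1) * y') = 0"
  shows "x = 0" "y = 0" "x' = 0" "y' = 0"
proof -
  have 0: "x + x' = 0" using eq[of 0] by simp
  have 1: "(\<rho> * x + y) + (\<sigma> * x' + y') = 0" using eq[of 1] by simp
  have 2: "(\<rho>\<^sup>2 * x + 2 * \<rho> * y) + (\<sigma>\<^sup>2 * x' + 2 * \<sigma> * y') = 0" using eq[of 2] by simp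
  have 3: "(\<rho>^3 * x + 3 * \<rho>\<^sup>2 * y) + (\<sigma>^3 * x' + 3 * \<sigma>\<^sup>2 * y') = 0" using eq[of 3] by simp
  have x': "x' = - x" using 0 by algebra
  have y': "y' = - (\<rho> - \<sigma>) * x - y" using 1 x' by algebra
  have "(\<rho> - \<sigma>)^3 * x = 0" using 2 3 x' y' by algebra
  then show x: "x = 0" using assms(1) by simp
  then show "x' = 0" using x' by simp
  have "2 * (\<rho> - \<sigma>) * y = 0" using 2 x x' y' by algebra
  then show "y = 0" using assms(1) by simp
  then show "y' = 0" using x y' by simp
qed

text \<open>
  The derivative of an endomorphism field in a complex direction \<open>x\<close>, given its derivatives \<open>D i\<close> in
  the coordinate directions.
\<close>

definition mcomb :: "complex^'i \<Rightarrow> ('i \<Rightarrow> complex^'n^'m) \<Rightarrow> complex^'n^'m" where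
  "mcomb x D = (\<chi> r c. \<Sum>i\<in>UNIV. x $ i * D i $ r $ c)"

lemma mcomb_vec: "mcomb x D *v y = (\<Sum>i\<in>UNIV. x $ i *s (D i *v y))"
  unfolding vec_eq_iff
proof
  fix r
  have "(mcomb x D *v y) $ r = (\<Sum>c\<in>UNIV. \<Sum>i\<in>UNIV. x $ i * D i $ r $ c * y $ c)"
    by (simp add: mcomb_def matrix_vector_mult_def sum_distrib_right)
  also have "\<dots> = (\<Sum>i\<in>UNIV. x $ i *s (D i *v y)) $ r"
    by (subst sum.swap) (simp add: matrix_vector_mult_def sum_distrib_left mult.assoc)
  finally show "(mcomb x D *v y) $ r = (\<Sum>i\<in>UNIV. x $ i *s (D i *v y)) $ r" .
qed

lemma trace_mcomb: "trace (mcomb x D) = (\<Sum>i\<in>UNIV. x $ i * trace (D i))"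
  unfolding trace_def mcomb_def by (simp add: sum_distrib_left) (rule sum.swap)

lemma matrix_eq_vec: "(\<And>w. A *v w = B *v w) \<Longrightarrow> A = (B :: complex^'n^'m)"
  by (rule complex_mat_eqI)

lemma mcomb_mult: "B ** mcomb x D = mcomb x (\<lambda>i. B ** D i)" "mcomb x D ** C = mcomb x (\<lambda>i. D i ** C)"
  by (rule matrix_eq_vec, simp add: matrix_vector_mul_assoc[symmetric] mcomb_vec vec.sum vec.scale)+

lemma mcomb_sym:
  assumes "\<And>i j. D i *v axis j 1 = D j *v axis i 1"
  shows "mcomb x D *v y = mcomb y D *v x"
proof -
  have "mcomb x D *v y = (\<Sum>i\<in>UNIV. \<Sum>j\<in>UNIV. (x $ i * y $ j) *s (D i *v axis j 1))" for x y
    by (subst caxis_expansion[of y], subst sum.swap)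
      (simp add: mcomb_vec vec.sum vec.scale vec.scale_sum_right mult.commute)
  from this[of x y] this[of y x] show ?thesis
    by (subst (asm) (2) sum.swap) (simp add: assms mult.commute)
qed

lemma mcomb_selfadjoint:
  assumes "\<And>i x y. bil M (D i *v x) y = bil M x (D i *v y)"
  shows "bil M (mcomb z D *v x) y = bil M x (mcomb z D *v y)"
  by (simp add: mcomb_vec bil_sum bil_scale assms)

text \<open>
  One block of size two for each eigenvalue, with a basis of null vectors: in each generalized
  eigenspace the eigenvector is null anyway, and a multiple of it can be added to \<open>u2\<close> or \<open>v2\<close>.
\<close>

locale two_jordan_blocks = two_double_eigenvalues M A \<rho> \<sigma> 1 1 u1 u2 v1 v2
  for M A :: "complex^4^4" and \<rho> \<sigma> :: complex and u1 u2 v1 v2 :: "complex^4" +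
  assumes null: "bil M u1 u1 = 0" "bil M u2 u2 = 0" "bil M v1 v1 = 0" "bil M v2 v2 = 0"
begin

lemma swap: "two_jordan_blocks M A \<sigma> \<rho> v1 v2 u1 u2"
  by unfold_locales (use M_sym M_inv A_sa distinct Au Av u_indep v_indep null in auto)

lemma pairing_nonzero: "bil M u1 u2 \<noteq> 0" "bil M v1 v2 \<noteq> 0"
  using nondegenerate_on_eigenspace[OF null(1)]
    two_double_eigenvalues.nondegenerate_on_eigenspace[OF two_jordan_blocks.axioms(1)[OF swap] null(3)]
  by auto

text \<open>
  The dual basis is the basis itself with partners exchanged, up to the factors \<open>\<langle>u1, u2\<rangle>\<close> and
  \<open>\<langle>v1, v2\<rangle>\<close>.
\<close>

lemma trace_formula:
  "trace X = (bil M u2 (X *v u1) + bil M u1 (X *v u2)) / bil M u1 u2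
    + (bil M v2 (X *v v1) + bil M v1 (X *v v2)) / bil M v1 v2"
proof -
  from dual_basis_exists obtain P :: "complex^4^4" where
    P': "(\<forall>i. P *v bas i = axis i 1) \<and> (\<forall>w. w = (\<Sum>i\<in>UNIV. (P *v w) $ i *s bas i))" ..
  note P = P'[THEN conjunct1, rule_format] P'[THEN conjunct2, rule_format]
  have w: "w = (P *v w) $ 1 *s u1 + (P *v w) $ 2 *s u2 + ((P *v w) $ 3 *s v1 + (P *v w) $ 4 *s v2)" for w
    by (rule P(2)[of w, unfolded sum_bas])
  note orth = eigenspaces_orthogonal eigenspaces_orthogonal[unfolded bil_commute[of u1] bil_commute[of u2]]
  have c1: "bil M u2 w = (P *v w) $ 1 * bil M u1 u2" for w
    by (subst w[of w]) (simp add: bil_add bil_scale null orth bil_commute[of u2 u1])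
  have c2: "bil M u1 w = (P *v w) $ 2 * bil M u1 u2" for w
    by (subst w[of w]) (simp add: bil_add bil_scale null orth)
  have c3: "bil M v2 w = (P *v w) $ 3 * bil M v1 v2" for w
    by (subst w[of w]) (simp add: bil_add bil_scale null orth bil_commute[of v2 v1])
  have c4: "bil M v1 w = (P *v w) $ 4 * bil M v1 v2" for w
    by (subst w[of w]) (simp add: bil_add bil_scale null orth)
  have "trace X = (P *v (X *v u1)) $ 1 + (P *v (X *v u2)) $ 2 + (P *v (X *v v1)) $ 3 + (P *v (X *v v2)) $ 4"
    unfolding trace_via_basis[OF P] sum_4 by (simp add: bas_def)
  then show ?thesis
    using pairing_nonzero unfolding c1[of "X *v u1"] c2[of "X *v u2"] c3[of "X *v v1"] c4[of "X *v v2"]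
    by (simp add: add_divide_distrib)
qed

lemma mpow_selfadjoint: "bil M (mpow A k *v x) y = bil M x (mpow A k *v y)"
proof (induction k arbitrary: x y)
  case (Suc k)
  have comm: "mpow A k ** A = A ** mpow A k" by (induction k) (simp_all add: matrix_mul_assoc[symmetric])
  have "bil M (mpow A (Suc k) *v x) y = bil M x (mpow A k *v (A *v y))"
    by (simp add: matrix_vector_mul_assoc[symmetric] A_sa Suc)
  then show ?case by (simp add: matrix_vector_mul_assoc comm)
qed simp

text \<open>
  The functions of \<open>A\<close> include the projections onto the two generalized eigenspaces and the nilpotent
  parts there. So the traces vanish only if \<open>B\<close> has these vanishing coefficients.
\<close>

lemma trace_free_coefficients:
  assumes sa: "\<And>x y. bil M (B *v x) y = bil M x (B *v y)"
    and tr: "\<And>k. k < 4 \<Longrightarrow> trace (mpow A k ** B) = 0"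
  shows "bil M (B *v u1) u1 = 0" "bil M (B *v u1) u2 = 0" "bil M (B *v v1) v1 = 0" "bil M (B *v v1) v2 = 0"
proof -
  define x where "x = 2 * bil M (B *v u1) u2 / bil M u1 u2"
  define y where "y = bil M (B *v u1) u1 / bil M u1 u2"
  define x' where "x' = 2 * bil M (B *v v1) v2 / bil M v1 v2"
  define y' where "y' = bil M (B *v v1) v1 / bil M v1 v2"
  have "(\<rho>^k * x + of_nat k * \<rho>^(k-1) * y) + (\<sigma>^k * x' + of_nat k * \<sigma>^(k-1) * y') = 0" if "k < 4" for k
  proof -
    have s: "bil M u2 (B *v u1) = bil M (B *v u1) u2" "bil M u1 (B *v u2) = bil M (B *v u1) u2"
      "bil M u1 (B *v u1) = bil M (B *v u1) u1" "bil M v2 (B *v v1) = bil M (B *v v1) v2"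
      "bil M v1 (B *v v2) = bil M (B *v v1) v2" "bil M v1 (B *v v1) = bil M (B *v v1) v1"
      by (simp_all only: bil_commute[of u2] bil_commute[of v2] sa)
    have "trace (mpow A k ** B)
        = (bil M (mpow A k *v u2) (B *v u1) + bil M (mpow A k *v u1) (B *v u2)) / bil M u1 u2
        + (bil M (mpow A k *v v2) (B *v v1) + bil M (mpow A k *v v1) (B *v v2)) / bil M v1 v2"
      unfolding trace_formula by (simp add: matrix_vector_mul_assoc[symmetric] mpow_selfadjoint)
    also have "\<dots> = (\<rho>^k * x + of_nat k * \<rho>^(k-1) * y) + (\<sigma>^k * x' + of_nat k * \<sigma>^(k-1) * y')"
      unfolding mpow_eigen[OF Au(1)] mpow_jordan[OF Au] mpow_eigen[OF Av(1)] mpow_jordan[OF Av]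
      by (simp add: bil_add bil_scale s x_def y_def x'_def y'_def add_divide_distrib mult.left_commute)
    finally show ?thesis using tr[OF that] by simp
  qed
  from confluent_vandermonde[OF distinct this]
  show "bil M (B *v u1) u1 = 0" "bil M (B *v u1) u2 = 0" "bil M (B *v v1) v1 = 0" "bil M (B *v v1) v2 = 0"
    using pairing_nonzero by (simp_all add: x_def y_def x'_def y'_def)
qed

end

subsection \<open>First and second derivatives of a nondiagonalizable shape operator\<close>

text \<open>
  The algebraic content of constant principal curvatures at one point: \<open>D\<close> and \<open>Q\<close> are the first and
  second covariant derivatives of \<open>A\<close>, symmetric by the Codazzi equation, and \<open>E i k\<close> is the first
  derivative of \<open>A\<^sup>k\<close>. The trace conditions say that \<open>tr A, \<dots>, tr A\<^sup>4\<close> are constant.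
\<close>

locale jordan_second_order = two_jordan_blocks +
  fixes D :: "4 \<Rightarrow> complex^4^4" and Q :: "4 \<Rightarrow> 4 \<Rightarrow> complex^4^4" and E :: "4 \<Rightarrow> nat \<Rightarrow> complex^4^4"
  assumes D_sa: "bil M (D i *v x) y = bil M x (D i *v y)"
    and D_codazzi: "D i *v axis j 1 = D j *v axis i 1"
    and D_trace: "k < 4 \<Longrightarrow> trace (mpow A k ** D i) = 0"
    and Q_sa: "bil M (Q i j *v x) y = bil M x (Q i j *v y)"
    and Q_codazzi: "Q i j *v axis l 1 = Q i l *v axis j 1"
    and E_0: "E i 0 = 0" and E_Suc: "E i (Suc m) = D i ** mpow A m + A ** E i m"
    and second_trace: "k < 4 \<Longrightarrow> trace (E i k ** D j) + trace (mpow A k ** Q i j) = 0"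
begin

abbreviation "DD x \<equiv> mcomb x D"
abbreviation "QQ x y \<equiv> mcomb x (\<lambda>i. mcomb y (Q i))"

lemma DD_sa: "bil M (DD z *v x) y = bil M x (DD z *v y)"
  by (rule mcomb_selfadjoint[OF D_sa])

lemma DD_sym: "DD x *v y = DD y *v x"
  by (rule mcomb_sym[OF D_codazzi])

lemma DD_coefficients:
  "bil M (DD z *v u1) u1 = 0" "bil M (DD z *v u1) u2 = 0" "bil M (DD z *v v1) v1 = 0" "bil M (DD z *v v1) v2 = 0"
  by (rule trace_free_coefficients[OF DD_sa]; simp add: mcomb_mult trace_mcomb D_trace)+

text \<open>
  The cubic form \<open>\<langle>(\<nabla>\<^sub>x A) y, z\<rangle>\<close> is totally symmetric, so all of its components with
  one argument \<open>u1\<close> vanish except the one with the other two arguments \<open>v2\<close>.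
\<close>

lemma DD_u1:
  defines "c \<equiv> bil M (DD u1 *v v2) v2 / (bil M v1 v2)\<^sup>2"
  shows "DD u1 *v w = (c * bil M v1 w) *s v1"
proof -
  note orth = eigenspaces_orthogonal eigenspaces_orthogonal[unfolded bil_commute[of u1] bil_commute[of u2]]
  have t12: "bil M (DD x *v y) z = bil M (DD y *v x) z" for x y z by (simp only: DD_sym[of x y])
  have t23: "bil M (DD x *v y) z = bil M (DD x *v z) y" for x y z
    using DD_sa[of x y z] bil_commute[of y "DD x *v z"] by simp
  have T1: "bil M (DD u1 *v u1) z = 0" for z
    using t23[of u1 u1 z] t12[of u1 z u1] DD_coefficients(1)[of z] by simp
  have T2: "bil M (DD u1 *v u2) z = 0" for z
    using t23[of u1 u2 z] t12[of u1 z u2] DD_coefficients(2)[of z] by simp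
  have 1: "DD u1 *v u1 = 0" by (rule orthogonal_to_basis) (rule T1)+
  have 2: "DD u1 *v u2 = 0" by (rule orthogonal_to_basis) (rule T2)+
  have 3: "DD u1 *v v1 = 0"
    by (rule orthogonal_to_basis)
      (simp_all add: t23[of u1 v1 u1] t23[of u1 v1 u2] T1 T2 DD_coefficients)
  have "DD u1 *v v2 - (c * bil M v1 v2) *s v1 = 0"
  proof (rule orthogonal_to_basis)
    show "bil M (DD u1 *v v2 - (c * bil M v1 v2) *s v1) u1 = 0"
      using 1 by (simp add: bil_diff bil_scale orth DD_sa bil_zero)
    show "bil M (DD u1 *v v2 - (c * bil M v1 v2) *s v1) u2 = 0"
      using 2 by (simp add: bil_diff bil_scale orth DD_sa bil_zero)
    show "bil M (DD u1 *v v2 - (c * bil M v1 v2) *s v1) v1 = 0"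
      using 3 by (simp add: bil_diff bil_scale null DD_sa bil_zero)
    show "bil M (DD u1 *v v2 - (c * bil M v1 v2) *s v1) v2 = 0"
      using pairing_nonzero by (simp add: bil_diff bil_scale c_def power2_eq_square)
  qed
  then have 4: "DD u1 *v v2 = (c * bil M v1 v2) *s v1" by simp
  obtain a1 a2 a3 a4 where w: "w = a1 *s u1 + a2 *s u2 + (a3 *s v1 + a4 *s v2)" by (rule basis_expansion)
  show ?thesis
    unfolding w by (simp add: vec.add vec.scale 1 2 3 4 bil_add bil_scale orth null)
qed

text \<open>
  Hence \<open>\<nabla>\<^bsub>u1\<^esub> A\<close> commutes with \<open>A\<close> and is trace-orthogonal to every \<open>\<nabla>\<^sub>y A\<close>, and the quadratic
  terms in the second derivatives of the traces drop out in these directions.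
\<close>

lemma QQ_u1_trace:
  assumes "k < 4"
  shows "trace (mpow A k ** QQ u1 y) = 0"
proof -
  note orth = eigenspaces_orthogonal eigenspaces_orthogonal[unfolded bil_commute[of u1] bil_commute[of u2]]
  obtain c where c: "DD u1 *v w = (c * bil M v1 w) *s v1" for w using DD_u1 by blast
  have DA: "DD u1 *v (mpow A m *v w) = \<sigma>^m *s (DD u1 *v w)" for m w
  proof -
    have "bil M v1 (mpow A m *v w) = \<sigma>^m * bil M v1 w"
      using mpow_selfadjoint[of m v1 w] by (simp add: mpow_eigen[OF Av(1)] bil_scale)
    then show ?thesis by (simp add: c)
  qed
  \<comment> \<open>By \<open>DA\<close>, the derivative of every power of \<open>A\<close> in the direction \<open>u1\<close> is a multiple of that of \<open>A\<close>.\<close>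
  have "\<exists>r. \<forall>w. mcomb u1 (\<lambda>i. E i m) *v w = r *s (DD u1 *v w)" for m
  proof (induction m)
    case 0
    show ?case by (intro exI[of _ 0]) (simp add: mcomb_vec E_0)
  next
    case (Suc m)
    then obtain r where r: "\<And>w. mcomb u1 (\<lambda>i. E i m) *v w = r *s (DD u1 *v w)" by blast
    have "mcomb u1 (\<lambda>i. E i (Suc m)) *v w = DD u1 *v (mpow A m *v w) + A *v (mcomb u1 (\<lambda>i. E i m) *v w)" for w
      by (simp add: mcomb_vec E_Suc matrix_vector_distribs matrix_vector_mul_assoc[symmetric]
          vec.scale_right_distrib sum.distrib vec.sum vec.scale)
    moreover have "A *v (DD u1 *v w) = \<sigma> *s (DD u1 *v w)" for w
      by (simp add: c vec.scale Av mult.commute)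
    ultimately have "mcomb u1 (\<lambda>i. E i (Suc m)) *v w = (\<sigma>^m + r * \<sigma>) *s (DD u1 *v w)" for w
      by (simp only: DA r vec.scale) (simp add: vec_eq_iff algebra_simps)
    then show ?case by blast
  qed
  then obtain r where r: "\<And>w. mcomb u1 (\<lambda>i. E i k) *v w = r *s (DD u1 *v w)" by blast
  have "trace (mcomb u1 (\<lambda>i. E i k) ** DD y) = 0"
    unfolding trace_formula
    by (simp add: matrix_vector_mul_assoc[symmetric] r c bil_scale orth null)
      (metis DD_coefficients(3) bil_commute)
  moreover have "trace (mcomb u1 (\<lambda>i. E i k) ** DD y)
      = (\<Sum>i\<in>UNIV. u1 $ i * (\<Sum>j\<in>UNIV. y $ j * trace (E i k ** D j)))"
    by (simp add: mcomb_mult trace_mcomb sum_distrib_left) (subst sum.swap, simp add: mult_ac)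
  moreover have "trace (mpow A k ** QQ u1 y)
      = (\<Sum>i\<in>UNIV. u1 $ i * (\<Sum>j\<in>UNIV. y $ j * trace (mpow A k ** Q i j)))"
    by (simp add: mcomb_mult trace_mcomb)
  moreover have "trace (mpow A k ** Q i j) = - trace (E i k ** D j)" for i j
    using second_trace[OF assms, of i j] by (simp add: eq_neg_iff_add_eq_0 add.commute)
  ultimately show ?thesis by (simp add: sum_negf)
qed

lemma QQ_sa: "bil M (QQ z z' *v x) y = bil M x (QQ z z' *v y)"
  by (intro mcomb_selfadjoint Q_sa)

lemma QQ_sym: "QQ z x *v y = QQ z y *v x"
  using mcomb_sym[OF Q_codazzi] by (simp add: mcomb_vec[of z])

text \<open>
  The trace conditions see the component of \<open>\<nabla>\<^sup>2\<^bsub>u1,u2\<^esub> A\<close> on \<open>v1, v2\<close>, and by the Codazzi symmetry this is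
  the component of \<open>\<nabla>\<^sup>2\<^bsub>u1,v1\<^esub> A\<close> on \<open>u2, v2\<close>.
\<close>

lemma QQ_u1_v1: "bil M (QQ u1 v1 *v u2) v2 = 0"
proof -
  have "bil M (QQ u1 u2 *v v1) v2 = 0"
    by (rule trace_free_coefficients(4)[OF QQ_sa QQ_u1_trace])
  then show ?thesis by (simp add: QQ_sym[of u1 u2 v1])
qed

lemma swap_second_order: "jordan_second_order M A \<sigma> \<rho> v1 v2 u1 u2 D Q E"
  by (intro jordan_second_order.intro swap jordan_second_order_axioms.intro)
    (use D_sa D_codazzi D_trace Q_sa Q_codazzi E_0 E_Suc second_trace in auto)

lemma QQ_commutator: "bil M (QQ u1 v1 *v u2) v2 = 0" "bil M (QQ v1 u1 *v u2) v2 = 0"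
  using QQ_u1_v1 jordan_second_order.QQ_u1_v1[OF swap_second_order] QQ_sa[of v1 u1 u2 v2] bil_commute
  by auto

end

subsection \<open>Normal form of a self-adjoint matrix\<close>

lemma two_double_eigenvalues_conjugate:
  fixes A g :: "real^4^4"
  assumes "transpose g = g" "invertible g"
    and sa: "\<And>v w. (A *v v) \<bullet> (g *v w) = v \<bullet> (g *v (A *v w))"
    and \<rho>: "Im \<rho> \<noteq> 0" and \<eta>: "\<eta> \<in> \<real>"
    and u: "cmat A *v u1 = \<rho> *s u1" "cmat A *v u2 = \<rho> *s u2 + \<eta> *s u1" "u1 \<noteq> 0" "\<And>c. u2 \<noteq> c *s u1"
  shows "two_double_eigenvalues (cmat g) (cmat A) \<rho> (cnj \<rho>) \<eta> \<eta> u1 u2 (cnjv u1) (cnjv u2)"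
proof
  have indep: "a = 0 \<and> b = 0" if eq: "a *s u1 + b *s u2 = 0" for a b
  proof (cases "b = 0")
    case True
    then show ?thesis using eq u(3) by (simp add: vec.scale_eq_0_iff)
  next
    case False
    have "u2 = (- a / b) *s u1"
      unfolding vec_eq_iff
    proof
      fix i
      have "a * u1 $ i + b * u2 $ i = 0" using arg_cong[OF eq, of "\<lambda>v. v $ i"] by simp
      then show "u2 $ i = ((- a / b) *s u1) $ i" using False by (simp add: field_simps eq_neg_iff_add_eq_0)
    qed
    then show ?thesis using u(4) by blast
  qed
  show "a *s u1 + b *s u2 = 0 \<Longrightarrow> a = 0 \<and> b = 0" for a b by (rule indep)
  show "a = 0 \<and> b = 0" if "a *s cnjv u1 + b *s cnjv u2 = 0" for a b
  proof -
    have "cnj a *s u1 + cnj b *s u2 = cnjv (a *s cnjv u1 + b *s cnjv u2)" by (simp add: cnjv_algebra)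
    also have "\<dots> = 0" unfolding that by (simp add: cnjv_algebra)
    finally show ?thesis using indep by fastforce
  qed
  show "transpose (cmat g) = cmat g" "invertible (cmat g)"
    using assms(1,2) transpose_cmat invertible_cmat by blast+
  show "bil (cmat g) (cmat A *v x) y = bil (cmat g) x (cmat A *v y)" for x y
    by (rule bil_selfadjoint_cmat[OF sa])
  show "\<rho> \<noteq> cnj \<rho>" using \<rho> by (simp add: complex_eq_iff)
  show "cmat A *v u1 = \<rho> *s u1" "cmat A *v u2 = \<rho> *s u2 + \<eta> *s u1" by (rule u)+
  show "cmat A *v cnjv u1 = cnj \<rho> *s cnjv u1" "cmat A *v cnjv u2 = cnj \<rho> *s cnjv u2 + \<eta> *s cnjv u1"
    using \<eta> by (simp_all add: cmat_cnjv u cnjv_algebra Reals_cnj_iff)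
qed

text \<open>
  If the eigenspace of \<open>\<rho>\<close> is a line, the eigenvector \<open>u1\<close> is null: otherwise the orthogonal complement
  of \<open>u1\<close> and its conjugate is invariant and contains one more eigenvector. The range of \<open>A - \<rho>\<close>
  is the orthogonal complement of its kernel, so it then contains \<open>u1\<close>.
\<close>

theorem selfadjoint_normal_form:
  fixes A g :: "real^4^4"
  defines "spec \<equiv> {\<mu>. \<exists>v. v \<noteq> 0 \<and> cmat A *v v = \<mu> *s v}"
  assumes g: "transpose g = g" "invertible g"
    and sa: "\<And>v w. (A *v v) \<bullet> (g *v w) = v \<bullet> (g *v (A *v w))"
    and card: "card spec = 2" and nonreal: "\<And>\<mu>. \<mu> \<in> spec \<Longrightarrow> Im \<mu> \<noteq> 0"
  obtains \<rho> \<eta> u1 u2 where "Im \<rho> > 0"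
    "two_double_eigenvalues (cmat g) (cmat A) \<rho> (cnj \<rho>) \<eta> \<eta> u1 u2 (cnjv u1) (cnjv u2)"
    "\<eta> = 0 \<or> \<eta> = 1 \<and> bil (cmat g) u1 u1 = 0 \<and> bil (cmat g) u2 u2 = 0"
proof -
  let ?A = "cmat A" and ?b = "bil (cmat g)"
  note gc = transpose_cmat[OF g(1)] invertible_cmat[OF g(2)]
  have saA: "?b (?A *v x) y = ?b x (?A *v y)" for x y by (rule bil_selfadjoint_cmat[OF sa])
  have comm: "?b x y = ?b y x" for x y by (rule bil_sym[OF gc(1)])
  have spec_iff: "\<mu> \<in> spec \<longleftrightarrow> (\<exists>v. v \<noteq> 0 \<and> ?A *v v = \<mu> *s v)" for \<mu> by (simp add: spec_def)
  have cnj_spec: "cnj \<mu> \<in> spec" if "\<mu> \<in> spec" for \<mu>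
  proof -
    from that[unfolded spec_iff] obtain v where "v \<noteq> 0 \<and> ?A *v v = \<mu> *s v" ..
    then have "cnjv v \<noteq> 0" "?A *v cnjv v = cnj \<mu> *s cnjv v" by (simp_all add: cmat_cnjv cnjv_algebra)
    then show ?thesis unfolding spec_iff by (intro exI[of _ "cnjv v"] conjI)
  qed
  obtain \<rho> where \<rho>: "\<rho> \<in> spec" "Im \<rho> > 0"
  proof -
    have "spec \<noteq> {}" using card by (metis card.empty zero_neq_numeral)
    then obtain \<mu> where "\<mu> \<in> spec" by blast
    then show ?thesis
      using that[of \<mu>] that[of "cnj \<mu>"] cnj_spec[of \<mu>] nonreal[of \<mu>] by (cases "Im \<mu> > 0") auto
  qed
  have spec: "spec = {\<rho>, cnj \<rho>}"
  proof -
    have "card {\<rho>, cnj \<rho>} = 2" using \<rho>(2) by (simp add: complex_eq_iff)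
    moreover have "finite spec" using card by (metis card.infinite zero_neq_numeral)
    ultimately show ?thesis
      using card_subset_eq[of spec "{\<rho>, cnj \<rho>}"] \<rho>(1) cnj_spec card by auto
  qed
  from \<rho>(1)[unfolded spec_iff] obtain u1 where "u1 \<noteq> 0 \<and> ?A *v u1 = \<rho> *s u1" ..
  then have u1: "u1 \<noteq> 0" "?A *v u1 = \<rho> *s u1" by simp_all
  define v1 where "v1 = cnjv u1"
  have v1: "v1 \<noteq> 0" "?A *v v1 = cnj \<rho> *s v1" using u1 by (simp_all add: v1_def cmat_cnjv cnjv_algebra)
  note conj = two_double_eigenvalues_conjugate[OF g sa, of \<rho>]
  show ?thesis
  proof (cases "\<exists>u2. ?A *v u2 = \<rho> *s u2 \<and> (\<forall>c. u2 \<noteq> c *s u1)")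
    case True
    then obtain u2 where u2: "?A *v u2 = \<rho> *s u2" "\<And>c. u2 \<noteq> c *s u1" by blast
    show ?thesis by (rule that[OF \<rho>(2) conj[of 0 u1 u2]]) (use \<rho> u1 u2 in auto)
  next
    case False
    then have line: "\<exists>c. w = c *s u1" if "?A *v w = \<rho> *s w" for w using that by blast
    have ortho: "?b u1 v1 = 0"
    proof -
      have "\<rho> * ?b u1 v1 = cnj \<rho> * ?b u1 v1" using saA[of u1 v1] by (simp add: u1 v1 bil_scale)
      then show ?thesis using \<rho>(2) by (auto simp: complex_eq_iff)
    qed
    have null: "?b u1 u1 = 0"
    proof (rule ccontr)
      assume nz: "?b u1 u1 \<noteq> 0"
      then have nz': "?b v1 v1 \<noteq> 0" by (simp add: v1_def bil_cnjv)
      have "vec.span {u1, v1} \<noteq> UNIV"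
      proof
        assume "vec.span {u1, v1} = UNIV"
        then have "vec.dim (UNIV :: (complex^4) set) \<le> card {u1, v1}"
          by (intro vec.dim_le_card) auto
        also have "\<dots> \<le> 2" by (simp add: card_insert_if)
        finally show False by (simp add: vec.dim_UNIV card_cart_basis)
      qed
      then obtain x where x: "x \<notin> vec.span {u1, v1}" by blast
      define w where "w = x - (?b x u1 / ?b u1 u1) *s u1 - (?b x v1 / ?b v1 v1) *s v1"
      have "w \<noteq> 0"
      proof
        assume "w = 0"
        then have "x = (?b x u1 / ?b u1 u1) *s u1 + (?b x v1 / ?b v1 v1) *s v1" by (simp add: w_def algebra_simps)
        moreover have "(?b x u1 / ?b u1 u1) *s u1 + (?b x v1 / ?b v1 v1) *s v1 \<in> vec.span {u1, v1}"
          by (intro vec.span_add vec.span_scale vec.span_base) auto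
        ultimately show False using x by simp
      qed
      define S where "S = {w. ?b w u1 = 0 \<and> ?b w v1 = 0}"
      have wS: "w \<in> S" using nz nz' ortho comm[of v1 u1] by (simp add: S_def w_def bil_diff bil_scale)
      have "vec.subspace S" by (simp add: vec.subspace_def S_def bil_add bil_scale bil_zero)
      moreover have "?A *v y \<in> S" if "y \<in> S" for y
        using that by (simp add: S_def saA u1 v1 bil_scale)
      ultimately obtain \<mu> y where y: "y \<in> S" "y \<noteq> 0" "?A *v y = \<mu> *s y"
        using invariant_subspace_eigenvector[of S ?A w] wS \<open>w \<noteq> 0\<close> by metis
      then have "\<mu> \<in> spec" unfolding spec_iff by (intro exI[of _ y] conjI)
      then consider "\<mu> = \<rho>" | "\<mu> = cnj \<rho>" using spec by blast
      then show False
      proof cases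
        case 1
        then obtain c where "y = c *s u1" using line y(3) by blast
        then show False using y(1,2) nz by (auto simp: S_def bil_scale)
      next
        case 2
        then have "?A *v cnjv y = \<rho> *s cnjv y" using y(3) by (simp add: cmat_cnjv cnjv_algebra)
        then obtain c where "cnjv y = c *s u1" using line by blast
        then have "y = cnj c *s v1" unfolding v1_def by (metis cnjv_algebra(2,3))
        then show False using y(1,2) nz' by (auto simp: S_def bil_scale)
      qed
    qed
    obtain w where w: "?A *v w = \<rho> *s w + u1"
    proof -
      obtain z where z: "?b u1 z \<noteq> 0" using bil_nondegenerate[OF gc] u1(1) by blast
      \<comment> \<open>A rank-one perturbation of \<open>A - \<rho>\<close> that is injective, hence surjective.\<close>
      define K :: "complex^4^4" where
        "K = (\<chi> r c. ?A $ r $ c - (if r = c then \<rho> else 0) + z $ r * (cmat g *v z) $ c)"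
      have K: "K *v y = ?A *v y - \<rho> *s y + ?b y z *s z" for y
      proof -
        have "(K *v y) $ r = (?A *v y - \<rho> *s y + ?b y z *s z) $ r" for r
          by (simp add: K_def matrix_vector_mult_def[of _ y] bil_def algebra_simps sum.distrib sum_subtractf
              sum_distrib_left if_distrib[of "\<lambda>c. c * _"] if_distrib[of "\<lambda>c. _ * c"] cong: if_cong)
        then show ?thesis by (simp add: vec_eq_iff)
      qed
      have bK: "?b u1 (K *v y) = ?b y z * ?b u1 z" for y
        using saA[of u1 y] by (simp add: K bil_add bil_diff bil_scale u1)
      have "y = 0" if "K *v y = 0" for y
      proof -
        have yz: "?b y z = 0" using bK[of y] that z by (simp add: bil_zero)
        then have "?A *v y = \<rho> *s y" using that by (simp add: K)
        then obtain c where "y = c *s u1" using line by blast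
        then show ?thesis using yz z by (auto simp: bil_scale)
      qed
      then obtain P where "P ** K = mat 1" using matrix_left_invertible_ker by blast
      then have "K ** P = mat 1" using matrix_left_right_inverse by blast
      then have KP: "K *v (P *v u1) = u1" by (simp add: matrix_vector_mul_assoc)
      then have "?b (P *v u1) z = 0" using bK[of "P *v u1"] null z by simp
      then show ?thesis using that[of "P *v u1"] KP by (simp add: K algebra_simps)
    qed
    have indep: "w' \<noteq> c *s u1" if "?A *v w' = \<rho> *s w' + u1" for w' c
      using that u1 by (auto simp: vec.scale mult.commute)
    have block: "two_double_eigenvalues (cmat g) ?A \<rho> (cnj \<rho>) 1 1 u1 w' (cnjv u1) (cnjv w')"
      if "?A *v w' = \<rho> *s w' + u1" for w'
      by (rule conj) (use \<rho> u1 that indep[OF that] in auto)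
    have pair: "?b u1 w \<noteq> 0"
      by (rule two_double_eigenvalues.nondegenerate_on_eigenspace[OF block[OF w] null])
    define u2 where "u2 = w - (?b w w / (2 * ?b u1 w)) *s u1"
    have "?A *v u2 = \<rho> *s u2 + u1"
      by (simp add: u2_def vec.diff vec.scale w u1 vec.scale_right_diff_distrib mult.commute)
    moreover have "?b u2 u2 = 0"
      using pair comm[of w u1] by (simp add: u2_def bil_diff bil_scale null field_simps)
    ultimately show ?thesis using that[OF \<rho>(2) block[of u2]] null by blast
  qed
qed

subsection \<open>Curvature in the plane of two eigenvectors\<close>

context two_double_eigenvalues
begin

context
  fixes R :: "4 \<Rightarrow> 4 \<Rightarrow> complex^4^4" and k e :: complex
  assumes gauss: "R i j *v z = k *s (bil M (axis j 1) z *s axis i 1 - bil M (axis i 1) z *s axis j 1)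
    + e *s (bil M (A *v axis j 1) z *s (A *v axis i 1) - bil M (A *v axis i 1) z *s (A *v axis j 1))"
begin

abbreviation "RR \<equiv> mcomb u1 (\<lambda>i. mcomb v1 (R i))"

text \<open>
  Since \<open>A u1 = \<rho> u1\<close> and \<open>A v1 = \<sigma> v1\<close>, both terms of the Gauss equation are multiples of the same
  infinitesimal rotation.
\<close>

lemma RR_vec: "RR *v z = (k + e * \<rho> * \<sigma>) *s (bil M v1 z *s u1 - bil M u1 z *s v1)"
proof -
  define W where "W B i j = bil M (B *v axis j 1) z *s (B *v axis i 1) - bil M (B *v axis i 1) z *s (B *v axis j 1)"
    for B :: "complex^4^4" and i j
  have exp: "B *v y = (\<Sum>i\<in>UNIV. y $ i *s (B *v axis i 1))" for B :: "complex^4^4" and y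
    by (subst caxis_expansion[of y]) (simp only: vec.sum vec.scale)
  have bexp: "bil M (B *v y) z = (\<Sum>i\<in>UNIV. y $ i * bil M (B *v axis i 1) z)" for B :: "complex^4^4" and y
    by (subst exp) (simp only: bil_sum bil_scale)
  have W: "(\<Sum>i\<in>UNIV. x $ i *s (\<Sum>j\<in>UNIV. y $ j *s W B i j))
      = bil M (B *v y) z *s (B *v x) - bil M (B *v x) z *s (B *v y)" for B x y
  proof -
    have "(\<Sum>i\<in>UNIV. x $ i *s (\<Sum>j\<in>UNIV. y $ j *s W B i j))
        = (\<Sum>i\<in>UNIV. x $ i *s (\<Sum>j\<in>UNIV. (y $ j * bil M (B *v axis j 1) z) *s (B *v axis i 1)))
        - (\<Sum>i\<in>UNIV. (x $ i * bil M (B *v axis i 1) z) *s (\<Sum>j\<in>UNIV. y $ j *s (B *v axis j 1)))"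
      by (simp add: W_def vec.scale_right_diff_distrib sum_subtractf vec.scale_sum_right mult_ac)
    also have "(\<Sum>i\<in>UNIV. x $ i *s (\<Sum>j\<in>UNIV. (y $ j * bil M (B *v axis j 1) z) *s (B *v axis i 1)))
        = (\<Sum>i\<in>UNIV. bil M (B *v y) z *s (x $ i *s (B *v axis i 1)))"
      by (simp only: vec.scale_sum_left[symmetric] bexp[symmetric]) (simp add: mult.commute)
    also have "\<dots> = bil M (B *v y) z *s (B *v x)"
      by (simp only: vec.scale_sum_right[symmetric] exp[symmetric])
    also have "(\<Sum>i\<in>UNIV. (x $ i * bil M (B *v axis i 1) z) *s (\<Sum>j\<in>UNIV. y $ j *s (B *v axis j 1)))
        = bil M (B *v x) z *s (B *v y)"
      by (simp only: vec.scale_sum_left[symmetric] bexp[symmetric] exp[symmetric])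
    finally show ?thesis .
  qed
  have "RR *v z = (\<Sum>i\<in>UNIV. u1 $ i *s (\<Sum>j\<in>UNIV. v1 $ j *s (k *s W (mat 1) i j + e *s W A i j)))"
    by (simp add: mcomb_vec gauss W_def)
  also have "\<dots> = k *s (\<Sum>i\<in>UNIV. u1 $ i *s (\<Sum>j\<in>UNIV. v1 $ j *s W (mat 1) i j))
      + e *s (\<Sum>i\<in>UNIV. u1 $ i *s (\<Sum>j\<in>UNIV. v1 $ j *s W A i j))"
    by (simp add: vec.scale_right_distrib sum.distrib vec.scale_sum_right mult_ac)
  finally show ?thesis
    unfolding W by (simp add: Au Av bil_scale vec_eq_iff algebra_simps)
qed

text \<open>
  For generalized eigenvectors \<open>w\<close>, \<open>w'\<close> paired with \<open>u1\<close>, \<open>v1\<close>, the commutator of this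
  curvature endomorphism with \<open>A\<close> is a multiple of \<open>k + e \<rho> \<sigma>\<close>.
\<close>

lemma product_of_eigenvalues:
  assumes w: "A *v w = \<rho> *s w + a *s u1" and w': "A *v w' = \<sigma> *s w' + b *s v1"
    and null: "a = 0 \<or> bil M u1 u1 = 0" "b = 0 \<or> bil M v1 v1 = 0"
    and pair: "bil M u1 w \<noteq> 0" "bil M v1 w' \<noteq> 0" "bil M v1 w = 0"
    and comm: "bil M ((RR ** A - A ** RR) *v w) w' = 0"
  shows "k + e * \<rho> * \<sigma> = 0"
proof -
  have u1v1: "bil M v1 u1 = 0" using eigenspaces_orthogonal(1) bil_commute by metis
  have au: "a *s (RR *v u1) = 0" using null(1) by (auto simp: RR_vec u1v1 vec.scale_zero_right)
  have Rw: "RR *v w = (- (k + e * \<rho> * \<sigma>) * bil M u1 w) *s v1"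
    by (simp add: RR_vec pair(3) vec_eq_iff algebra_simps)
  have "(RR ** A - A ** RR) *v w = \<rho> *s (RR *v w) + a *s (RR *v u1) - A *v (RR *v w)"
    by (simp add: matrix_vector_distribs matrix_vector_mul_assoc[symmetric] w vec.add vec.scale)
  then have "bil M ((RR ** A - A ** RR) *v w) w' = \<rho> * bil M (RR *v w) w' - bil M (RR *v w) (A *v w')"
    by (simp add: au bil_diff bil_scale A_sa)
  also have "\<dots> = (\<rho> - \<sigma>) * (- (k + e * \<rho> * \<sigma>) * bil M u1 w * bil M v1 w')"
  proof -
    have "b * bil M (RR *v w) v1 = 0" using null(2) unfolding Rw bil_scale by auto
    then have "bil M (RR *v w) (A *v w') = \<sigma> * bil M (RR *v w) w'" by (simp add: w' bil_add bil_scale)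
    moreover have "bil M (RR *v w) w' = - (k + e * \<rho> * \<sigma>) * bil M u1 w * bil M v1 w'"
      unfolding Rw bil_scale ..
    ultimately show ?thesis by (simp add: left_diff_distrib)
  qed
  finally show ?thesis using comm pair distinct by (simp add: neg_eq_iff_add_eq_0)
qed

end

end

section \<open>Constant non-real principal curvatures\<close>

lemma mpow_add: "mpow A (k + l) = mpow A k ** mpow A l"
  by (induction k) (simp_all add: matrix_mul_assoc)

lemma cmat_mpow: "cmat (mpow A k) = mpow (cmat A) k"
  by (induction k) (simp_all add: cmat_algebra)

lemma cmat_scalar: "cmat (r *\<^sub>R mat 1) *v w = of_real r *s w"
  by (simp add: vec_eq_iff matrix_vector_mult_def mat_def if_distrib[of "\<lambda>c. c * _"]
      if_distrib[of "\<lambda>c. _ * c"] if_distrib[of complex_of_real] cong: if_cong)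

lemma smooth_on_mpow:
  fixes B :: "real^'n \<Rightarrow> real^'p^'p"
  assumes "open S" "smooth_on S B"
  shows "smooth_on S (\<lambda>y. mpow (B y) k)"
  by (induction k) (auto intro!: smooth_intros assms)

lemma mD_const_scalar: "mD C i (\<lambda>_. r *\<^sub>R mat 1) x = 0"
  by (simp add: mD_def matrix_mult_scaleR)

lemma mD_cong:
  assumes "open S" "x \<in> S" "\<And>y. y \<in> S \<Longrightarrow> B y = B' y"
  shows "mD C i B x = mD C i B' x"
  unfolding mD_def using pd_cong[OF assms] assms by simp

lemma mD_mpow_Suc:
  assumes "open S" "x \<in> S" "smooth_on S B"
  shows "mD C i (\<lambda>y. mpow (B y) (Suc k)) x = mD C i B x ** mpow (B x) k + B x ** mD C i (\<lambda>y. mpow (B y) k) x"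
  unfolding mpow.simps
  by (intro mD_matmul smooth_on_differentiable[OF _ assms(2)] smooth_on_mpow assms)

text \<open>
  By the Leibniz rule the derivative of a power is a sum of products with one differentiated factor,
  and under the trace all of them agree up to cyclic permutation.
\<close>

lemma trace_mD_mpow:
  assumes "open S" "x \<in> S" "smooth_on S B"
  shows "trace (mpow (B x) l ** mD C i (\<lambda>y. mpow (B y) (Suc k)) x)
    = real (Suc k) * trace (mpow (B x) (l + k) ** mD C i B x)"
proof (induction k arbitrary: l)
  case 0
  have "mD C i (\<lambda>y. mpow (B y) 0) x = 0" using mD_const_scalar[of C i 1 x] by simp
  then show ?case using mD_mpow_Suc[OF assms, of C i 0] by simp
next
  case (Suc k)
  let ?D = "mD C i B x"
  have comm: "mpow (B x) l ** B x = B x ** mpow (B x) l" by (induction l) (simp_all add: matrix_mul_assoc[symmetric])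
  have "trace (mpow (B x) l ** mD C i (\<lambda>y. mpow (B y) (Suc (Suc k))) x)
      = trace ((mpow (B x) l ** ?D) ** mpow (B x) (Suc k))
        + trace (mpow (B x) (Suc l) ** mD C i (\<lambda>y. mpow (B y) (Suc k)) x)"
    by (subst mD_mpow_Suc[OF assms])
      (simp add: matrix_mult_distribs trace_add matrix_mul_assoc comm)
  also have "trace ((mpow (B x) l ** ?D) ** mpow (B x) (Suc k)) = trace (mpow (B x) (Suc k + l) ** ?D)"
    by (subst trace_mul_sym) (simp only: matrix_mul_assoc mpow_add)
  finally show ?case by (simp add: Suc algebra_simps del: mpow.simps)
qed

text \<open>
  A totally symmetric tensor that anticommutes with an invertible operator in one pair of arguments:
  moving that operator around all three arguments reverses the sign an odd number of times.
\<close>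

lemma anticommuting_codazzi_zero:
  fixes D :: "'n \<Rightarrow> real^'n^'n" and B M :: "real^'n^'n"
  assumes M_sym: "\<And>v w. v \<bullet> (M *v w) = w \<bullet> (M *v v)"
    and M_nd: "\<And>v. (\<And>w. v \<bullet> (M *v w) = 0) \<Longrightarrow> v = 0"
    and D_sa: "\<And>i v w. (D i *v v) \<bullet> (M *v w) = v \<bullet> (M *v (D i *v w))"
    and B_sa: "\<And>v w. (B *v v) \<bullet> (M *v w) = v \<bullet> (M *v (B *v w))"
    and codazzi: "\<And>i j. D i *v axis j 1 = D j *v axis i 1"
    and anti: "\<And>i. D i ** B + B ** D i = 0"
    and square: "B ** B = r *\<^sub>R mat 1" and r: "r \<noteq> 0"
  shows "D i = 0"
proof -
  define DD where "DD x y = (\<Sum>i\<in>UNIV. x $ i *\<^sub>R (D i *v y))" for x y :: "real^'n"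
  have DD_sym: "DD x y = DD y x" for x y
  proof -
    have "DD x y = (\<Sum>i\<in>UNIV. \<Sum>j\<in>UNIV. (x $ i * y $ j) *\<^sub>R (D i *v axis j 1))" for x y
      by (subst axis_expansion[of y])
        (simp add: DD_def matrix_vector_sum matrix_vector_scaleR scaleR_sum_right)
    from this[of x y] this[of y x] show ?thesis
      by (subst (asm) (2) sum.swap) (simp add: codazzi mult.commute)
  qed
  have DB: "D i *v (B *v y) = - (B *v (D i *v y))" for i y
  proof -
    have "(D i ** B + B ** D i) *v y = 0" by (simp add: anti)
    then show ?thesis
      by (simp add: matrix_vector_distribs matrix_vector_mul_assoc[symmetric] eq_neg_iff_add_eq_0)
  qed
  define T where "T x y z = DD x y \<bullet> (M *v z)" for x y z
  have s2: "T x y z = T y x z" for x y z by (simp add: T_def DD_sym[of x y])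
  have s3: "T x y z = T x z y" for x y z
  proof -
    have "DD x y \<bullet> (M *v z) = y \<bullet> (M *v DD x z)"
      by (simp add: DD_def inner_sum_left inner_sum_right D_sa matrix_vector_sum matrix_vector_scaleR)
    then show ?thesis using M_sym by (simp add: T_def)
  qed
  have s1: "T x (B *v y) z = - T x y (B *v z)" for x y z
  proof -
    have "DD x (B *v y) = - (B *v DD x y)"
      by (simp add: DD_def DB matrix_vector_sum matrix_vector_scaleR sum_negf)
    then show ?thesis by (simp add: T_def B_sa)
  qed
  have zero: "T x (B *v y) z = 0" for x y z
  proof -
    have "T x (B *v y) z = - T y x (B *v z)" using s1 s2 by metis
    also have "\<dots> = T y (B *v x) z" using s1 by simp
    also have "\<dots> = T z y (B *v x)" using s3 s2 by metis
    also have "\<dots> = - T z (B *v y) x" using s1 by simp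
    also have "\<dots> = - T x (B *v y) z" using s3 s2 by metis
    finally show ?thesis by simp
  qed
  have "T x y z = 0" for x y z
  proof -
    have "B *v (B *v y) = r *\<^sub>R y"
      by (simp add: matrix_vector_mul_assoc square matrix_vector_scaleR)
    then have "T x (r *\<^sub>R y) z = 0" using zero[of x "B *v y" z] by simp
    then have "r * T x y z = 0"
      by (simp add: T_def DD_def matrix_vector_scaleR inner_sum_left sum_distrib_left mult_ac)
    then show ?thesis using r by simp
  qed
  then have "DD x y = 0" for x y using M_nd[of "DD x y"] by (simp add: T_def)
  from this[of "axis i 1"] have "D i *v y = 0" for y
    by (simp add: DD_def axis_def if_distrib[of "\<lambda>c. c *\<^sub>R _"] cong: if_cong)
  then show ?thesis by (metis matrix_eq matrix_vector_mult_0)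
qed

lemma complex_linear_eqI:
  fixes f h :: "complex^'n \<Rightarrow> complex^'m"
  assumes "\<And>x y. f (x + y) = f x + f y" "\<And>c x. f (c *s x) = c *s f x"
    and "\<And>x y. h (x + y) = h x + h y" "\<And>c x. h (c *s x) = c *s h x"
    and "\<And>i. f (axis i 1) = h (axis i 1)"
  shows "f z = h z"
proof -
  have "f 0 = 0" "h 0 = 0" using assms(2)[of 0 0] assms(4)[of 0 0] by simp_all
  then have "f (\<Sum>i\<in>I. z $ i *s axis i 1) = h (\<Sum>i\<in>I. z $ i *s axis i 1)" for I
    by (induction I rule: infinite_finite_induct) (simp_all add: assms)
  from this[of UNIV] show ?thesis using caxis_expansion[of z] by simp
qed

lemma mcomb_commutator:
  assumes "\<And>i j. R i j ** A - A ** R i j = Q i j - Q j i"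
  shows "(mcomb x (\<lambda>i. mcomb y (R i)) ** A - A ** mcomb x (\<lambda>i. mcomb y (R i))) *v w
    = mcomb x (\<lambda>i. mcomb y (Q i)) *v w - mcomb y (\<lambda>i. mcomb x (Q i)) *v w"
proof -
  have "(mcomb x (\<lambda>i. mcomb y (R i)) ** A - A ** mcomb x (\<lambda>i. mcomb y (R i))) *v w
      = (\<Sum>i\<in>UNIV. x $ i *s (\<Sum>j\<in>UNIV. y $ j *s ((R i j ** A - A ** R i j) *v w)))"
    by (simp add: matrix_vector_distribs matrix_vector_mul_assoc[symmetric] mcomb_vec vec.sum vec.scale
        vec.scale_right_diff_distrib sum_subtractf)
  also have "\<dots> = mcomb x (\<lambda>i. mcomb y (Q i)) *v w
      - (\<Sum>i\<in>UNIV. x $ i *s (\<Sum>j\<in>UNIV. y $ j *s (Q j i *v w)))"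
    by (simp add: assms matrix_vector_distribs mcomb_vec vec.scale_right_diff_distrib sum_subtractf)
  also have "(\<Sum>i\<in>UNIV. x $ i *s (\<Sum>j\<in>UNIV. y $ j *s (Q j i *v w))) = mcomb y (\<lambda>i. mcomb x (Q i)) *v w"
    unfolding mcomb_vec vec.scale_sum_right vec.scale_scale
    by (subst sum.swap) (simp add: mult.commute)
  finally show ?thesis .
qed

locale hypersurface_dim4 = hypersurface_patch T G U F g \<xi> \<kappa>
  for T :: "(real^'p) set" and G and U :: "(real^4) set" and F g \<xi> \<kappa>
begin

lemma complex_gauss_equation:
  assumes x: "x \<in> U"
  shows "cmat (curv \<Gamma> i j x) *v z
    = of_real \<kappa> *s (bil (cmat (g x)) (axis j 1) z *s axis i 1 - bil (cmat (g x)) (axis i 1) z *s axis j 1)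
    + of_real (\<epsilon> x) *s (bil (cmat (g x)) (cmat (A x) *v axis j 1) z *s (cmat (A x) *v axis i 1)
        - bil (cmat (g x)) (cmat (A x) *v axis i 1) z *s (cmat (A x) *v axis j 1))"
proof (rule complex_linear_eqI[where f = "\<lambda>z. cmat (curv \<Gamma> i j x) *v z"])
  fix l :: 4
  have b: "bil (cmat (g x)) (axis m 1) (axis l 1) = of_real (ip g x (axis m 1) (axis l 1))"
    "bil (cmat (g x)) (cmat (A x) *v axis m 1) (axis l 1) = of_real (ip g x (A x *v axis m 1) (axis l 1))" for m
    by (simp_all add: cvec_axis[symmetric] cmat_cvec bil_cvec ip_def)
  have "cmat (curv \<Gamma> i j x) *v axis l 1 = cvec (curv \<Gamma> i j x *v axis l 1)"
    by (simp add: cvec_axis[symmetric] cmat_cvec)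
  also have "\<dots> = of_real \<kappa> *s (of_real (ip g x (axis j 1) (axis l 1)) *s axis i 1 - of_real (ip g x (axis i 1) (axis l 1)) *s axis j 1)
    + of_real (\<epsilon> x) *s (of_real (ip g x (A x *v axis j 1) (axis l 1)) *s (cmat (A x) *v axis i 1)
        - of_real (ip g x (A x *v axis i 1) (axis l 1)) *s (cmat (A x) *v axis j 1))"
    by (simp add: gauss_equation[OF x] cvec_algebra cvec_axis[symmetric] cmat_cvec)
  finally show "cmat (curv \<Gamma> i j x) *v axis l 1
    = of_real \<kappa> *s (bil (cmat (g x)) (axis j 1) (axis l 1) *s axis i 1 - bil (cmat (g x)) (axis i 1) (axis l 1) *s axis j 1)
    + of_real (\<epsilon> x) *s (bil (cmat (g x)) (cmat (A x) *v axis j 1) (axis l 1) *s (cmat (A x) *v axis i 1)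
        - bil (cmat (g x)) (cmat (A x) *v axis i 1) (axis l 1) *s (cmat (A x) *v axis j 1))"
    by (simp only: b)
qed (simp_all add: vec.add vec.scale bil_add bil_scale vec_eq_iff algebra_simps)

lemma A_selfadjoint_matrix: "x \<in> U \<Longrightarrow> (A x *v v) \<bullet> (g x *v w) = v \<bullet> (g x *v (A x *v w))"
  using A_selfadjoint by (simp add: ip_def)

lemma mD_A_smooth: "smooth_on U (mD \<Gamma> i A)"
  by (intro mD_smooth open_S M.lc_conn_smooth A_smooth)

lemma mD_A_selfadjoint: "x \<in> U \<Longrightarrow> ip g x (mD \<Gamma> i A x *v v) w = ip g x v (mD \<Gamma> i A x *v w)"
  by (rule M.mD_selfadjoint[OF _ A_smooth A_selfadjoint])

lemma ricci_identity:
  assumes "x \<in> U"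
  shows "mD \<Gamma> i (mD \<Gamma> j A) x - mD \<Gamma> j (mD \<Gamma> i A) x = curv \<Gamma> i j x ** A x - A x ** curv \<Gamma> i j x"
  by (rule mD_commute[OF open_S assms M.lc_conn_smooth A_smooth])

text \<open>
  The second covariant derivative. The correction by the Christoffel symbols makes it tensorial in
  \<open>j\<close> and thereby lets it inherit the Codazzi symmetry.
\<close>

definition hessA :: "4 \<Rightarrow> 4 \<Rightarrow> real^4 \<Rightarrow> real^4^4" where
  "hessA i j x = mD \<Gamma> i (mD \<Gamma> j A) x - (\<Sum>l\<in>UNIV. (\<Gamma> i x *v axis j 1) $ l *\<^sub>R mD \<Gamma> l A x)"

lemma hessA_commute:
  assumes "x \<in> U"
  shows "hessA i j x - hessA j i x = curv \<Gamma> i j x ** A x - A x ** curv \<Gamma> i j x"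
  using ricci_identity[OF assms, of i j] M.lc_conn_sym[OF assms, of i j] by (simp add: hessA_def)

lemma hessA_selfadjoint:
  assumes x: "x \<in> U"
  shows "(hessA i j x *v v) \<bullet> (g x *v w) = v \<bullet> (g x *v (hessA i j x *v w))"
proof -
  have "(mD \<Gamma> i (mD \<Gamma> j A) x *v v) \<bullet> (g x *v w) = v \<bullet> (g x *v (mD \<Gamma> i (mD \<Gamma> j A) x *v w))"
    using M.mD_selfadjoint[OF x mD_A_smooth mD_A_selfadjoint] by (simp add: ip_def)
  moreover have "(mD \<Gamma> l A x *v v) \<bullet> (g x *v w) = v \<bullet> (g x *v (mD \<Gamma> l A x *v w))" for l
    using mD_A_selfadjoint[OF x] by (simp add: ip_def)
  ultimately show ?thesis
    by (simp add: hessA_def matrix_vector_distribs matrix_vector_sum matrix_vector_scaleR inner_simps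
        inner_sum_left inner_sum_right)
qed

lemma hessA_codazzi:
  assumes x: "x \<in> U"
  shows "hessA i j x *v axis k 1 = hessA i k x *v axis j 1"
proof -
  have 1: "mD \<Gamma> i (mD \<Gamma> j A) x *v axis k 1 = vD \<Gamma> i (\<lambda>y. mD \<Gamma> j A y *v axis k 1) x - mD \<Gamma> j A x *v (\<Gamma> i x *v axis k 1)" for j k
    using smooth_on_differentiable[OF mD_A_smooth x] by (simp add: vD_matvec vD_const)
  have 2: "mD \<Gamma> j A x *v v = (\<Sum>l\<in>UNIV. v $ l *\<^sub>R (mD \<Gamma> l A x *v axis j 1))" for j v
    by (subst axis_expansion[of v]) (simp add: matrix_vector_sum matrix_vector_scaleR codazzi[OF x, of j])
  have "vD \<Gamma> i (\<lambda>y. mD \<Gamma> j A y *v axis k 1) x = vD \<Gamma> i (\<lambda>y. mD \<Gamma> k A y *v axis j 1) x"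
    by (rule vD_cong[OF open_S x codazzi])
  moreover have "hessA i j x *v axis k 1 = vD \<Gamma> i (\<lambda>y. mD \<Gamma> j A y *v axis k 1) x
      - mD \<Gamma> j A x *v (\<Gamma> i x *v axis k 1) - mD \<Gamma> k A x *v (\<Gamma> i x *v axis j 1)" for j k
    unfolding hessA_def matrix_vector_distribs 1 2[of k "\<Gamma> i x *v axis j 1"]
    by (simp add: matrix_vector_sum matrix_vector_scaleR)
  ultimately show ?thesis by simp
qed

text \<open>
  From here on the two conjugate principal curvatures are constant; the Jordan type may vary.
\<close>

context
  fixes \<rho> :: complex
  assumes \<rho>: "Im \<rho> > 0"
    and spectral: "\<And>y. y \<in> U \<Longrightarrow> \<exists>\<eta> u1 u2.
      two_double_eigenvalues (cmat (g y)) (cmat (A y)) \<rho> (cnj \<rho>) \<eta> \<eta> u1 u2 (cnjv u1) (cnjv u2) \<and>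
      (\<eta> = 0 \<or> \<eta> = 1 \<and> bil (cmat (g y)) u1 u1 = 0 \<and> bil (cmat (g y)) u2 u2 = 0)"
begin

lemma trace_mpow_constant:
  assumes "y \<in> U"
  shows "complex_of_real (trace (mpow (A y) k)) = 2 * \<rho>^k + 2 * cnj \<rho>^k"
  using spectral[OF assms] two_double_eigenvalues.trace_mpow
  unfolding trace_cmat[symmetric] cmat_mpow by blast

text \<open>
  The function \<open>tr A\<^sup>k\<^sup>+\<^sup>1\<close> is constant, as it is determined by the eigenvalues.
\<close>

lemma first_trace:
  assumes y: "y \<in> U"
  shows "trace (mpow (A y) k ** mD \<Gamma> i A y) = 0"
proof -
  have "trace (mpow (A z) (Suc k)) = trace (mpow (A y) (Suc k))" if "z \<in> U" for z
    using trace_mpow_constant[OF that, of "Suc k"] trace_mpow_constant[OF y, of "Suc k"]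
    by (metis of_real_eq_iff)
  then have "pd i (\<lambda>z. trace (mpow (A z) (Suc k))) y = pd i (\<lambda>_. trace (mpow (A y) (Suc k))) y"
    by (intro pd_cong[OF open_S y])
  then have "trace (mD \<Gamma> i (\<lambda>z. mpow (A z) (Suc k)) y) = 0"
    using pd_trace_mD[OF smooth_on_differentiable[OF smooth_on_mpow[OF open_S A_smooth, of "Suc k"] y], of i \<Gamma>]
    by simp
  then have "real (Suc k) * trace (mpow (A y) k ** mD \<Gamma> i A y) = 0"
    using trace_mD_mpow[OF open_S y A_smooth, of 0 \<Gamma> i k] by simp
  then show ?thesis by simp
qed

lemma second_trace:
  assumes x: "x \<in> U"
  shows "trace (mD \<Gamma> i (\<lambda>y. mpow (A y) k) x ** mD \<Gamma> j A x) + trace (mpow (A x) k ** hessA i j x) = 0"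
proof -
  note d = smooth_on_differentiable[OF _ x]
  have "pd i (\<lambda>y. trace (mpow (A y) k ** mD \<Gamma> j A y)) x = pd i (\<lambda>_. 0) x"
    by (rule pd_cong[OF open_S x first_trace])
  moreover have "pd i (\<lambda>y. trace (mpow (A y) k ** mD \<Gamma> j A y)) x
      = trace (mD \<Gamma> i (\<lambda>y. mpow (A y) k ** mD \<Gamma> j A y) x)"
    by (intro pd_trace_mD d smooth_on_matmul open_S smooth_on_mpow A_smooth mD_A_smooth)
  moreover have "mD \<Gamma> i (\<lambda>y. mpow (A y) k ** mD \<Gamma> j A y) x
      = mD \<Gamma> i (\<lambda>y. mpow (A y) k) x ** mD \<Gamma> j A x + mpow (A x) k ** mD \<Gamma> i (mD \<Gamma> j A) x"
    by (intro mD_matmul d smooth_on_mpow open_S A_smooth mD_A_smooth)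
  moreover have "trace (mpow (A x) k ** (\<Sum>l\<in>UNIV. (\<Gamma> i x *v axis j 1) $ l *\<^sub>R mD \<Gamma> l A x)) = 0"
    by (simp add: matrix_mult_sum matrix_mult_scaleR first_trace[OF x]
        linear_sum[OF bounded_linear.linear[OF bounded_linear_trace]]
        linear_scale[OF bounded_linear.linear[OF bounded_linear_trace]])
  ultimately show ?thesis by (simp add: hessA_def matrix_mult_distribs trace_add trace_sub)
qed

text \<open>
  By the Ricci identity the antisymmetric part of the second derivative is \<open>[R(u1, v1), A]\<close>. Its component
  on \<open>u2, v2\<close> vanishes by \<open>QQ_commutator\<close> and is a multiple of \<open>\<kappa> + \<epsilon> \<bar>\<rho>\<bar>\<^sup>2\<close> by the Gauss equation.
\<close>

lemma jordan_case:
  assumes x: "x \<in> U"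
    and two: "two_double_eigenvalues (cmat (g x)) (cmat (A x)) \<rho> (cnj \<rho>) 1 1 u1 u2 (cnjv u1) (cnjv u2)"
    and null: "bil (cmat (g x)) u1 u1 = 0" "bil (cmat (g x)) u2 u2 = 0"
  shows "of_real \<kappa> + of_real (\<epsilon> x) * \<rho> * cnj \<rho> = (0 :: complex)"
proof -
  let ?M = "cmat (g x)" and ?A = "cmat (A x)"
  let ?D = "\<lambda>i. cmat (mD \<Gamma> i A x)" and ?Q = "\<lambda>i j. cmat (hessA i j x)"
  let ?E = "\<lambda>i k. cmat (mD \<Gamma> i (\<lambda>y. mpow (A y) k) x)"
  let ?R = "\<lambda>i j. cmat (curv \<Gamma> i j x)"
  interpret two_double_eigenvalues ?M ?A \<rho> "cnj \<rho>" 1 1 u1 u2 "cnjv u1" "cnjv u2" by (rule two)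
  interpret J: jordan_second_order ?M ?A \<rho> "cnj \<rho>" u1 u2 "cnjv u1" "cnjv u2" ?D ?Q ?E
  proof
    show "bil ?M u1 u1 = 0" "bil ?M u2 u2 = 0" by (rule null)+
    show "bil ?M (cnjv u1) (cnjv u1) = 0" "bil ?M (cnjv u2) (cnjv u2) = 0" by (simp_all add: bil_cnjv null)
    show "bil ?M (?D i *v v) w = bil ?M v (?D i *v w)" for i v w
      using mD_A_selfadjoint[OF x] by (intro bil_selfadjoint_cmat) (simp add: ip_def)
    show "?D i *v axis j 1 = ?D j *v axis i 1" for i j
      using codazzi[OF x, of i j] by (simp add: cvec_axis[symmetric] cmat_cvec)
    show "trace (mpow ?A k ** ?D i) = 0" for k i
      using first_trace[OF x, of k i] by (simp add: cmat_mpow[symmetric] cmat_algebra[symmetric] trace_cmat)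
    show "bil ?M (?Q i j *v v) w = bil ?M v (?Q i j *v w)" for i j v w
      by (rule bil_selfadjoint_cmat[OF hessA_selfadjoint[OF x]])
    show "?Q i j *v axis l 1 = ?Q i l *v axis j 1" for i j l
      using hessA_codazzi[OF x, of i j l] by (simp add: cvec_axis[symmetric] cmat_cvec)
    show "?E i 0 = 0" for i using mD_const_scalar[of \<Gamma> i 1 x] by (simp add: cmat_algebra)
    show "?E i (Suc m) = ?D i ** mpow ?A m + ?A ** ?E i m" for i m
      unfolding mD_mpow_Suc[OF open_S x A_smooth] by (simp only: cmat_algebra cmat_mpow)
    show "trace (?E i k ** ?D j) + trace (mpow ?A k ** ?Q i j) = 0" for i j k
      using second_trace[OF x, of i k j]
      by (simp only: cmat_mpow[symmetric] cmat_algebra[symmetric] trace_cmat of_real_add[symmetric]) simp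
  qed
  have "?R i j ** ?A - ?A ** ?R i j = ?Q i j - ?Q j i" for i j
    by (simp only: cmat_algebra[symmetric] hessA_commute[OF x])
  from mcomb_commutator[where R = ?R, OF this]
  have "bil ?M ((mcomb u1 (\<lambda>i. mcomb (cnjv u1) (?R i)) ** ?A - ?A ** mcomb u1 (\<lambda>i. mcomb (cnjv u1) (?R i))) *v u2) (cnjv u2) = 0"
    by (simp only: bil_diff J.QQ_commutator diff_zero)
  moreover have "bil ?M (cnjv u1) u2 = 0" using eigenspaces_orthogonal(3) bil_commute by metis
  ultimately show ?thesis
    using null J.pairing_nonzero
    by (intro product_of_eigenvalues[where R = ?R and w = u2 and w' = "cnjv u2" and a = 1 and b = 1])
      (simp_all add: complex_gauss_equation[OF x] Au Av bil_cnjv)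
qed

text \<open>
  The operator \<open>B = A - Re \<rho>\<close> squares to a constant, so its derivative anticommutes with it and vanishes by
  the Codazzi symmetry. Thus \<open>A\<close> is parallel and commutes with the curvature.
\<close>

lemma diagonalizable_case:
  assumes x: "x \<in> U"
    and two: "\<And>y. y \<in> U \<Longrightarrow> \<exists>u1 u2.
      two_double_eigenvalues (cmat (g y)) (cmat (A y)) \<rho> (cnj \<rho>) 0 0 u1 u2 (cnjv u1) (cnjv u2)"
  shows "of_real \<kappa> + of_real (\<epsilon> x) * \<rho> * cnj \<rho> = (0 :: complex)"
proof -
  define B where "B y = A y - Re \<rho> *\<^sub>R mat 1" for y
  have square: "B y ** B y = (- (Im \<rho>)\<^sup>2) *\<^sub>R mat 1" if y: "y \<in> U" for y
  proof -
    obtain u1 u2 where "two_double_eigenvalues (cmat (g y)) (cmat (A y)) \<rho> (cnj \<rho>) 0 0 u1 u2 (cnjv u1) (cnjv u2)"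
      using two[OF y] by blast
    then interpret two_double_eigenvalues "cmat (g y)" "cmat (A y)" \<rho> "cnj \<rho>" 0 0 u1 u2 "cnjv u1" "cnjv u2" .
    have B: "cmat (B y) *v w = cmat (A y) *v w - of_real (Re \<rho>) *s w" for w
    proof -
      have "cmat (B y) = cmat (A y) - cmat (Re \<rho> *\<^sub>R mat 1)" by (simp add: B_def cmat_algebra)
      then show ?thesis by (simp only: matrix_vector_distribs cmat_scalar)
    qed
    have \<rho>': "\<rho> - of_real (Re \<rho>) = \<i> * of_real (Im \<rho>)" "cnj \<rho> - of_real (Re \<rho>) = - (\<i> * of_real (Im \<rho>))"
      by (simp_all add: complex_eq_iff)
    have eig: "cmat (B y) *v (cmat (B y) *v v) = of_real (- (Im \<rho>)\<^sup>2) *s v"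
      if "cmat (A y) *v v = \<mu> *s v" "\<mu> = \<rho> \<or> \<mu> = cnj \<rho>" for v \<mu>
    proof -
      have Bv: "cmat (B y) *v v = (\<mu> - of_real (Re \<rho>)) *s v" by (simp add: B that(1) vec.scale_left_diff_distrib)
      have "cmat (B y) *v (cmat (B y) *v v) = ((\<mu> - of_real (Re \<rho>)) * (\<mu> - of_real (Re \<rho>))) *s v"
        by (simp only: Bv vec.scale vec.scale_scale)
      also have "(\<mu> - of_real (Re \<rho>)) * (\<mu> - of_real (Re \<rho>)) = of_real (- (Im \<rho>)\<^sup>2)"
        using that(2) by (auto simp: \<rho>' power2_eq_square complex_eq_iff)
      finally show ?thesis .
    qed
    have "cmat (B y) *v (cmat (B y) *v w) = of_real (- (Im \<rho>)\<^sup>2) *s w" for w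
    proof -
      obtain a b c d where w: "w = a *s u1 + b *s u2 + (c *s cnjv u1 + d *s cnjv u2)" by (rule basis_expansion)
      have "cmat (A y) *v u1 = \<rho> *s u1" "cmat (A y) *v u2 = \<rho> *s u2"
        "cmat (A y) *v cnjv u1 = cnj \<rho> *s cnjv u1" "cmat (A y) *v cnjv u2 = cnj \<rho> *s cnjv u2"
        using Au Av by simp_all
      note e = this[THEN eig]
      show ?thesis
        unfolding w vec.add vec.scale by (simp only: e simp_thms vec.scale_right_distrib) (simp add: mult.commute)
    qed
    then have "cmat (B y ** B y) *v w = cmat ((- (Im \<rho>)\<^sup>2) *\<^sub>R mat 1) *v w" for w
      by (simp only: cmat_algebra(1) matrix_vector_mul_assoc[symmetric] cmat_scalar)
    then show ?thesis using matrix_eq_vec cmat_inj by blast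
  qed
  have B_smooth: "smooth_on U B" unfolding B_def by (intro smooth_intros open_S A_smooth)
  have DB: "mD \<Gamma> i B y = mD \<Gamma> i A y" if "y \<in> U" for i y
  proof -
    have "mD \<Gamma> i B y = mD \<Gamma> i A y - mD \<Gamma> i (\<lambda>_. Re \<rho> *\<^sub>R mat 1) y"
      unfolding B_def[abs_def] mD_def
      using smooth_on_differentiable[OF A_smooth that]
      by (simp add: pd_diff matrix_mult_distribs algebra_simps)
    then show ?thesis by (simp add: mD_const_scalar)
  qed
  have parallel: "mD \<Gamma> i A y = 0" if y: "y \<in> U" for i y
  proof (rule anticommuting_codazzi_zero[where M = "g y" and B = "B y" and r = "- (Im \<rho>)\<^sup>2"])
    show "v \<bullet> (g y *v w) = w \<bullet> (g y *v v)" for v w using M.ip_commute[OF y] by (simp add: ip_def)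
    show "v = 0" if "\<And>w. v \<bullet> (g y *v w) = 0" for v
      using that by (intro M.ip_nondegenerate[OF y]) (simp add: ip_def)
    show "(mD \<Gamma> i A y *v v) \<bullet> (g y *v w) = v \<bullet> (g y *v (mD \<Gamma> i A y *v w))" for i v w
      using mD_A_selfadjoint[OF y] by (simp add: ip_def)
    show "(B y *v v) \<bullet> (g y *v w) = v \<bullet> (g y *v (B y *v w))" for v w
      using A_selfadjoint_matrix[OF y]
      by (simp add: B_def matrix_vector_distribs matrix_vector_scaleR inner_simps)
    show "mD \<Gamma> i A y *v axis j 1 = mD \<Gamma> j A y *v axis i 1" for i j by (rule codazzi[OF y])
    show "mD \<Gamma> i A y ** B y + B y ** mD \<Gamma> i A y = 0" for i
    proof -
      have "mD \<Gamma> i (\<lambda>y. B y ** B y) y = mD \<Gamma> i (\<lambda>_. (- (Im \<rho>)\<^sup>2) *\<^sub>R mat 1) y"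
        by (rule mD_cong[OF open_S y square])
      then have "mD \<Gamma> i (\<lambda>y. B y ** B y) y = 0" by (simp only: mD_const_scalar)
      then show ?thesis
        using smooth_on_differentiable[OF B_smooth y] by (simp add: mD_matmul DB[OF y])
    qed
    show "B y ** B y = (- (Im \<rho>)\<^sup>2) *\<^sub>R mat 1" by (rule square[OF y])
    show "- (Im \<rho>)\<^sup>2 \<noteq> 0" using \<rho> by simp
  qed
  let ?M = "cmat (g x)" and ?A = "cmat (A x)" and ?R = "\<lambda>i j. cmat (curv \<Gamma> i j x)"
  have "mD \<Gamma> i (mD \<Gamma> j A) x = 0" for i j
  proof -
    have "mD \<Gamma> i (mD \<Gamma> j A) x = mD \<Gamma> i (\<lambda>_. 0 *\<^sub>R mat 1) x"
      by (rule mD_cong[OF open_S x]) (simp add: parallel)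
    then show ?thesis by (simp only: mD_const_scalar)
  qed
  then have comm: "?R i j ** ?A - ?A ** ?R i j = 0 - 0" for i j
    using ricci_identity[OF x, of i j] by (simp add: cmat_algebra[symmetric])
  obtain u1 u2 where "two_double_eigenvalues ?M ?A \<rho> (cnj \<rho>) 0 0 u1 u2 (cnjv u1) (cnjv u2)"
    using two[OF x] by blast
  then interpret two_double_eigenvalues ?M ?A \<rho> "cnj \<rho>" 0 0 u1 u2 "cnjv u1" "cnjv u2" .
  have orth: "bil ?M (cnjv u1) u1 = 0" "bil ?M (cnjv u1) u2 = 0"
    using eigenspaces_orthogonal bil_commute by metis+
  obtain w where w: "w = u1 \<or> w = u2" "bil ?M u1 w \<noteq> 0"
    using nondegenerate_on_eigenspace by blast
  have "bil ?M ((mcomb u1 (\<lambda>i. mcomb (cnjv u1) (?R i)) ** ?A - ?A ** mcomb u1 (\<lambda>i. mcomb (cnjv u1) (?R i))) *v w) (cnjv w) = 0"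
    using mcomb_commutator[where R = ?R and Q = "\<lambda>i j. 0", OF comm]
    by (simp only: mcomb_vec) (simp add: bil_zero)
  moreover have "?A *v w = \<rho> *s w" using w(1) Au by auto
  moreover have "?A *v cnjv w = cnj \<rho> *s cnjv w" using w(1) Av by auto
  moreover have "bil ?M (cnjv u1) w = 0" using w(1) orth by auto
  ultimately show ?thesis
    using w(2)
    by (intro product_of_eigenvalues[where R = ?R and w = w and w' = "cnjv w" and a = 0 and b = 0])
      (simp_all add: complex_gauss_equation[OF x] bil_cnjv)
qed

text \<open>
  Either some point has a nondiagonalizable shape operator, or the shape operator is
  diagonalizable on all of the open set, and can be differentiated as such.
\<close>

theorem constant_double_eigenvalues:
  assumes "U \<noteq> {}"
  shows "\<exists>x\<in>U. \<kappa> + \<epsilon> x * ((Re \<rho>)\<^sup>2 + (Im \<rho>)\<^sup>2) = 0"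
proof -
  have "\<exists>x\<in>U. of_real \<kappa> + of_real (\<epsilon> x) * \<rho> * cnj \<rho> = (0 :: complex)"
  proof (cases "\<exists>x\<in>U. \<exists>u1 u2. two_double_eigenvalues (cmat (g x)) (cmat (A x)) \<rho> (cnj \<rho>) 1 1 u1 u2 (cnjv u1) (cnjv u2)
      \<and> bil (cmat (g x)) u1 u1 = 0 \<and> bil (cmat (g x)) u2 u2 = 0")
    case True
    then show ?thesis using jordan_case by blast
  next
    case False
    then have "\<exists>u1 u2. two_double_eigenvalues (cmat (g y)) (cmat (A y)) \<rho> (cnj \<rho>) 0 0 u1 u2 (cnjv u1) (cnjv u2)"
      if "y \<in> U" for y
      using spectral[OF that] that by metis
    then show ?thesis using diagonalizable_case assms by blast
  qed
  then obtain x where x: "x \<in> U" "of_real \<kappa> + of_real (\<epsilon> x) * \<rho> * cnj \<rho> = (0 :: complex)" by blast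
  have eq: "of_real (\<kappa> + \<epsilon> x * ((Re \<rho>)\<^sup>2 + (Im \<rho>)\<^sup>2)) = of_real \<kappa> + of_real (\<epsilon> x) * (\<rho> * cnj \<rho>)"
    by (simp add: complex_mult_cnj)
  have "of_real (\<kappa> + \<epsilon> x * ((Re \<rho>)\<^sup>2 + (Im \<rho>)\<^sup>2)) = (0 :: complex)"
    unfolding eq using x(2) by (simp only: mult.assoc)
  then show ?thesis using x(1) of_real_eq_0_iff by blast
qed

end

end

section \<open>Biharmonic hypersurfaces\<close>

lemma vanishing_pd_constant:
  fixes f :: "real^'n \<Rightarrow> real"
  assumes f: "smooth_on (ball x r) f" and pd: "\<And>y k. y \<in> ball x r \<Longrightarrow> pd k f y = 0"
    and y: "y \<in> ball x r"
  shows "f y = f x"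
proof -
  have "(f has_derivative (\<lambda>h. 0)) (at z within ball x r)" if z: "z \<in> ball x r" for z
  proof -
    have d: "f differentiable (at z)" by (rule smooth_on_differentiable[OF f z])
    then have "frechet_derivative f (at z) = (\<lambda>h. 0)"
      by (simp add: fun_eq_iff frechet_derivative_pd pd[OF z])
    then show ?thesis
      using d frechet_derivative_works has_derivative_at_withinI by metis
  qed
  then obtain c where c: "\<And>z. z \<in> ball x r \<Longrightarrow> f z = c"
    using has_derivative_zero_constant[OF convex_ball] by blast
  have "x \<in> ball x r" using y by (metis centre_in_ball ball_eq_empty empty_iff not_le)
  then show ?thesis using c y by metis
qed

locale hypersurface_4_in_5 = hypersurface_dim4 T G U F g \<xi> \<kappa>
  for T :: "(real^5) set" and G and U :: "(real^4) set" and F g \<xi> \<kappa>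
begin

text \<open>
  The Weingarten formula is the defining property of the shape operator, and \<open>dF\<close> is injective.
\<close>

lemma shape_operator_A:
  assumes x: "x \<in> U"
  shows "shape_operator G F \<xi> x = A x"
  unfolding shape_operator_def
proof (rule the_equality)
  note d = smooth_on_differentiable[OF _ x]
  have cov: "cov_along G F (\<lambda>_. v) \<xi> x = - tang x (A x *v v)" for v
  proof -
    have "along C v (\<lambda>x. 1 *\<^sub>R \<xi> x) x = dirD v (\<lambda>_. 1) x *\<^sub>R \<xi> x - 1 *\<^sub>R tang x (A x *v v)"
      by (rule along_normal_field[OF x smooth_on_const])
    then show ?thesis
      by (simp add: cov_along_vD d F_smooth \<xi>_smooth along_def dirD_def)
  qed
  then show "\<forall>v. cov_along G F (\<lambda>_. v) \<xi> x = - tang x (A x *v v)" by blast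
  fix B :: "real^4^4"
  assume "\<forall>v. cov_along G F (\<lambda>_. v) \<xi> x = - tang x (B *v v)"
  then have "tang x (B *v v) = tang x (A x *v v)" for v using cov by (metis minus_minus)
  then have "B *v v = A x *v v" for v using tang_normal_unique(1)[OF x, of _ 0 _ 0] by simp
  then show "B = A x" by (simp add: matrix_eq)
qed

lemma mean_curvature_A: "x \<in> U \<Longrightarrow> mean_curvature G F \<xi> x = (1/4) * \<epsilon> x * trace (A x)"
  by (simp add: mean_curvature_def shape_operator_A)

lemma mean_curvature_smooth: "smooth_on U (mean_curvature G F \<xi>)"
proof -
  have "smooth_on U (\<lambda>x. (1/4) * \<epsilon> x * trace (A x))"
    unfolding ip_def by (intro smooth_intros open_S \<xi>_smooth G_F_smooth A_smooth)
  then show ?thesis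
    using smooth_on_cong[OF open_S, of "mean_curvature G F \<xi>" "\<lambda>x. (1/4) * \<epsilon> x * trace (A x)"]
      mean_curvature_A by blast
qed

lemma cov_along_eq_along:
  "x \<in> U \<Longrightarrow> V differentiable (at x) \<Longrightarrow> cov_along G F X V x = along C (X x) V x"
  using smooth_on_differentiable[OF F_smooth] by (simp add: cov_along_vD along_def)

lemma frame_laplacian_along:
  assumes x: "x \<in> U" and e: "\<And>i. smooth_on U (e i)" and \<phi>: "smooth_on U \<phi>"
  shows "frame_laplacian g G F e (\<lambda>x. \<phi> x *\<^sub>R \<xi> x) x
    = - (\<Sum>i\<in>UNIV. ip g x (e i x) (e i x) *\<^sub>R
        (along C (e i x) (\<lambda>y. along C (e i y) (\<lambda>x. \<phi> x *\<^sub>R \<xi> x) y) x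
          - along C (along \<Gamma> (e i x) (e i) x) (\<lambda>x. \<phi> x *\<^sub>R \<xi> x) x))"
proof -
  let ?V = "\<lambda>x. \<phi> x *\<^sub>R \<xi> x"
  have V: "smooth_on U ?V" by (intro smooth_intros open_S \<phi> \<xi>_smooth)
  note d = smooth_on_differentiable
  have 1: "cov_along G F (e i) ?V y = along C (e i y) ?V y" if "y \<in> U" for i y
    using that d[OF V] by (simp add: cov_along_eq_along)
  have sm: "smooth_on U (\<lambda>y. along C (e i y) ?V y)" for i
    unfolding along_def by (intro smooth_intros vD_smooth open_S e C_smooth V)
  have 2: "cov_along G F (e i) (cov_along G F (e i) ?V) x = along C (e i x) (\<lambda>y. along C (e i y) ?V y) x" for i
  proof -
    have "cov_along G F (e i) ?V differentiable (at x)"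
      using d[OF sm x] by (subst differentiable_cong_open[OF open_S x 1])
    then have "cov_along G F (e i) (cov_along G F (e i) ?V) x = along C (e i x) (cov_along G F (e i) ?V) x"
      by (rule cov_along_eq_along[OF x])
    also have "\<dots> = along C (e i x) (\<lambda>y. along C (e i y) ?V y) x"
      by (rule along_cong[OF x 1])
    finally show ?thesis .
  qed
  have 3: "levi_civita g (e i) (e i) x = along \<Gamma> (e i x) (e i) x" for i
    using d[OF e x] by (simp add: levi_civita_def cov_along_vD pull_conn_ident along_def)
  have 4: "cov_along G F (levi_civita g (e i) (e i)) ?V x = along C (along \<Gamma> (e i x) (e i) x) ?V x" for i
    using cov_along_eq_along[OF x d[OF V x]] by (simp add: 3)
  show ?thesis by (simp add: frame_laplacian_def 2 4)
qed

text \<open>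
  Where the frame is defined, the Laplacian is the frame expression analysed above, with \<open>\<phi> = H\<close> and
  \<open>H = \<epsilon> tr A / 4\<close>.
\<close>

lemma biharmonic_consequences:
  assumes x: "x \<in> U"
    and lap: "has_laplacian g G F (mean_curvature_vector G F \<xi>) x ((4 * \<kappa>) *\<^sub>R mean_curvature_vector G F \<xi> x)"
  shows "(\<And>v \<mu>. A x *v v = \<mu> *\<^sub>R v \<Longrightarrow> v = 0) \<Longrightarrow> pd k (mean_curvature G F \<xi>) x = 0"
    and "(\<And>y k. y \<in> U \<Longrightarrow> pd k (mean_curvature G F \<xi>) y = 0) \<Longrightarrow>
      mean_curvature G F \<xi> x * \<epsilon> x * trace (A x ** A x) = 4 * \<kappa> * mean_curvature G F \<xi> x"
proof -
  let ?H = "mean_curvature G F \<xi>"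
  obtain U' e where U': "open U'" "x \<in> U'" and e: "orthonormal_frame g U' e"
    and eq: "frame_laplacian g G F e (mean_curvature_vector G F \<xi>) x = (4 * \<kappa>) *\<^sub>R mean_curvature_vector G F \<xi> x"
    using lap unfolding has_laplacian_def by blast
  define W where "W = U \<inter> U'"
  have W: "open W" "W \<subseteq> U" "x \<in> W" "W \<subseteq> U'" using open_S U' x by (auto simp: W_def)
  interpret W: hypersurface_patch T G W F g \<xi> \<kappa> by (rule restrict_patch[OF W(1,2)])
  interpret W: hypersurface_dim4 T G W F g \<xi> \<kappa> by unfold_locales
  interpret W: hypersurface_4_in_5 T G W F g \<xi> \<kappa> by unfold_locales
  have e_smooth: "smooth_on W (e i)" for i
    using e W(4) smooth_on_subset unfolding orthonormal_frame_def by blast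
  have orth: "if i = j then ip g y (e i y) (e j y) \<in> {1, -1} else ip g y (e i y) (e j y) = 0"
    if "y \<in> W" for y i j
    using e W(4) that unfolding orthonormal_frame_def by blast
  have mcv: "mean_curvature_vector G F \<xi> = (\<lambda>x. ?H x *\<^sub>R \<xi> x)"
    by (simp add: fun_eq_iff mean_curvature_vector_def)
  have L: "- (\<Sum>i\<in>UNIV. ip g x (e i x) (e i x) *\<^sub>R
        (along C (e i x) (\<lambda>y. along C (e i y) (\<lambda>x. ?H x *\<^sub>R \<xi> x) y) x
          - along C (along \<Gamma> (e i x) (e i) x) (\<lambda>x. ?H x *\<^sub>R \<xi> x) x)) = (4 * \<kappa> * ?H x) *\<^sub>R \<xi> x"
    using eq W.frame_laplacian_along[OF W(3) e_smooth W.mean_curvature_smooth] unfolding mcv by simp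
  have quarter: "(1/4 :: real) \<noteq> 0" by simp
  show "pd k ?H x = 0" if "\<And>v \<mu>. A x *v v = \<mu> *\<^sub>R v \<Longrightarrow> v = 0"
    by (rule W.gradient_zero[OF e_smooth orth quarter W.mean_curvature_A W(3) L that])
  show "?H x * \<epsilon> x * trace (A x ** A x) = 4 * \<kappa> * ?H x" if "\<And>y k. y \<in> U \<Longrightarrow> pd k ?H y = 0"
    by (rule W.normal_part[OF e_smooth orth quarter W.mean_curvature_A W(3) L]) (use that W(2) in auto)
qed

text \<open>
  A point with nonzero mean curvature has a ball around it on which the mean curvature, hence
  \<open>tr A\<close>, \<open>tr A\<^sup>2\<close> and the two principal curvatures \<open>a \<plusminus> ib\<close> are constant. There the normal part of the
  equation reads \<open>\<epsilon> (a\<^sup>2 - b\<^sup>2) = \<kappa>\<close>, while constancy forces \<open>\<epsilon> (a\<^sup>2 + b\<^sup>2) = - \<kappa>\<close>, so \<open>a = 0\<close>.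
\<close>

theorem biharmonic_two_nonreal_minimal:
  assumes x: "x \<in> U"
    and lap: "\<And>x. x \<in> U \<Longrightarrow>
      has_laplacian g G F (mean_curvature_vector G F \<xi>) x ((4 * \<kappa>) *\<^sub>R mean_curvature_vector G F \<xi> x)"
    and card: "\<And>x. x \<in> U \<Longrightarrow> card (principal_curvatures G F \<xi> x) = 2"
    and nonreal: "\<And>x \<mu>. x \<in> U \<Longrightarrow> \<mu> \<in> principal_curvatures G F \<xi> x \<Longrightarrow> Im \<mu> \<noteq> 0"
  shows "mean_curvature G F \<xi> x = 0"
proof (rule ccontr)
  let ?H = "mean_curvature G F \<xi>"
  assume Hx: "?H x \<noteq> 0"
  have pc: "principal_curvatures G F \<xi> y = {\<mu>. \<exists>v. v \<noteq> 0 \<and> cmat (A y) *v v = \<mu> *s v}" if "y \<in> U" for y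
    by (simp add: principal_curvatures_def shape_operator_A[OF that])
  have no_real: "v = 0" if y: "y \<in> U" and "A y *v v = \<mu> *\<^sub>R v" for y v \<mu>
  proof (rule ccontr)
    assume "v \<noteq> 0"
    then have "cvec v \<noteq> 0" using cvec_algebra(4,5) by metis
    moreover have "cmat (A y) *v cvec v = of_real \<mu> *s cvec v"
      by (simp add: cmat_cvec that(2) cvec_algebra)
    ultimately have "of_real \<mu> \<in> principal_curvatures G F \<xi> y"
      unfolding pc[OF y] by (intro CollectI exI[of _ "cvec v"] conjI)
    then show False using nonreal[OF y] by fastforce
  qed
  have pdH: "pd k ?H y = 0" if "y \<in> U" for y k
    by (rule biharmonic_consequences(1)[OF that lap[OF that] no_real[OF that]])
  obtain r where r: "r > 0" "ball x r \<subseteq> U" using open_S x open_contains_ball by blast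
  define W where "W = ball x r"
  have W: "open W" "W \<subseteq> U" "x \<in> W" "\<And>y. y \<in> W \<Longrightarrow> y \<in> U" using r by (auto simp: W_def)
  have H_const: "?H y = ?H x" if "y \<in> W" for y
    using that W(4) pdH smooth_on_subset[OF mean_curvature_smooth W(2)] unfolding W_def
    by (intro vanishing_pd_constant[where x = x and r = r]) auto
  have \<epsilon>_const: "\<epsilon> y = \<epsilon> x" if "y \<in> W" for y
  proof -
    have "smooth_on U \<epsilon>" unfolding ip_def by (intro smooth_intros open_S \<xi>_smooth G_F_smooth)
    then show ?thesis
      using that W(4) vD_normal_orthogonal(1) smooth_on_subset[OF _ W(2)] unfolding W_def
      by (intro vanishing_pd_constant[where x = x and r = r]) auto
  qed
  have tr1: "trace (A y) = 4 * \<epsilon> x * ?H x" if "y \<in> W" for y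
  proof -
    have "4 * \<epsilon> x * ?H x = (\<epsilon> x * \<epsilon> x) * trace (A y)"
      using mean_curvature_A[OF W(4)[OF that]] H_const[OF that] \<epsilon>_const[OF that] by simp
    then show ?thesis by (simp add: \<epsilon>_square[OF x])
  qed
  have tr2: "trace (A y ** A y) = 4 * \<epsilon> x * \<kappa>" if "y \<in> W" for y
  proof -
    have "?H y * \<epsilon> y * trace (A y ** A y) = 4 * \<kappa> * ?H y"
      by (rule biharmonic_consequences(2)[OF W(4)[OF that] lap[OF W(4)[OF that]] pdH])
    then have "\<epsilon> x * trace (A y ** A y) = 4 * \<kappa>"
      using Hx H_const[OF that] \<epsilon>_const[OF that] by simp
    then have "(\<epsilon> x * \<epsilon> x) * trace (A y ** A y) = \<epsilon> x * (4 * \<kappa>)" by (simp add: mult.assoc)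
    then show ?thesis using \<epsilon>_square[OF x] by (simp add: mult_ac)
  qed
  let ?good = "\<lambda>y \<rho>. Im \<rho> > 0 \<and> (\<exists>\<eta> u1 u2.
      two_double_eigenvalues (cmat (g y)) (cmat (A y)) \<rho> (cnj \<rho>) \<eta> \<eta> u1 u2 (cnjv u1) (cnjv u2) \<and>
      (\<eta> = 0 \<or> \<eta> = 1 \<and> bil (cmat (g y)) u1 u1 = 0 \<and> bil (cmat (g y)) u2 u2 = 0))"
  have exists: "\<exists>\<rho>. ?good y \<rho>" if y: "y \<in> U" for y
  proof (rule selfadjoint_normal_form[OF g_sym[OF y] g_inv[OF y] A_selfadjoint_matrix[OF y]
        card[OF y, unfolded pc[OF y]] nonreal[OF y, unfolded pc[OF y]]])
    fix \<rho> \<eta> u1 u2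
    assume "Im \<rho> > 0" "two_double_eigenvalues (cmat (g y)) (cmat (A y)) \<rho> (cnj \<rho>) \<eta> \<eta> u1 u2 (cnjv u1) (cnjv u2)"
      "\<eta> = 0 \<or> \<eta> = 1 \<and> bil (cmat (g y)) u1 u1 = 0 \<and> bil (cmat (g y)) u2 u2 = 0"
    then show "\<exists>\<rho>. ?good y \<rho>"
      by (intro exI[of _ \<rho>] conjI exI[of _ \<eta>] exI[of _ u1] exI[of _ u2])
  qed
  have parts: "4 * Re \<rho> = trace (A y)" "4 * ((Re \<rho>)\<^sup>2 - (Im \<rho>)\<^sup>2) = trace (A y ** A y)" if "?good y \<rho>" for y \<rho>
  proof -
    have t: "complex_of_real (trace (mpow (A y) k)) = 2 * \<rho>^k + 2 * cnj \<rho>^k" for k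
      using that two_double_eigenvalues.trace_mpow unfolding trace_cmat[symmetric] cmat_mpow by blast
    show "4 * Re \<rho> = trace (A y)" using arg_cong[OF t[of 1], of Re] by simp
    show "4 * ((Re \<rho>)\<^sup>2 - (Im \<rho>)\<^sup>2) = trace (A y ** A y)"
      using arg_cong[OF t[of 2], of Re] by (simp add: power2_eq_square numeral_2_eq_2)
  qed
  obtain \<rho> where \<rho>: "?good x \<rho>" using exists[OF x] by blast
  have same: "?good y \<rho>" if y: "y \<in> W" for y
  proof -
    obtain \<rho>' where \<rho>': "?good y \<rho>'" using exists[OF W(4)[OF y]] by blast
    have re: "Re \<rho>' = Re \<rho>" using parts(1)[OF \<rho>] parts(1)[OF \<rho>'] tr1[OF y] tr1[OF W(3)] by simp
    then have "(Im \<rho>')\<^sup>2 = (Im \<rho>)\<^sup>2"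
      using parts(2)[OF \<rho>] parts(2)[OF \<rho>'] tr2[OF y] tr2[OF W(3)] by simp
    then have "Im \<rho>' = Im \<rho>" using \<rho> \<rho>' by (simp add: power2_eq_iff_nonneg)
    then have "\<rho>' = \<rho>" using re by (simp add: complex_eq_iff)
    then show ?thesis using \<rho>' by simp
  qed
  interpret W: hypersurface_patch T G W F g \<xi> \<kappa> by (rule restrict_patch[OF W(1,2)])
  interpret W: hypersurface_dim4 T G W F g \<xi> \<kappa> by unfold_locales
  have "\<exists>y\<in>W. \<kappa> + \<epsilon> y * ((Re \<rho>)\<^sup>2 + (Im \<rho>)\<^sup>2) = 0"
    by (rule W.constant_double_eigenvalues) (use same \<rho> W(3) in blast)+
  then have 1: "\<kappa> + \<epsilon> x * ((Re \<rho>)\<^sup>2 + (Im \<rho>)\<^sup>2) = 0" using \<epsilon>_const by auto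
  have "(Re \<rho>)\<^sup>2 - (Im \<rho>)\<^sup>2 = \<epsilon> x * \<kappa>" using parts(2)[OF \<rho>] tr2[OF W(3)] by simp
  then have "\<epsilon> x * ((Re \<rho>)\<^sup>2 - (Im \<rho>)\<^sup>2) = (\<epsilon> x * \<epsilon> x) * \<kappa>" by (simp add: mult.assoc)
  then have 2: "\<epsilon> x * ((Re \<rho>)\<^sup>2 - (Im \<rho>)\<^sup>2) = \<kappa>" by (simp add: \<epsilon>_square[OF x])
  have "2 * (\<epsilon> x * (Re \<rho>)\<^sup>2) = 0" using 1 2 by (simp add: algebra_simps)
  then have "Re \<rho> = 0" using \<xi>_unit[OF x] by auto
  then have "trace (A x) = 0" using parts(1)[OF \<rho>] by simp
  then show False using Hx mean_curvature_A[OF x] by simp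
qed

end

text \<open>
  Constant sectional curvature enters here, as the formula for the full curvature tensor.
\<close>

lemma local_unit_normal_patch:
  fixes \<A> :: "('m::{t2_space, second_countable_topology}, 4) chart set"
    and \<B> :: "('k::{t2_space, second_countable_topology}, 5) chart set"
  assumes sf: "space_form \<B> h s \<kappa>" and hyp: "nondegenerate_hypersurface \<A> g r \<B> h f"
    and un: "local_unit_normal \<A> \<B> h f c d U \<xi>"
  shows "hypersurface_4_in_5 (snd d ` fst d) (h d) U (local_rep c d f) (g c) \<xi> \<kappa>"
proof -
  let ?T = "snd d ` fst d" and ?G = "h d" and ?F = "local_rep c d f"
  have c: "c \<in> \<A>" and d: "d \<in> \<B>" and U: "open U" "U \<subseteq> local_dom c d f"
    and \<xi>: "unit_normal ?G ?F U \<xi>"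
    using un unfolding local_unit_normal_def by blast+
  have atB: "smooth_atlas \<B>" and mB: "pseudo_riemannian_metric \<B> h s"
    and sec: "\<And>y v w. y \<in> ?T \<Longrightarrow> area_form ?G y v w \<noteq> 0 \<Longrightarrow> sectional_curvature ?G y v w = \<kappa>"
    using sf d unfolding space_form_def by blast+
  have atA: "smooth_atlas \<A>" and mA: "pseudo_riemannian_metric \<A> g r" and im: "isometric_immersion \<A> g \<B> h f"
    using hyp unfolding nondegenerate_hypersurface_def by blast+
  have chc: "is_chart c" and chd: "is_chart d" using atA atB c d unfolding smooth_atlas_def by blast+
  have F_smooth: "smooth_on U ?F"
    using im c d U(2) smooth_on_subset unfolding isometric_immersion_def smooth_map_def by blast
  have U_c: "U \<subseteq> snd c ` fst c" using U(2) unfolding local_dom_def by blast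
  have F_into: "?F ` U \<subseteq> ?T"
  proof
    fix y assume "y \<in> ?F ` U"
    then obtain p where p: "p \<in> fst c" "f p \<in> fst d" "y = ?F (snd c p)"
      using U(2) unfolding local_dom_def by blast
    have "chart_inv c (snd c p) = p"
      using chc p(1) homeomorphism_apply1 unfolding is_chart_def by metis
    then show "y \<in> ?T" using p by (simp add: local_rep_def)
  qed
  have metric_c: "smooth_on (snd c ` fst c) (g c)"
    "\<And>x. x \<in> snd c ` fst c \<Longrightarrow> transpose (g c x) = g c x \<and> invertible (g c x)"
    using mA c unfolding pseudo_riemannian_metric_def by blast+
  have metric_d: "smooth_on ?T ?G" "\<And>y. y \<in> ?T \<Longrightarrow> transpose (?G y) = ?G y \<and> invertible (?G y)"
    using mB d unfolding pseudo_riemannian_metric_def by blast+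
  interpret smooth_metric ?T ?G
    by unfold_locales (use chd metric_d in \<open>auto simp: is_chart_def\<close>)
  have curvature: "riemann ?G y v w z = \<kappa> *\<^sub>R (ip ?G y w z *\<^sub>R v - ip ?G y v z *\<^sub>R w)" if "y \<in> ?T" for y v w z
    by (rule constant_curvature_tensor[OF that _ sec[OF that]]) simp
  show ?thesis
  proof
    show "open U" "smooth_on U ?F" "?F ` U \<subseteq> ?T" by (fact U(1) F_smooth F_into)+
    show "CARD(5) = CARD(4) + 1" by simp
    show "smooth_on U (g c)" by (rule smooth_on_subset[OF metric_c(1) U_c])
    show "smooth_on U \<xi>" using \<xi> unfolding unit_normal_def by blast
    fix x assume x: "x \<in> U"
    show "transpose (g c x) = g c x" "invertible (g c x)" using metric_c(2) U_c x by blast+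
    show "ip (g c) x v w = ip ?G (?F x) (frechet_derivative ?F (at x) v) (frechet_derivative ?F (at x) w)" for v w
      using im c d U(2) x unfolding isometric_immersion_def by blast
    show "ip ?G (?F x) (\<xi> x) (\<xi> x) \<in> {1, -1}" "ip ?G (?F x) (frechet_derivative ?F (at x) v) (\<xi> x) = 0" for v
      using \<xi> x unfolding unit_normal_def by blast+
  next
    show "riemann ?G y v w z = \<kappa> *\<^sub>R (ip ?G y w z *\<^sub>R v - ip ?G y v z *\<^sub>R w)" if "y \<in> ?T" for y v w z
      by (rule curvature[OF that])
  qed
qed

theorem corollary4p11:
  fixes \<A> :: "('m::{t2_space, second_countable_topology}, 4) chart set"
    and g :: "('m, 4) chart \<Rightarrow> 4 metric_field"
    and \<B> :: "('k::{t2_space, second_countable_topology}, 5) chart set"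
    and h :: "('k, 5) chart \<Rightarrow> 5 metric_field"
    and f :: "'m \<Rightarrow> 'k"
    and \<kappa> :: real
    and r s :: nat
  assumes "space_form \<B> h s \<kappa>"
    and "nondegenerate_hypersurface \<A> g r \<B> h f"
    and "biharmonic_hypersurface \<A> g \<B> h \<kappa> f"
    and "\<And>c d U \<xi> x. local_unit_normal \<A> \<B> h f c d U \<xi> \<Longrightarrow> x \<in> U \<Longrightarrow>
           card (principal_curvatures (h d) (local_rep c d f) \<xi> x) = 2"
    and "\<And>c d U \<xi> x \<mu>. local_unit_normal \<A> \<B> h f c d U \<xi> \<Longrightarrow> x \<in> U \<Longrightarrow>
           \<mu> \<in> principal_curvatures (h d) (local_rep c d f) \<xi> x \<Longrightarrow> Im \<mu> \<noteq> 0"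
  shows "minimal_hypersurface \<A> \<B> h f"
  unfolding minimal_hypersurface_def
proof (intro allI impI ballI)
  fix c d U \<xi> x
  assume un: "local_unit_normal \<A> \<B> h f c d U \<xi>" and x: "x \<in> U"
  interpret hypersurface_4_in_5 "snd d ` fst d" "h d" U "local_rep c d f" "g c" \<xi> \<kappa>
    by (rule local_unit_normal_patch[OF assms(1,2) un])
  show "mean_curvature (h d) (local_rep c d f) \<xi> x = 0"
  proof (rule biharmonic_two_nonreal_minimal[OF x])
    fix y assume y: "y \<in> U"
    show "has_laplacian (g c) (h d) (local_rep c d f) (mean_curvature_vector (h d) (local_rep c d f) \<xi>) y
        ((4 * \<kappa>) *\<^sub>R mean_curvature_vector (h d) (local_rep c d f) \<xi> y)"
      using assms(3) un y unfolding biharmonic_hypersurface_def by blast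
    show "card (principal_curvatures (h d) (local_rep c d f) \<xi> y) = 2" by (rule assms(4)[OF un y])
    show "Im \<mu> \<noteq> 0" if "\<mu> \<in> principal_curvatures (h d) (local_rep c d f) \<xi> y" for \<mu>
      by (rule assms(5)[OF un y that])
  qed
qed

end
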